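(* Let $(M,m)$ be a closed weighted Riemannian manifold, let $k\ge 1$ be an integer and let $p\in[1,\infty)$. For any sequence $\{A_\alpha\}_{\alpha=0}^{k}$ of Borel subsets of $M$ we have $$\nu_{k,p}(M,m)^{\frac1p}\le \frac{2}{\mathcal{D}(\{A_\alpha\})}\max_{\alpha=0,\dots,k}\log\frac{e\left(1-\sum_{\beta\ne\alpha}m(A_\beta)\right)}{m(A_\alpha)}.$$
   Context: A closed weighted Riemannian manifold $(M,m)$ is a connected compact Riemannian manifold $(M,g)$ without boundary, with Riemannian distance $d$ and Riemannian volume measure $v_g$, together with the probability measure $m=e^{-f}v_g$, where $f\in C^\infty(M)$ satisfies $\int_M e^{-f}\,dv_g=1$. $\nabla$ and $\|\cdot\|$ are the gradient and norm induced from $g$; $W^{1,p}(M,m)$ is the $(1,p)$-Sobolev space of real functions; $\mathcal{C}$ is the set of all constant functions on $M$. The $k$-th (Neumann) $p$-Poincaré constant is $$\nu_{k,p}(M,m):=\inf_{L_k}\sup_{\phi\in L_k\setminus\{0\}}\frac{\int_M\|\nabla\phi\|^p\,dm}{\int_M\left|\phi-\int_M\phi\,dm\right|^p dm},$$ where the infimum is over all $k$-dimensional subspaces $L_k$ of $W^{1,p}(M,m)$ with $L_k\cap\mathcal{C}=\{0\}$. $\mathcal{D}(\{A_\alpha\}):=\min_{\alpha\ne\beta}d(A_\alpha,A_\beta)$, with $d(A_\alpha,A_\beta):=\inf\{d(x,y)\mid x\in A_\alpha,\ y\in A_\beta\}$. Convention: if $\mathcal{D}(\{A_\alpha\})=0$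 or $m(A_\alpha)=0$ for some $\alpha$, the right-hand side is understood as $+\infty$. $\log$ is the natural logarithm. *)

theory Defs
  imports "HOL-Analysis.Analysis"
begin

section \<open>Smooth maps between open subsets of Euclidean spaces\<close>

primrec Ck_on ::
  "nat \<Rightarrow> 'u::real_normed_vector set \<Rightarrow> ('u \<Rightarrow> 'w::real_normed_vector) \<Rightarrow> bool"
where
  "Ck_on 0 S f \<longleftrightarrow> continuous_on S f"
| "Ck_on (Suc k) S f \<longleftrightarrow>
     (\<forall>x\<in>S. f differentiable (at x)) \<and> (\<forall>u. Ck_on k S (\<lambda>x. frechet_derivative f (at x) u))"

definition smooth_on ::
  "'u::real_normed_vector set \<Rightarrow> ('u \<Rightarrow> 'w::real_normed_vector) \<Rightarrow> bool" where
  "smooth_on S f \<longleftrightarrow> (\<forall>k. Ck_on k S f)"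


section \<open>Riemannian manifolds\<close>

text \<open>The underlying space of the manifold is a whole type \<open>'a\<close>; a chart is a pair of its open
  domain and its coordinate map, whose values outside the domain are irrelevant.\<close>

type_synonym ('a, 'n) chart = "'a set \<times> ('a \<Rightarrow> real ^ 'n)"

text \<open>A vector field is given by its components in every chart: \<open>X c q\<close> is the component vector
  at \<open>q\<close> with respect to the coordinate frame of \<open>c\<close>, and matters only for \<open>q \<in> fst c\<close>.\<close>

type_synonym ('a, 'n) vfield = "('a, 'n) chart \<Rightarrow> 'a \<Rightarrow> real ^ 'n"

text \<open>Likewise \<open>metric M c q\<close> is the inner product on the tangent space at \<open>q\<close>, expressed in the
  coordinates of \<open>c\<close>.\<close>

record ('a, 'n) riem =
  atlas :: "('a, 'n::finite) chart set"
  metric :: "('a, 'n) chart \<Rightarrow> 'a \<Rightarrow> real ^ 'n \<Rightarrow> real ^ 'n \<Rightarrow> real"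

definition chart_inv :: "('a, 'n::finite) chart \<Rightarrow> real ^ 'n \<Rightarrow> 'a" where
  "chart_inv c = inv_into (fst c) (snd c)"

definition transition ::
  "('a, 'n::finite) chart \<Rightarrow> ('a, 'n) chart \<Rightarrow> real ^ 'n \<Rightarrow> real ^ 'n" where
  "transition c c' = snd c' \<circ> chart_inv c"

text \<open>The coordinate change of tangent vectors at \<open>q\<close>, from the frame of \<open>c\<close> to that of \<open>c'\<close>.\<close>

definition dtransition ::
  "('a, 'n::finite) chart \<Rightarrow> ('a, 'n) chart \<Rightarrow> 'a \<Rightarrow> real ^ 'n \<Rightarrow> real ^ 'n" where
  "dtransition c c' q = frechet_derivative (transition c c') (at (snd c q))"

definition smooth_atlas :: "('a::topological_space, 'n::finite) chart set \<Rightarrow> bool" where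
  "smooth_atlas C \<longleftrightarrow>
     (\<forall>c\<in>C. open (fst c) \<and> open (snd c ` fst c) \<and>
        homeomorphism (fst c) (snd c ` fst c) (snd c) (chart_inv c)) \<and>
     (\<Union>c\<in>C. fst c) = UNIV \<and>
     (\<forall>c\<in>C. \<forall>c'\<in>C. smooth_on (snd c ` (fst c \<inter> fst c')) (transition c c'))"

definition smooth_metric :: "('a, 'n::finite) riem \<Rightarrow> bool" where
  "smooth_metric M \<longleftrightarrow>
     (\<forall>c\<in>atlas M. \<forall>q\<in>fst c. bilinear (metric M c q) \<and>
        (\<forall>u w. metric M c q u w = metric M c q w u) \<and>
        (\<forall>u. u \<noteq> 0 \<longrightarrow> 0 < metric M c q u u)) \<and>
     (\<forall>c\<in>atlas M. \<forall>u w. smooth_on (snd c ` fst c) (\<lambda>y. metric M c (chart_inv c y) u w)) \<and>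
     (\<forall>c\<in>atlas M. \<forall>c'\<in>atlas M. \<forall>q\<in>fst c \<inter> fst c'. \<forall>u w.
        metric M c q u w = metric M c' q (dtransition c c' q u) (dtransition c c' q w))"

definition smooth_function :: "('a, 'n::finite) riem \<Rightarrow> ('a \<Rightarrow> real) \<Rightarrow> bool" where
  "smooth_function M h \<longleftrightarrow>
     (\<forall>c\<in>atlas M. smooth_on (snd c ` fst c) (\<lambda>y. h (chart_inv c y)))"

definition chart_at :: "('a, 'n::finite) riem \<Rightarrow> 'a \<Rightarrow> ('a, 'n) chart" where
  "chart_at M q = (SOME c. c \<in> atlas M \<and> q \<in> fst c)"


subsection \<open>Riemannian distance\<close>

definition C1_curve_on ::
  "('a::topological_space, 'n::finite) riem \<Rightarrow> real \<Rightarrow> real \<Rightarrow> (real \<Rightarrow> 'a) \<Rightarrow> bool" where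
  "C1_curve_on M a b \<gamma> \<longleftrightarrow> continuous_on {a..b} \<gamma> \<and>
     (\<forall>c\<in>atlas M.
        (\<forall>t\<in>{a..b} \<inter> \<gamma> -` fst c. (snd c \<circ> \<gamma>) differentiable (at t within {a..b})) \<and>
        continuous_on ({a..b} \<inter> \<gamma> -` fst c)
          (\<lambda>t. vector_derivative (snd c \<circ> \<gamma>) (at t within {a..b})))"

definition piecewise_C1_curve ::
  "('a::topological_space, 'n::finite) riem \<Rightarrow> (real \<Rightarrow> 'a) \<Rightarrow> bool" where
  "piecewise_C1_curve M \<gamma> \<longleftrightarrow>
     (\<exists>N (s :: nat \<Rightarrow> real). s 0 = 0 \<and> s N = 1 \<and>
        (\<forall>i<N. s i < s (Suc i) \<and> C1_curve_on M (s i) (s (Suc i)) \<gamma>))"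

text \<open>The speed is meaningless at the finitely many break points of a piecewise \<open>C\<^sup>1\<close> curve; these
  do not contribute to the length.\<close>

definition speed :: "('a, 'n::finite) riem \<Rightarrow> (real \<Rightarrow> 'a) \<Rightarrow> real \<Rightarrow> real" where
  "speed M \<gamma> t =
     (let c = chart_at M (\<gamma> t); u = vector_derivative (snd c \<circ> \<gamma>) (at t)
      in sqrt (metric M c (\<gamma> t) u u))"

definition curve_length :: "('a, 'n::finite) riem \<Rightarrow> (real \<Rightarrow> 'a) \<Rightarrow> ennreal" where
  "curve_length M \<gamma> = (\<integral>\<^sup>+ t\<in>{0..1}. ennreal (speed M \<gamma> t) \<partial>lborel)"

definition riem_dist :: "('a::topological_space, 'n::finite) riem \<Rightarrow> 'a \<Rightarrow> 'a \<Rightarrow> ennreal" where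
  "riem_dist M x y =
     (INF \<gamma>\<in>{\<gamma>. piecewise_C1_curve M \<gamma> \<and> \<gamma> 0 = x \<and> \<gamma> 1 = y}. curve_length M \<gamma>)"

definition riem_setdist ::
  "('a::topological_space, 'n::finite) riem \<Rightarrow> 'a set \<Rightarrow> 'a set \<Rightarrow> ennreal" where
  "riem_setdist M S T = (INF x\<in>S. INF y\<in>T. riem_dist M x y)"

definition separation ::
  "('a::topological_space, 'n::finite) riem \<Rightarrow> nat \<Rightarrow> (nat \<Rightarrow> 'a set) \<Rightarrow> ennreal" where
  "separation M k A =
     Min {riem_setdist M (A \<alpha>) (A \<beta>) | \<alpha> \<beta>. \<alpha> \<le> k \<and> \<beta> \<le> k \<and> \<alpha> \<noteq> \<beta>}"


subsection \<open>Riemannian volume and weighted manifolds\<close>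

definition gram_matrix :: "('a, 'n::finite) riem \<Rightarrow> ('a, 'n) chart \<Rightarrow> 'a \<Rightarrow> real ^ 'n ^ 'n" where
  "gram_matrix M c q = (\<chi> i j. metric M c q (axis i 1) (axis j 1))"

text \<open>The Riemannian volume measure is the unique Borel measure with density \<open>sqrt (det (g i j))\<close>
  with respect to Lebesgue measure in every chart of the atlas.\<close>

definition riemannian_volume ::
  "('a::topological_space, 'n::finite) riem \<Rightarrow> 'a measure \<Rightarrow> bool" where
  "riemannian_volume M v \<longleftrightarrow> sets v = sets borel \<and>
     (\<forall>c\<in>atlas M. \<forall>B\<in>sets borel. B \<subseteq> fst c \<longrightarrow>
        emeasure v B =
          (\<integral>\<^sup>+ y\<in>snd c ` B. ennreal (sqrt (det (gram_matrix M c (chart_inv c y)))) \<partial>lborel))"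

definition weighted_measure :: "'a measure \<Rightarrow> ('a \<Rightarrow> real) \<Rightarrow> 'a measure" where
  "weighted_measure v f = density v (\<lambda>x. ennreal (exp (- f x)))"

definition closed_weighted_riemannian_manifold ::
  "('a::{t2_space, second_countable_topology}, 'n::finite) riem \<Rightarrow> 'a measure \<Rightarrow>
     ('a \<Rightarrow> real) \<Rightarrow> bool" where
  "closed_weighted_riemannian_manifold M v f \<longleftrightarrow>
     compact (UNIV :: 'a set) \<and> connected (UNIV :: 'a set) \<and>
     smooth_atlas (atlas M) \<and> smooth_metric M \<and> riemannian_volume M v \<and>
     smooth_function M f \<and> (\<integral>x. exp (- f x) \<partial>v) = 1"


section \<open>Sobolev spaces\<close>

definition vector_field ::
  "('a::topological_space, 'n::finite) riem \<Rightarrow> ('a, 'n) vfield \<Rightarrow> bool" where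
  "vector_field M X \<longleftrightarrow>
     (\<forall>c\<in>atlas M. \<forall>c'\<in>atlas M. \<forall>q\<in>fst c \<inter> fst c'. X c' q = dtransition c c' q (X c q))"

definition measurable_vector_field ::
  "('a::topological_space, 'n::finite) riem \<Rightarrow> ('a, 'n) vfield \<Rightarrow> bool" where
  "measurable_vector_field M X \<longleftrightarrow> vector_field M X \<and>
     (\<forall>c\<in>atlas M. X c \<in> borel_measurable (restrict_space borel (fst c)))"

definition vf_norm :: "('a, 'n::finite) riem \<Rightarrow> ('a, 'n) vfield \<Rightarrow> 'a \<Rightarrow> real" where
  "vf_norm M X q = (let c = chart_at M q in sqrt (metric M c q (X c q) (X c q)))"

definition test_function :: "(real ^ 'n::finite) set \<Rightarrow> (real ^ 'n \<Rightarrow> real) \<Rightarrow> bool" where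
  "test_function S \<eta> \<longleftrightarrow> smooth_on UNIV \<eta> \<and>
     (\<exists>K. compact K \<and> K \<subseteq> S \<and> (\<forall>y. y \<notin> K \<longrightarrow> \<eta> y = 0))"

text \<open>\<open>X\<close> is a weak gradient of \<open>\<phi>\<close> if in every chart the covector \<open>g(X, -)\<close> is the distributional
  differential of \<open>\<phi>\<close>. It is unique up to null sets.\<close>

definition weak_gradient ::
  "('a::topological_space, 'n::finite) riem \<Rightarrow> ('a \<Rightarrow> real) \<Rightarrow> ('a, 'n) vfield \<Rightarrow> bool" where
  "weak_gradient M \<phi> X \<longleftrightarrow> measurable_vector_field M X \<and>
     (\<forall>c\<in>atlas M. \<forall>u \<eta>. test_function (snd c ` fst c) \<eta> \<longrightarrow>
        (LINT y:snd c ` fst c|lborel. \<phi> (chart_inv c y) * frechet_derivative \<eta> (at y) u) =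
        - (LINT y:snd c ` fst c|lborel.
             metric M c (chart_inv c y) (X c (chart_inv c y)) u * \<eta> y))"

definition gradient ::
  "('a::topological_space, 'n::finite) riem \<Rightarrow> ('a \<Rightarrow> real) \<Rightarrow> ('a, 'n) vfield" where
  "gradient M \<phi> = (SOME X. weak_gradient M \<phi> X)"

definition sobolev ::
  "('a::topological_space, 'n::finite) riem \<Rightarrow> 'a measure \<Rightarrow> real \<Rightarrow> ('a \<Rightarrow> real) set" where
  "sobolev M m p =
     {\<phi>. \<phi> \<in> borel_measurable borel \<and> integrable m (\<lambda>x. \<bar>\<phi> x\<bar> powr p) \<and>
        (\<exists>X. weak_gradient M \<phi> X \<and> integrable m (\<lambda>x. vf_norm M X x powr p))}"

text \<open>Elements of \<open>W\<^sup>1\<^sup>,\<^sup>p\<close> are classes of functions modulo equality almost everywhere. A subspace of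
  it is represented by the set \<open>L\<close> of all representatives of its elements, so that \<open>L\<close> is closed
  under modification on null sets, and zero, constancy, linear independence and spanning are
  understood almost everywhere.\<close>

definition sobolev_subspace ::
  "('a::topological_space, 'n::finite) riem \<Rightarrow> 'a measure \<Rightarrow> real \<Rightarrow> ('a \<Rightarrow> real) set \<Rightarrow> bool" where
  "sobolev_subspace M m p L \<longleftrightarrow> L \<subseteq> sobolev M m p \<and> (\<lambda>x. 0) \<in> L \<and>
     (\<forall>\<phi>\<in>L. \<forall>\<psi>\<in>L. (\<lambda>x. \<phi> x + \<psi> x) \<in> L) \<and>
     (\<forall>\<phi>\<in>L. \<forall>a::real. (\<lambda>x. a * \<phi> x) \<in> L) \<and>
     (\<forall>\<phi>\<in>L. \<forall>\<psi>\<in>borel_measurable borel. (AE x in m. \<psi> x = \<phi> x) \<longrightarrow> \<psi> \<in> L)"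

definition has_ae_dim :: "'a measure \<Rightarrow> ('a \<Rightarrow> real) set \<Rightarrow> nat \<Rightarrow> bool" where
  "has_ae_dim m L k \<longleftrightarrow>
     (\<exists>b :: nat \<Rightarrow> 'a \<Rightarrow> real. (\<forall>i<k. b i \<in> L) \<and>
        (\<forall>a :: nat \<Rightarrow> real. (AE x in m. (\<Sum>i<k. a i * b i x) = 0) \<longrightarrow> (\<forall>i<k. a i = 0)) \<and>
        (\<forall>\<phi>\<in>L. \<exists>a :: nat \<Rightarrow> real. AE x in m. \<phi> x = (\<Sum>i<k. a i * b i x)))"

definition ae_zero :: "'a measure \<Rightarrow> ('a \<Rightarrow> real) \<Rightarrow> bool" where
  "ae_zero m \<phi> \<longleftrightarrow> (AE x in m. \<phi> x = 0)"

definition ae_constant :: "'a measure \<Rightarrow> ('a \<Rightarrow> real) \<Rightarrow> bool" where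
  "ae_constant m \<phi> \<longleftrightarrow> (\<exists>a. AE x in m. \<phi> x = a)"


section \<open>Poincare constants\<close>

definition rayleigh ::
  "('a::topological_space, 'n::finite) riem \<Rightarrow> 'a measure \<Rightarrow> real \<Rightarrow> ('a \<Rightarrow> real) \<Rightarrow> real" where
  "rayleigh M m p \<phi> =
     (\<integral>x. vf_norm M (gradient M \<phi>) x powr p \<partial>m) / (\<integral>x. \<bar>\<phi> x - (\<integral>y. \<phi> y \<partial>m)\<bar> powr p \<partial>m)"

definition poincare_const ::
  "('a::topological_space, 'n::finite) riem \<Rightarrow> 'a measure \<Rightarrow> nat \<Rightarrow> real \<Rightarrow> ereal" where
  "poincare_const M m k p =
     (INF L\<in>{L. sobolev_subspace M m p L \<and> has_ae_dim m L k \<and>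
                 (\<forall>\<phi>\<in>L. ae_constant m \<phi> \<longrightarrow> ae_zero m \<phi>)}.
        SUP \<phi>\<in>{\<phi>\<in>L. \<not> ae_zero m \<phi>}. ereal (rayleigh M m p \<phi>))"

text \<open>Power with positive exponent on \<open>[0, \<infinity>]\<close>.\<close>

definition ereal_powr :: "ereal \<Rightarrow> real \<Rightarrow> ereal" where
  "ereal_powr x s = (if x = \<infinity> then \<infinity> else ereal (real_of_ereal x powr s))"

text \<open>The right-hand side of the inequality, including the convention for degenerate families.\<close>

definition separation_bound ::
  "('a::topological_space, 'n::finite) riem \<Rightarrow> 'a measure \<Rightarrow> nat \<Rightarrow> (nat \<Rightarrow> 'a set) \<Rightarrow> ereal" where
  "separation_bound M m k A =
     (if separation M k A = 0 \<or> (\<exists>\<alpha>\<le>k. measure m (A \<alpha>) = 0) then \<infinity>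
      else ereal (2 / enn2real (separation M k A) *
        (MAX \<alpha>\<in>{..k}. ln (exp 1 * (1 - (\<Sum>\<beta>\<in>{..k} - {\<alpha>}. measure m (A \<beta>))) / measure m (A \<alpha>)))))"

end

theory Submission
  imports Defs
begin

text \<open>
  The Poincare constant is an infimum over subspaces, so it is bounded by exhibiting one. Let
  \<open>\<phi>\<^sub>0, \<dots>, \<phi>\<^sub>k\<close> be nonnegative and nonzero with pairwise disjoint supports. The
  combinations \<open>\<psi> = \<Sum> a\<^sub>i \<phi>\<^sub>i\<close> of mean zero form a space of dimension \<open>k\<close> without nonzero
  constants. Mean zero removes the average from the denominator of the Rayleigh quotient, and
  disjointness makes both \<open>\<integral>|\<nabla>\<psi>|\<^sup>p\<close> and \<open>\<integral>|\<psi>|\<^sup>p\<close> additive in \<open>i\<close>. So the Rayleigh quotient of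
  \<open>\<psi>\<close> is at most \<open>R\<close> as soon as \<open>\<integral>|\<nabla>\<phi>\<^sub>i|\<^sup>p \<le> R \<integral>\<phi>\<^sub>i\<^sup>p\<close> for every \<open>i\<close>
  (\<open>poincare_const_le_disjoint_functions\<close>).

  The function \<open>\<phi>\<^sub>\<alpha>\<close> is a profile of the distance to \<open>A\<^sub>\<alpha>\<close> that vanishes at distance \<open>T\<close> from
  \<open>A\<^sub>\<alpha>\<close>, where \<open>2T < D\<close>; hence the supports are disjoint, and the support of \<open>\<phi>\<^sub>\<alpha>\<close> avoids the
  other sets and has mass at most \<open>Q\<^sub>\<alpha> = 1 - \<Sum>\<^bsub>\<beta>\<noteq>\<alpha>\<^esub> m(A\<^sub>\<beta>)\<close>. The profile is \<open>H(\<kappa> s)\<close>, where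
  \<open>s\<close> grows from \<open>0\<close> to \<open>T\<close> with slope \<open>1\<close> on the way to \<open>A\<^sub>\<alpha>\<close>, and where \<open>H(t) = t\<close> for
  \<open>t \<le> 1\<close> and \<open>H(t) = e\<^bsup>t-1\<^esup>\<close> for \<open>t \<ge> 1\<close>. Since \<open>H' = max 1 H\<close> for \<open>t \<ge> 0\<close>, one has
  \<open>|\<nabla>\<phi>|\<^sup>p \<le> \<kappa>\<^sup>p (1 + \<phi>\<^sup>p)\<close>, and the gradient vanishes on \<open>A\<^sub>\<alpha>\<close>. The extra term \<open>\<kappa>\<^sup>p\<close> integrates
  to at most \<open>\<kappa>\<^sup>p Q\<^sub>\<alpha>\<close>, which is absorbed by the part of \<open>\<integral>\<phi>\<^sup>p\<close> over \<open>A\<^sub>\<alpha>\<close>, namely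
  \<open>H(\<kappa>T)\<^sup>p m(A\<^sub>\<alpha>)\<close>, once \<open>H(\<kappa>T) \<ge> Q\<^sub>\<alpha> / m(A\<^sub>\<alpha>)\<close>; that is \<open>\<kappa>T \<ge> log (e Q\<^sub>\<alpha> / m(A\<^sub>\<alpha>))\<close>
  (\<open>slope_integral_le\<close>). The two branches of \<open>H\<close> are responsible for the constant \<open>e\<close>.
  Then \<open>R = \<kappa>\<^sup>p\<close>, and \<open>T \<rightarrow> D/2\<close> gives the theorem.

  The distance function itself is only Lipschitz. It is replaced by a continuously differentiable
  function whose slope exceeds \<open>1\<close> by an arbitrarily small amount, so that weak gradients are
  classical gradients, computed in charts. At a small scale \<open>\<delta>\<close> the metric is almost constant in
  suitable coordinates, and a smooth maximum of finitely many coordinate cones rises from \<open>0\<close> to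
  \<open>1\<close> within distance \<open>\<delta>\<close> of a given set (\<open>exists_layer\<close>). Stacking such layers, whose gradients
  live on disjoint shells, gives the cut-off \<open>s\<close> (\<open>exists_cutoff\<close>). Distances enter only through
  chains of coordinate segments: the relation of being joined by a chain is obviously symmetric
  and transitive, and a chain of length \<open>L\<close> yields a curve of length at most \<open>L\<close>
  (\<open>riem_dist_le_chain\<close>).

  The Rayleigh quotient refers to an arbitrarily chosen weak gradient, and its defining identity
  may hold merely because the integral of a non-integrable function is \<open>0\<close> by convention. If the
  \<open>p\<close>-th power of its norm is integrable, then it is locally integrable, and the fundamental lemma
  of the calculus of variations identifies it with the classical gradient
  (\<open>weak_gradient_unique\<close>). Otherwise the numerator is \<open>0\<close> by convention.
\<close>

section \<open>Smooth bumps and integration by parts in Euclidean space\<close>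

text \<open>The functions \<open>x \<mapsto> P(1/x) e\<^bsup>-1/x\<^esup>\<close>, extended by \<open>0\<close>. With an arbitrary polynomial \<open>P\<close> this
  family is closed under differentiation, so smoothness of all members is a single induction.\<close>

definition flat :: "real poly \<Rightarrow> real \<Rightarrow> real" where
  "flat P x = (if x > 0 then poly P (1 / x) * exp (- (1 / x)) else 0)"

lemma poly_times_exp_minus_tendsto_0:
  fixes P :: "real poly"
  shows "((\<lambda>t. poly P t * exp (- t)) \<longlongrightarrow> 0) at_top"
proof -
  have "((\<lambda>t. \<Sum>i\<le>degree P. coeff P i * (t ^ i / exp t)) \<longlongrightarrow> (\<Sum>i\<le>degree P. coeff P i * 0)) at_top"
    by (intro tendsto_sum tendsto_mult tendsto_const tendsto_power_div_exp_0)
  moreover have "(\<lambda>t. poly P t * exp (- t)) = (\<lambda>t. \<Sum>i\<le>degree P. coeff P i * (t ^ i / exp t))"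
    by (auto simp: poly_altdef exp_minus sum_divide_distrib field_simps)
  ultimately show ?thesis by simp
qed

lemma flat_has_real_derivative:
  "(flat P has_real_derivative flat ([:0, 0, 1:] * (P - pderiv P)) x) (at x)"
proof -
  consider "x > 0" | "x < 0" | "x = 0" by linarith
  then show ?thesis
  proof cases
    case 1
    have "((\<lambda>x. poly P (1 / x) * exp (- (1 / x))) has_real_derivative
        flat ([:0, 0, 1:] * (P - pderiv P)) x) (at x)"
      using 1 unfolding flat_def
      by (auto intro!: derivative_eq_intros poly_DERIV[THEN DERIV_chain2]
          simp: field_simps power2_eq_square)
    then show ?thesis
      by (rule has_field_derivative_transform_within_open[where S="{0<..}"])
         (use 1 in \<open>auto simp: flat_def\<close>)
  next
    case 2
    have "((\<lambda>x. 0) has_real_derivative flat ([:0, 0, 1:] * (P - pderiv P)) x) (at x)"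
      using 2 by (auto simp: flat_def)
    then show ?thesis
      by (rule has_field_derivative_transform_within_open[where S="{..<0}"])
         (use 2 in \<open>auto simp: flat_def\<close>)
  next
    case 3
    have "((\<lambda>h. poly (pCons 0 P) (1 / h) * exp (- (1 / h))) \<longlongrightarrow> 0) (at_right 0)"
      using filterlim_compose[OF poly_times_exp_minus_tendsto_0[of "pCons 0 P"]
          filterlim_inverse_at_top_right] by (simp add: inverse_eq_divide)
    then have "((\<lambda>h. flat P h / h) \<longlongrightarrow> 0) (at_right 0)"
      by (rule Lim_transform_eventually)
         (auto simp: flat_def eventually_at_filter intro!: always_eventually)
    moreover have "((\<lambda>h. flat P h / h) \<longlongrightarrow> 0) (at_left 0)"
      by (rule Lim_transform_eventually[of "\<lambda>_. 0"])
         (auto simp: flat_def eventually_at_filter intro!: always_eventually)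
    ultimately have "((\<lambda>h. flat P h / h) \<longlongrightarrow> 0) (at 0)"
      by (simp add: filterlim_split_at)
    then show ?thesis
      using 3 by (simp add: DERIV_def flat_def)
  qed
qed

lemma continuous_on_flat: "continuous_on S (flat P)"
  using flat_has_real_derivative DERIV_isCont continuous_at_imp_continuous_on by blast

lemma Ck_on_Suc_imp: "Ck_on (Suc k) UNIV f \<Longrightarrow> Ck_on k UNIV f"
proof (induction k arbitrary: f)
  case 0
  then show ?case
    by (auto intro!: continuous_at_imp_continuous_on differentiable_imp_continuous_within)
next
  case (Suc k)
  then show ?case by (auto simp del: Ck_on.simps(1))
qed

lemma Ck_on_add:
  "Ck_on k UNIV f \<Longrightarrow> Ck_on k UNIV g \<Longrightarrow> Ck_on k UNIV (\<lambda>x. f x + g x)"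
proof (induction k arbitrary: f g)
  case 0
  then show ?case by (auto intro!: continuous_intros)
next
  case (Suc k)
  have "((\<lambda>x. f x + g x) has_derivative
      (\<lambda>u. frechet_derivative f (at x) u + frechet_derivative g (at x) u)) (at x)" for x
    using Suc.prems by (auto intro!: has_derivative_add simp: frechet_derivative_works)
  then have eq: "frechet_derivative (\<lambda>x. f x + g x) (at x) =
      (\<lambda>u. frechet_derivative f (at x) u + frechet_derivative g (at x) u)" for x
    by (metis frechet_derivative_at)
  show ?case
    using Suc by (auto simp: eq)
qed

lemma Ck_on_mult:
  fixes f g :: "'a::real_normed_vector \<Rightarrow> real"
  shows "Ck_on k UNIV f \<Longrightarrow> Ck_on k UNIV g \<Longrightarrow> Ck_on k UNIV (\<lambda>x. f x * g x)"
proof (induction k arbitrary: f g)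
  case 0
  then show ?case by (auto intro!: continuous_intros)
next
  case (Suc k)
  have "((\<lambda>x. f x * g x) has_derivative
      (\<lambda>u. f x * frechet_derivative g (at x) u + frechet_derivative f (at x) u * g x)) (at x)" for x
    using Suc.prems by (auto intro!: has_derivative_mult simp: frechet_derivative_works)
  then have eq: "frechet_derivative (\<lambda>x. f x * g x) (at x) =
      (\<lambda>u. f x * frechet_derivative g (at x) u + frechet_derivative f (at x) u * g x)" for x
    by (metis frechet_derivative_at)
  have "Ck_on k UNIV f" "Ck_on k UNIV g"
    using Suc.prems Ck_on_Suc_imp by blast+
  then show ?case
    using Suc by (auto simp: eq intro!: Ck_on_add)
qed

lemma Ck_on_const: "Ck_on k UNIV (\<lambda>x. c)"
  by (induction k arbitrary: c) (auto simp: frechet_derivative_const)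

lemma Ck_on_prod:
  fixes f :: "'i \<Rightarrow> 'a::real_normed_vector \<Rightarrow> real"
  assumes "\<And>i. i \<in> I \<Longrightarrow> Ck_on k UNIV (f i)"
  shows "Ck_on k UNIV (\<lambda>x. \<Prod>i\<in>I. f i x)"
  using assms by (induction I rule: infinite_finite_induct) (auto intro!: Ck_on_const Ck_on_mult)

text \<open>The polynomial is generalised in the induction: differentiating replaces it by another one.\<close>

lemma Ck_on_flat:
  assumes "bounded_linear l"
  shows "Ck_on k UNIV (\<lambda>y. flat P (l y + c))"
proof (induction k arbitrary: P)
  case 0
  have "continuous_on UNIV l" using assms linear_continuous_on by blast
  then show ?case
    by (auto intro!: continuous_on_compose2[OF continuous_on_flat[of UNIV]] continuous_intros)
next
  case (Suc k)
  have der: "((\<lambda>y. flat P (l y + c)) has_derivative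
      (\<lambda>u. l u * flat ([:0, 0, 1:] * (P - pderiv P)) (l x + c))) (at x)" for x
  proof -
    have "((\<lambda>y. l y + c) has_derivative l) (at x)"
      by (auto intro!: derivative_eq_intros bounded_linear_imp_has_derivative assms)
    from DERIV_compose_FDERIV[OF flat_has_real_derivative this]
    show ?thesis by simp
  qed
  then have eq: "frechet_derivative (\<lambda>y. flat P (l y + c)) (at x) =
      (\<lambda>u. l u * flat ([:0, 0, 1:] * (P - pderiv P)) (l x + c))" for x
    by (metis frechet_derivative_at)
  have "Ck_on k UNIV (\<lambda>y. l u * flat ([:0, 0, 1:] * (P - pderiv P)) (l y + c))" for u
    by (intro Ck_on_mult Ck_on_const Suc)
  then show ?case
    using der by (auto simp: eq differentiable_def simp del: mult_pCons_left)
qed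

text \<open>Since \<open>e\<^bsup>-1/(N t)\<^esup> \<rightarrow> 1\<close> for \<open>t > 0\<close>, these bumps converge to the indicator of the open box as
  \<open>N \<rightarrow> \<infinity>\<close>.\<close>

definition box_bump :: "real ^ 'n \<Rightarrow> real ^ 'n \<Rightarrow> nat \<Rightarrow> real ^ 'n \<Rightarrow> real" where
  "box_bump a b N y = (\<Prod>i\<in>UNIV. flat 1 (real N * (y $ i - a $ i)) * flat 1 (real N * (b $ i - y $ i)))"

lemma flat_1_bounds: "0 \<le> flat 1 x" "flat 1 x \<le> 1"
  by (auto simp: flat_def)

lemma box_bump_bounds: "0 \<le> box_bump a b N y" "box_bump a b N y \<le> 1"
  unfolding box_bump_def by (auto intro!: prod_nonneg prod_le_1 mult_le_one flat_1_bounds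
      mult_nonneg_nonneg)

lemma flat_1_scaled_tendsto: "(\<lambda>N. flat 1 (real N * x)) \<longlonglongrightarrow> (if x > 0 then 1 else 0)"
proof (cases "x > 0")
  case True
  have "(\<lambda>N. exp (- ((1 / x) * inverse (real N)))) \<longlonglongrightarrow> exp (- ((1 / x) * 0))"
    by (intro tendsto_intros lim_inverse_n)
  moreover have "\<forall>\<^sub>F N in sequentially. exp (- ((1 / x) * inverse (real N))) = flat 1 (real N * x)"
    using eventually_gt_at_top[of 0] by eventually_elim (use True in \<open>auto simp: flat_def field_simps\<close>)
  ultimately show ?thesis
    using True by (simp add: Lim_transform_eventually)
next
  case False
  then have "flat 1 (real N * x) = 0" for N by (auto simp: flat_def zero_less_mult_iff)
  then show ?thesis using False by simp
qed

lemma box_bump_tendsto: "(\<lambda>N. box_bump a b N y) \<longlonglongrightarrow> indicator (box a b) y"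
proof -
  have "(\<lambda>N. box_bump a b N y) \<longlonglongrightarrow>
     (\<Prod>i\<in>UNIV. (if y $ i - a $ i > 0 then 1 else 0) * (if b $ i - y $ i > 0 then 1 else 0))"
    unfolding box_bump_def by (intro tendsto_prod tendsto_mult flat_1_scaled_tendsto)
  also have "(\<Prod>i\<in>UNIV. (if y $ i - a $ i > 0 then 1 else 0) * (if b $ i - y $ i > 0 then 1 else 0))
      = (indicator (box a b) y :: real)"
  proof (cases "y \<in> box a b")
    case False
    then obtain i where "\<not> (a $ i < y $ i \<and> y $ i < b $ i)" by (auto simp: mem_box_cart)
    then show ?thesis using False by (auto intro!: bexI[of _ i])
  qed (auto simp: mem_box_cart)
  finally show ?thesis .
qed

lemma box_bump_eq_0: "y \<notin> box a b \<Longrightarrow> box_bump a b N y = 0"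
proof -
  assume "y \<notin> box a b"
  then obtain i where "\<not> (a $ i < y $ i \<and> y $ i < b $ i)" by (auto simp: mem_box_cart)
  then show ?thesis
    unfolding box_bump_def by (intro prod_zero bexI[of _ i]) (auto simp: flat_def zero_less_mult_iff)
qed

lemma test_function_box_bump:
  fixes a b :: "real ^ 'n::finite"
  assumes "cbox a b \<subseteq> S"
  shows "test_function S (box_bump a b N)"
  unfolding test_function_def
proof
  have l: "bounded_linear (\<lambda>y::real^'n. c * y $ i)" for i and c :: real
    by (intro bounded_linear_intros bounded_linear_vec_nth)
  have "Ck_on k UNIV (box_bump a b N)" for k
  proof -
    have 1: "Ck_on k UNIV (\<lambda>y::real^'n. flat 1 (real N * (y $ i - a $ i)))" for i
      using Ck_on_flat[OF l[of "real N" i], of k 1 "- real N * a $ i"] by (simp add: algebra_simps)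
    have 2: "Ck_on k UNIV (\<lambda>y::real^'n. flat 1 (real N * (b $ i - y $ i)))" for i
      using Ck_on_flat[OF l[of "- real N" i], of k 1 "real N * b $ i"] by (simp add: algebra_simps)
    show ?thesis
      unfolding box_bump_def[abs_def] by (intro Ck_on_prod Ck_on_mult 1 2)
  qed
  then show "smooth_on UNIV (box_bump a b N)" by (simp add: smooth_on_def)
  show "\<exists>K. compact K \<and> K \<subseteq> S \<and> (\<forall>y. y \<notin> K \<longrightarrow> box_bump a b N y = 0)"
  proof (intro exI[of _ "cbox a b"] conjI allI impI)
    show "box_bump a b N y = 0" if "y \<notin> cbox a b" for y
      using that box_subset_cbox[of a b] by (intro box_bump_eq_0) auto
  qed (use assms in auto)
qed

text \<open>Boxes form an intersection-stable generator of the Borel sets, so vanishing of the integral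
  spreads from boxes to all Borel sets.\<close>

lemma AE_zero_if_integral_boxes_zero:
  fixes h :: "'e::euclidean_space \<Rightarrow> real"
  assumes h: "integrable lborel h" and "\<And>a b. (LINT x:box a b|lborel. h x) = 0"
  shows "AE x in lborel. h x = 0"
proof (rule density_unique_real)
  have UN: "(\<Union>n::nat. box (- (real n *\<^sub>R One)) (real n *\<^sub>R One)) = (UNIV :: 'e set)"
    by (rule UN_box_eq_UNIV)
  have si: "set_integrable lborel S h" if "S \<in> sets lborel" for S
    using h that unfolding set_integrable_def by (metis integrable_mult_indicator)
  have all: "(LINT x:UNIV|lborel. h x) = 0"
  proof -
    have "(\<lambda>n. LINT x:box (- (real n *\<^sub>R One)) (real n *\<^sub>R One)|lborel. h x) \<longlonglongrightarrow>
        (LINT x:(\<Union>n. box (- (real n *\<^sub>R One)) (real n *\<^sub>R One))|lborel. h x)"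
      by (rule set_integral_cont_up)
         (auto intro!: si incseq_SucI simp: mem_box, (smt (verit))+)
    then have "(\<lambda>n. 0::real) \<longlonglongrightarrow> (LINT x:UNIV|lborel. h x)"
      unfolding UN assms(2) by simp
    then show ?thesis by (simp add: LIMSEQ_const_iff)
  qed
  show "(LINT x:S|lborel. h x) = (LINT x:S|lborel. 0)" if "S \<in> sets lborel" for S
  proof -
    have "Int_stable (range (\<lambda>(a, b). box a b :: 'e set))"
      by (auto simp: Int_stable_def box_Int_box)
    moreover have "range (\<lambda>(a, b). box a b :: 'e set) \<subseteq> Pow UNIV" by simp
    moreover have "S \<in> sigma_sets UNIV (range (\<lambda>(a, b). box a b :: 'e set))"
      using that unfolding sets_lborel borel_eq_box by simp
    ultimately have "(LINT x:S|lborel. h x) = 0"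
    proof (induction rule: sigma_sets_induct_disjoint)
      case (basic A) then show ?case using assms(2) by auto
    next
      case empty show ?case by (simp add: set_lebesgue_integral_def)
    next
      case (compl A)
      have "A \<in> sets lborel" using compl(1) unfolding sets_lborel borel_eq_box by simp
      then have "(LINT x:A \<union> (UNIV - A)|lborel. h x) = (LINT x:A|lborel. h x) + (LINT x:UNIV -
          A|lborel. h x)"
        by (intro set_integral_Un si) auto
      then show ?case using compl all by (simp add: Un_commute)
    next
      case (union A)
      have A: "A i \<in> sets lborel" for i using union(2) unfolding sets_lborel borel_eq_box by auto
      have "(LINT x:(\<Union>i. A i)|lborel. h x) = (\<Sum>i. LINT x:A i|lborel. h x)"
        by (rule lebesgue_integral_countable_add[OF A])
           (use union(1) in \<open>auto simp: disjoint_family_on_def intro!: si A\<close>)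
      then show ?case using union by simp
    qed
    then show ?thesis by simp
  qed
qed (use h in auto)

text \<open>Testing against \<open>box_bump\<close> and passing to the limit shows that \<open>h\<close> has integral zero over every
  box whose closure lies in \<open>U\<close>; countably many such boxes cover \<open>U\<close>.\<close>

lemma fundamental_lemma_calculus_of_variations:
  fixes h :: "real ^ 'n::finite \<Rightarrow> real"
  assumes U: "open U"
    and int: "\<And>K. compact K \<Longrightarrow> K \<subseteq> U \<Longrightarrow> set_integrable lborel K h"
    and zero: "\<And>\<eta>. test_function U \<eta> \<Longrightarrow> (LINT y:U|lborel. h y * \<eta> y) = 0"
  shows "AE y in lborel. y \<in> U \<longrightarrow> h y = 0"
proof -
  have box0: "(LINT x:box a b|lborel. h x) = 0" if ab: "cbox a b \<subseteq> U" for a b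
  proof -
    have intc: "integrable lborel (\<lambda>y. indicator (cbox a b) y *\<^sub>R h y)"
      using int[OF compact_cbox ab] by (simp add: set_integrable_def)
    then have [measurable]: "(\<lambda>y. indicator (cbox a b) y *\<^sub>R h y) \<in> borel_measurable lborel" by auto
    have bm[measurable]: "box_bump a b N \<in> borel_measurable borel" for N
    proof -
      have "Ck_on 0 UNIV (box_bump a b N)"
        using test_function_box_bump[OF order_refl, of a b N] by (auto simp: test_function_def
            smooth_on_def)
      then show ?thesis by (simp add: borel_measurable_continuous_onI)
    qed
    have "(\<lambda>N. LINT y|lborel. box_bump a b N y * (indicator (cbox a b) y *\<^sub>R h y)) \<longlonglongrightarrow>
        (LINT y|lborel. indicator (box a b) y * (indicator (cbox a b) y *\<^sub>R h y))"
    proof (rule integral_dominated_convergence[where w="\<lambda>y. \<bar>indicator (cbox a b) y *\<^sub>R h y\<bar>"])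
      show "AE y in lborel. (\<lambda>N. box_bump a b N y * (indicator (cbox a b) y *\<^sub>R h y)) \<longlonglongrightarrow>
          indicator (box a b) y * (indicator (cbox a b) y *\<^sub>R h y)"
        by (intro AE_I2 tendsto_mult box_bump_tendsto tendsto_const)
      show "AE y in lborel. norm (box_bump a b N y * (indicator (cbox a b) y *\<^sub>R h y))
          \<le> \<bar>indicator (cbox a b) y *\<^sub>R h y\<bar>" for N
        using box_bump_bounds[of a b N] by (intro AE_I2) (auto simp: abs_mult mult_left_le_one_le)
      show "integrable lborel (\<lambda>y. \<bar>indicator (cbox a b) y *\<^sub>R h y\<bar>)"
        using intc by (rule integrable_abs)
    qed (use intc in measurable)
    moreover have "(LINT y|lborel. box_bump a b N y * (indicator (cbox a b) y *\<^sub>R h y)) = 0" for N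
    proof -
      have "(\<lambda>y. box_bump a b N y * (indicator (cbox a b) y *\<^sub>R h y)) =
          (\<lambda>y. indicator U y *\<^sub>R (h y * box_bump a b N y))"
        using ab box_bump_eq_0[of _ a b N] box_subset_cbox[of a b]
        by (auto simp: fun_eq_iff indicator_def)
      then show ?thesis
        using zero[OF test_function_box_bump[OF ab, of N]] by (simp add: set_lebesgue_integral_def)
    qed
    moreover have "(\<lambda>y. indicator (box a b) y * (indicator (cbox a b) y *\<^sub>R h y)) =
        (\<lambda>y. indicator (box a b) y *\<^sub>R h y)"
      using box_subset_cbox[of a b] by (auto simp: fun_eq_iff indicator_def)
    ultimately show ?thesis
      by (simp add: set_lebesgue_integral_def LIMSEQ_const_iff)
  qed
  have local: "AE y in lborel. y \<in> box a b \<longrightarrow> h y = 0" if ab: "cbox a b \<subseteq> U" for a b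
  proof -
    have "set_integrable lborel (box a b) h"
      by (rule set_integrable_subset[OF int[OF compact_cbox ab]]) (auto simp: box_subset_cbox)
    then have "AE y in lborel. indicator (box a b) y *\<^sub>R h y = 0"
    proof (intro AE_zero_if_integral_boxes_zero)
      fix c d
      obtain c' d' where cd: "box a b \<inter> box c d = box c' d'"
        unfolding box_Int_box by blast
      show "(LINT x:box c d|lborel. indicator (box a b) x *\<^sub>R h x) = 0"
      proof (cases "box c' d' = {}")
        case True
        then have *: "indicator (box c d) x *\<^sub>R indicator (box a b) x *\<^sub>R h x = 0" for x
          using cd by (auto simp: indicator_def)
        show ?thesis unfolding set_lebesgue_integral_def * by simp
      next
        case False
        have "cbox c' d' \<subseteq> cbox a b"
        proof -
          have "box c' d' \<subseteq> box a b" using cd by blast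
          moreover from this False have "box a b \<noteq> {}" by blast
          ultimately show ?thesis using closure_mono[of "box c' d'" "box a b"] False by simp
        qed
        then have "(LINT x:box c' d'|lborel. h x) = 0" using box0 ab by blast
        moreover have "indicator (box c d) x *\<^sub>R indicator (box a b) x *\<^sub>R h x =
            indicator (box c' d') x *\<^sub>R h x" for x
          unfolding cd[symmetric] by (auto simp: indicator_def)
        ultimately show ?thesis by (simp only: set_lebesgue_integral_def)
      qed
    qed (simp add: set_integrable_def)
    then show ?thesis by eventually_elim (auto simp: indicator_def)
  qed
  obtain \<D> where \<D>: "countable \<D>" "\<And>X. X \<in> \<D> \<Longrightarrow> X \<subseteq> U \<and> (\<exists>a b. X = box a b \<and> cbox a b \<subseteq> U)" "\<Union>\<D> = U"
  proof -
    have "\<exists>a b. y \<in> box a b \<and> cbox a b \<subseteq> U" if "y \<in> U" for y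
      by (rule open_contains_cbox[OF U that]) blast
    then obtain a b where ab: "\<And>y. y \<in> U \<Longrightarrow> y \<in> box (a y) (b y) \<and> cbox (a y) (b y) \<subseteq> U" by metis
    obtain F where F: "F \<subseteq> (\<lambda>y. box (a y) (b y)) ` U" "countable F"
        "\<Union>F = \<Union>((\<lambda>y. box (a y) (b y)) ` U)"
      by (rule Lindelof[of "(\<lambda>y. box (a y) (b y)) ` U"]) (auto simp: open_box)
    show thesis
    proof (rule that[of F])
      show "X \<subseteq> U \<and> (\<exists>a b. X = box a b \<and> cbox a b \<subseteq> U)" if "X \<in> F" for X
        using that F(1) ab box_subset_cbox by blast
      show "\<Union>F = U" unfolding F(3) using ab box_subset_cbox by fast
    qed (rule F(2))
  qed
  have "AE y in lborel. \<forall>X\<in>\<D>. y \<in> X \<longrightarrow> h y = 0"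
  proof (subst AE_ball_countable[OF \<D>(1)], rule ballI)
    fix X assume "X \<in> \<D>"
    then obtain a b where "X = box a b" "cbox a b \<subseteq> U" using \<D>(2) by blast
    then show "AE y in lborel. y \<in> X \<longrightarrow> h y = 0" using local by simp
  qed
  then show ?thesis
    by eventually_elim (use \<D>(3) in blast)
qed

text \<open>By translation invariance the difference quotients of \<open>G\<close> have integral zero, and they converge
  dominatedly to the directional derivative.\<close>

lemma integral_derivative_compact_support_zero:
  fixes G :: "'e::euclidean_space \<Rightarrow> real"
  assumes der: "\<And>y. (G has_derivative G' y) (at y)"
    and cont: "\<And>u. continuous_on UNIV (\<lambda>y. G' y u)"
    and K: "compact K" "\<And>y. y \<notin> K \<Longrightarrow> G y = 0"
  shows "(LINT y|lborel. G' y u) = 0"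
proof -
  have contG: "continuous_on UNIV G"
    by (rule has_derivative_continuous_on) (use der in auto)
  have mG[measurable]: "G \<in> borel_measurable borel" and mG': "(\<lambda>y. G' y u) \<in> borel_measurable borel"
    using contG cont by (auto intro: borel_measurable_continuous_onI)
  obtain R where R: "R > 0" "\<And>y. y \<in> K \<Longrightarrow> norm y \<le> R"
    using compact_imp_bounded[OF K(1)] bounded_pos by metis
  define R' where "R' = R + norm u"
  have G'0: "G' y u = 0" if "y \<notin> K" for y
  proof -
    have "open (- K)" using K(1) compact_imp_closed by auto
    then have "(G has_derivative (\<lambda>_. 0)) (at y)"
      by (rule has_derivative_transform_within_open[OF has_derivative_const]) (use that K(2) in auto)
    then show ?thesis using der has_derivative_unique by metis
  qed
  have "compact ((\<lambda>y. G' y u) ` K)"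
    using K(1) cont continuous_on_subset by (blast intro: compact_continuous_image)
  then obtain C0 where C0: "\<And>y. y \<in> K \<Longrightarrow> \<bar>G' y u\<bar> \<le> C0"
    by (metis bounded_iff compact_imp_bounded imageI real_norm_def)
  define C where "C = max C0 0"
  have C: "\<bar>G' y u\<bar> \<le> C" for y using C0[of y] G'0[of y] by (cases "y \<in> K") (auto simp: C_def)
  have lin: "linear (G' y)" for y using der has_derivative_linear by blast
  have line: "((\<lambda>s. G (y + s *\<^sub>R u)) has_real_derivative G' (y + s *\<^sub>R u) u) (at s)" for y s
  proof -
    have "((\<lambda>s. y + s *\<^sub>R u) has_derivative (\<lambda>s. s *\<^sub>R u)) (at s)"
      by (auto intro!: derivative_eq_intros)
    from has_derivative_compose[OF this der[of "y + s *\<^sub>R u"]]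
    show ?thesis
      by (simp add: has_field_derivative_def linear_scale[OF lin] mult_commute_abs)
  qed
  define t where "t n = inverse (real (Suc n))" for n
  have t: "0 < t n" "t n \<le> 1" for n by (auto simp: t_def field_simps)
  have intG: "integrable lborel G"
  proof -
    have "integrable lborel (\<lambda>y. indicator K y *\<^sub>R G y)"
      using K(1) continuous_on_subset[OF contG] by (intro borel_integrable_compact) auto
    moreover have "(\<lambda>y. indicator K y *\<^sub>R G y) = G" using K(2) by (auto simp: indicator_def fun_eq_iff)
    ultimately show ?thesis by simp
  qed
  have shift: "integrable lborel (\<lambda>y. G (y + w))" "(LINT y|lborel. G (y + w)) = (LINT y|lborel. G
      y)" for w
  proof -
    have "integrable (distr lborel borel ((+) w)) G" using intG by (simp add: lborel_distr_plus)
    then show "integrable lborel (\<lambda>y. G (y + w))"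
      by (subst (asm) integrable_distr_eq) (auto simp: add.commute)
    have "(LINT y|distr lborel borel ((+) w). G y) = (LINT y|lborel. G (w + y))"
      by (rule integral_distr) auto
    then show "(LINT y|lborel. G (y + w)) = (LINT y|lborel. G y)"
      by (simp add: lborel_distr_plus add.commute)
  qed
  have "(\<lambda>n. LINT y|lborel. (G (y + t n *\<^sub>R u) - G y) / t n) \<longlonglongrightarrow> (LINT y|lborel. G' y u)"
  proof (rule integral_dominated_convergence[where w="\<lambda>y. C * indicator (cball 0 R') y"])
    show "AE y in lborel. (\<lambda>n. (G (y + t n *\<^sub>R u) - G y) / t n) \<longlonglongrightarrow> G' y u"
    proof (rule AE_I2)
      fix y
      have "((\<lambda>h. (G (y + h *\<^sub>R u) - G y) / h) \<longlongrightarrow> G' y u) (at 0)"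
        using line[of y 0] by (simp add: DERIV_def)
      moreover have "filterlim t (at 0) sequentially"
        unfolding filterlim_at using t LIMSEQ_inverse_real_of_nat unfolding t_def[abs_def]
        by (auto simp: less_imp_neq)
      ultimately show "(\<lambda>n. (G (y + t n *\<^sub>R u) - G y) / t n) \<longlonglongrightarrow> G' y u"
        by (rule filterlim_compose)
    qed
    show "AE y in lborel. norm ((G (y + t n *\<^sub>R u) - G y) / t n) \<le> C * indicator (cball 0 R') y" for n
    proof (rule AE_I2)
      fix y
      show "norm ((G (y + t n *\<^sub>R u) - G y) / t n) \<le> C * indicator (cball 0 R') y"
      proof (cases "y \<in> cball 0 R'")
        case True
        obtain z where "0 < z" "z < t n"
            "G (y + t n *\<^sub>R u) - G (y + 0 *\<^sub>R u) = (t n - 0) * G' (y + z *\<^sub>R u) u"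
          using MVT2[OF t(1)[of n], of "\<lambda>s. G (y + s *\<^sub>R u)" "\<lambda>s. G' (y + s *\<^sub>R u) u", OF line] by metis
        then show ?thesis using True t(1)[of n] C[of "y + z *\<^sub>R u"] by (simp add: abs_mult)
      next
        case False
        have "norm y \<le> norm (y + t n *\<^sub>R u) + t n * norm u"
          using norm_triangle_ineq4[of "y + t n *\<^sub>R u" "t n *\<^sub>R u"] t(1)[of n] by simp
        moreover have "t n * norm u \<le> norm u"
          using t[of n] by (intro mult_left_le_one_le) auto
        moreover have "R + norm u < norm y" using False by (simp add: R'_def)
        ultimately have "R < norm (y + t n *\<^sub>R u)" "R < norm y"
          using norm_ge_zero[of u] by linarith+
        then have "y \<notin> K" "y + t n *\<^sub>R u \<notin> K" using R(2) leD by blast+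
        then show ?thesis using K(2) False by simp
      qed
    qed
    show "integrable lborel (\<lambda>y. C * indicator (cball 0 R') y)"
      using emeasure_lborel_cball_finite[of 0 R']
      by (intro integrable_mult_right integrable_real_indicator) auto
    show "(\<lambda>y. G' y u) \<in> borel_measurable lborel" using mG' by simp
    show "(\<lambda>y. (G (y + t n *\<^sub>R u) - G y) / t n) \<in> borel_measurable lborel" for n by measurable
  qed
  moreover have "(LINT y|lborel. (G (y + t n *\<^sub>R u) - G y) / t n) = 0" for n
    by (simp add: Bochner_Integration.integral_diff[OF shift(1) intG] shift(2))
  ultimately have "(\<lambda>n. 0) \<longlonglongrightarrow> (LINT y|lborel. G' y u)" by (simp only:)
  then show ?thesis by (simp add: LIMSEQ_const_iff)
qed

section \<open>One-dimensional profiles\<close>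

text \<open>A profile that starts with slope \<open>0\<close> can be continued by a constant and stays differentiable.\<close>

lemma has_real_derivative_compose_positive_part:
  fixes G G' :: "real \<Rightarrow> real"
  assumes der: "\<And>x. 0 \<le> x \<Longrightarrow> (G has_real_derivative G' x) (at x)"
    and "G 0 = 0" "G' 0 = 0"
  shows "((\<lambda>t. G (max t 0)) has_real_derivative G' (max t 0)) (at t)"
proof -
  consider "t > 0" | "t < 0" | "t = 0" by linarith
  then show ?thesis
  proof cases
    case 1
    then have "(G has_real_derivative G' (max t 0)) (at t)" using der[of t] by simp
    then show ?thesis
      by (rule has_field_derivative_transform_within_open[where S="{0<..}"]) (use 1 in auto)
  next
    case 2
    have "((\<lambda>_. 0) has_real_derivative G' (max t 0)) (at t)" using 2 assms(3) by simp
    then show ?thesis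
      by (rule has_field_derivative_transform_within_open[where S="{..<0}"]) (use 2 assms(2) in auto)
  next
    case 3
    have "((\<lambda>h. G h / h) \<longlongrightarrow> 0) (at 0)"
      using der[of 0] assms(2,3) by (simp add: DERIV_def)
    then have "((\<lambda>h. G h / h) \<longlongrightarrow> 0) (at_right 0)"
      by (simp add: filterlim_at_split)
    then have "((\<lambda>h. G (max h 0) / h) \<longlongrightarrow> 0) (at_right 0)"
      by (rule Lim_transform_eventually)
         (auto simp: eventually_at_filter intro!: always_eventually)
    moreover have "((\<lambda>h. G (max h 0) / h) \<longlongrightarrow> 0) (at_left 0)"
      by (rule Lim_transform_eventually[of "\<lambda>_. 0"])
         (auto simp: eventually_at_filter max_def assms(2) intro!: always_eventually)
    ultimately have "((\<lambda>h. G (max h 0) / h) \<longlongrightarrow> 0) (at 0)"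
      by (simp add: filterlim_split_at)
    then show ?thesis
      using 3 assms by (simp add: DERIV_def)
  qed
qed

text \<open>A continuously differentiable substitute for the positive part \<open>max t 0\<close>: its slope stays in
  \<open>[0, 1]\<close>, and it loses at most \<open>a\<close>.\<close>

definition soft_positive_part :: "real \<Rightarrow> real \<Rightarrow> real" where
  "soft_positive_part a t = (max t 0)\<^sup>2 / (max t 0 + a)"

definition soft_positive_part' :: "real \<Rightarrow> real \<Rightarrow> real" where
  "soft_positive_part' a t = 1 - a\<^sup>2 / (max t 0 + a)\<^sup>2"

lemma soft_positive_part_derivative:
  assumes "0 < a"
  shows "(soft_positive_part a has_real_derivative soft_positive_part' a t) (at t)"
proof -
  have "((\<lambda>x. x\<^sup>2 / (x + a)) has_real_derivative (1 - a\<^sup>2 / (x + a)\<^sup>2)) (at x)" if "0 \<le> x" for x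
  proof -
    have "((\<lambda>x. x\<^sup>2 / (x + a)) has_real_derivative ((2 * x) * (x + a) - x\<^sup>2 * 1) / ((x + a) * (x +
        a))) (at x)"
      using assms that by (auto intro!: derivative_eq_intros)
    moreover have "((2 * x) * (x + a) - x\<^sup>2 * 1) / ((x + a) * (x + a)) = 1 - a\<^sup>2 / (x + a)\<^sup>2"
      using assms that by (simp add: divide_simps power2_eq_square) (simp add: algebra_simps)
    ultimately show ?thesis by simp
  qed
  from has_real_derivative_compose_positive_part[OF this, of t] assms
  show ?thesis by (simp add: soft_positive_part_def[abs_def] soft_positive_part'_def)
qed

lemma soft_positive_part'_bounds:
  assumes "0 < a"
  shows "0 \<le> soft_positive_part' a t" "soft_positive_part' a t \<le> 1"
    and "t \<le> 0 \<Longrightarrow> soft_positive_part' a t = 0"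
  using assms by (auto simp: soft_positive_part'_def max_def divide_simps power_mono)

lemma soft_positive_part'_continuous:
  assumes "0 < a"
  shows "continuous_on UNIV (soft_positive_part' a)"
proof -
  have "max t 0 + a \<noteq> 0" for t :: real using assms by (auto simp: max_def)
  then show ?thesis
    unfolding soft_positive_part'_def[abs_def] by (intro continuous_intros) auto
qed

text \<open>A step from \<open>0\<close> to \<open>1\<close> over a unit interval needs slope at least \<open>1\<close>; the cost of making it
  continuously differentiable is arbitrarily small. Soft positive parts are used twice, once for
  each corner.\<close>

lemma exists_C1_step:
  fixes \<theta> :: real
  assumes "0 < \<theta>"
  obtains \<sigma> \<sigma>' :: "real \<Rightarrow> real"
  where "\<And>t. (\<sigma> has_real_derivative \<sigma>' t) (at t)" "continuous_on UNIV \<sigma>'"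
    "\<And>t. t \<le> 0 \<Longrightarrow> \<sigma> t = 0" "\<And>t. t \<le> 0 \<Longrightarrow> \<sigma>' t = 0"
    "\<And>t. 1 \<le> t \<Longrightarrow> \<sigma> t = 1" "\<And>t. 1 \<le> t \<Longrightarrow> \<sigma>' t = 0"
    "\<And>t. 0 \<le> \<sigma>' t" "\<And>t. \<sigma>' t \<le> 1 + \<theta>" "\<And>t. 0 \<le> \<sigma> t" "\<And>t. \<sigma> t \<le> 1"
proof -
  \<comment> \<open>Two factors \<open>1 + a\<close> enter the slope: rescaling the argument and rescaling the height.\<close>
  define a where "a = sqrt (1 + \<theta>) - 1"
  have a: "0 < a" "(1 + a) * (1 + a) = 1 + \<theta>" using assms by (auto simp: a_def)
  define P P' where "P = soft_positive_part a" and "P' = soft_positive_part' a"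
  have P: "(P has_real_derivative P' t) (at t)" for t
    unfolding P_def P'_def by (rule soft_positive_part_derivative[OF a(1)])
  have P': "0 \<le> P' t" "P' t \<le> 1" "t \<le> 0 \<Longrightarrow> P' t = 0" for t
    unfolding P'_def by (rule soft_positive_part'_bounds[OF a(1)])+
  have P0: "P t = 0" if "t \<le> 0" for t using that by (simp add: P_def soft_positive_part_def)
  have P1: "P 1 = 1 / (1 + a)" by (simp add: P_def soft_positive_part_def)
  have Pge: "1 \<le> P t" if "1 + a \<le> t" for t
  proof -
    have "0 < t" using that a by simp
    have "(1 + a) * a \<le> t * (t - 1)" using that a by (intro mult_mono) auto
    then have "t + a \<le> t * t" using a by (simp add: algebra_simps) (smt (verit) mult_nonneg_nonneg)
    then show ?thesis using \<open>0 < t\<close> a by (simp add: P_def soft_positive_part_def power2_eq_square)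
  qed
  define \<sigma> where "\<sigma> t = (1 + a) * (P 1 - P (1 - P ((1 + a) * t)))" for t
  define \<sigma>' where "\<sigma>' t = (1 + a) * (P' (1 - P ((1 + a) * t)) * (P' ((1 + a) * t) * (1 + a)))" for t
  have der: "(\<sigma> has_real_derivative \<sigma>' t) (at t)" for t
    unfolding \<sigma>_def[abs_def] \<sigma>'_def
    by (auto intro!: derivative_eq_intros DERIV_chain2[OF P])
  have cP: "continuous_on UNIV P" using P DERIV_isCont continuous_at_imp_continuous_on by blast
  have cP': "continuous_on UNIV P'" unfolding P'_def by (rule soft_positive_part'_continuous[OF a(1)])
  have cont: "continuous_on UNIV \<sigma>'"
    unfolding \<sigma>'_def[abs_def]
    by (intro continuous_intros continuous_on_compose2[OF cP'] continuous_on_compose2[OF cP]) auto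
  have low: "\<sigma> t = 0" "\<sigma>' t = 0" if "t \<le> 0" for t
  proof -
    have "(1 + a) * t \<le> 0" using that a by (simp add: mult_nonneg_nonpos)
    then show "\<sigma> t = 0" "\<sigma>' t = 0" by (simp_all add: \<sigma>_def \<sigma>'_def P0 P')
  qed
  have high: "\<sigma> t = 1" "\<sigma>' t = 0" if "1 \<le> t" for t
  proof -
    have "1 \<le> P ((1 + a) * t)" using that a by (intro Pge) simp
    then show "\<sigma> t = 1" "\<sigma>' t = 0" using a by (simp_all add: \<sigma>_def \<sigma>'_def P0 P' P1)
  qed
  have nn: "0 \<le> \<sigma>' t" for t using a P' by (simp add: \<sigma>'_def)
  have le: "\<sigma>' t \<le> 1 + \<theta>" for t
  proof -
    have "P' (1 - P ((1 + a) * t)) * P' ((1 + a) * t) \<le> 1" using P' by (intro mult_le_one)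
    then have "(1 + a) * (1 + a) * (P' (1 - P ((1 + a) * t)) * P' ((1 + a) * t)) \<le> (1 + a) * (1 + a)
        * 1"
      using a(1) by (intro mult_left_mono) auto
    then show ?thesis unfolding a(2)[symmetric] by (simp add: \<sigma>'_def ac_simps)
  qed
  have mono: "\<sigma> s \<le> \<sigma> t" if "s \<le> t" for s t
    using DERIV_nonneg_imp_nondecreasing[OF that, of \<sigma>] der nn by blast
  have "0 \<le> \<sigma> t" for t using mono[of "min t 0" t] low[of "min t 0"] by simp
  moreover have "\<sigma> t \<le> 1" for t using mono[of t "max t 1"] high[of "max t 1"] by simp
  ultimately show thesis using that der cont low high nn le by blast
qed

text \<open>The profile \<open>H\<close>: equal to \<open>t\<close> up to \<open>1\<close> and to \<open>e\<^bsup>t-1\<^esup>\<close> afterwards. In this form it is a linear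
  function plus a function of the positive part of \<open>t - 1\<close> that starts with slope \<open>0\<close>.\<close>

definition linear_then_exp :: "real \<Rightarrow> real" where
  "linear_then_exp t = t + (exp (max (t - 1) 0) - 1 - max (t - 1) 0)"

lemma linear_then_exp_derivative:
  "(linear_then_exp has_real_derivative exp (max (t - 1) 0)) (at t)"
proof -
  have "((\<lambda>s. exp s - 1 - s) has_real_derivative (exp s - 1)) (at s)" for s :: real
    by (auto intro!: derivative_eq_intros)
  from has_real_derivative_compose_positive_part[OF this]
  have "((\<lambda>s. exp (max s 0) - 1 - max s 0) has_real_derivative (exp (max s 0) - 1)) (at s)"
      for s :: real
    by simp
  then have "((\<lambda>t. exp (max (t - 1) 0) - 1 - max (t - 1) 0) has_real_derivative (exp (max (t - 1) 0)
      - 1) * 1) (at t)"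
    by (rule DERIV_chain2) (auto intro!: derivative_eq_intros)
  from DERIV_add[OF DERIV_ident this] show ?thesis
    by (simp add: linear_then_exp_def[abs_def])
qed

lemma linear_then_exp_values:
  "t \<le> 1 \<Longrightarrow> linear_then_exp t = t" "1 \<le> t \<Longrightarrow> linear_then_exp t = exp (t - 1)"
  by (auto simp: linear_then_exp_def max_def)

lemma linear_then_exp_derivative_le: "exp (max (t - 1) 0) \<le> max 1 (linear_then_exp t)"
  by (cases "t \<le> 1") (auto simp: linear_then_exp_values max_def)

lemma linear_then_exp_pos: "0 < t \<Longrightarrow> 0 < linear_then_exp t"
  by (cases "t \<le> 1") (auto simp: linear_then_exp_values)

lemma linear_expand_axis:
  fixes d :: "real ^ 'n::finite \<Rightarrow> real"
  assumes "linear d"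
  shows "d w = (\<Sum>i\<in>UNIV. w $ i * d (axis i 1))"
proof -
  have "w = (\<Sum>i\<in>UNIV. w $ i *\<^sub>R axis i 1)"
    by (simp add: basis_expansion scalar_mult_eq_scaleR[symmetric])
  then have "d w = d (\<Sum>i\<in>UNIV. w $ i *\<^sub>R axis i 1)" by simp
  also have "\<dots> = (\<Sum>i\<in>UNIV. w $ i * d (axis i 1))"
    using assms by (simp add: linear_sum linear_scale)
  finally show ?thesis .
qed

text \<open>The slope, in units of \<open>1/\<delta>\<close>, of the layers built below, where \<open>\<eta>\<close> measures every loss: the
  distortion of the coordinates, the size of the net, and the smoothing of steps and maxima.\<close>

definition layer_slope :: "real \<Rightarrow> real" where
  "layer_slope \<eta> = (1 + \<eta>) / (1 - \<eta>) * ((1 + \<eta>) * (1 + \<eta>) / (1 / (1 + \<eta>) - 3 * \<eta>))"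

lemma layer_slope_close_to_1:
  assumes "0 < \<epsilon>"
  obtains \<eta> where "0 < \<eta>" "\<eta> < 1" "3 * \<eta> < 1 / (1 + \<eta>)" "layer_slope \<eta> < 1 + \<epsilon>"
proof -
  have "(layer_slope \<longlongrightarrow> (1 + 0) / (1 - 0) * ((1 + 0) * (1 + 0) / (1 / (1 + 0) - 3 * 0))) (at_right 0)"
    unfolding layer_slope_def[abs_def] by (intro tendsto_intros) auto
  then have "\<forall>\<^sub>F \<eta> in at_right 0. layer_slope \<eta> < 1 + \<epsilon>"
    by (rule order_tendstoD(2)) (use assms in simp)
  moreover have "\<forall>\<^sub>F \<eta> in at_right 0. \<eta> \<in> {0<..<1/4::real}"
    by (rule eventually_at_right_real) simp
  ultimately have "\<forall>\<^sub>F \<eta> in at_right 0. layer_slope \<eta> < 1 + \<epsilon> \<and> \<eta> \<in> {0<..<1/4::real}"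
    by (rule eventually_conj)
  then obtain \<eta> :: real where \<eta>: "layer_slope \<eta> < 1 + \<epsilon>" "0 < \<eta>" "\<eta> < 1/4"
    using eventually_happens'[OF trivial_limit_at_right_real] by fastforce
  have "\<eta> * (1 + \<eta>) \<le> (1/4) * (1 + 1/4)"
    using \<eta> by (intro mult_mono) simp_all
  then have "3 * \<eta> * (1 + \<eta>) < 1" by simp
  then have "3 * \<eta> < 1 / (1 + \<eta>)" using \<eta>(2) by (simp add: field_simps)
  then show thesis using that \<eta> by simp
qed

text \<open>At most one term of the sum is nonzero, so taking powers commutes with the summation.\<close>

lemma sum_powr_of_disjoint:
  fixes a u :: "nat \<Rightarrow> real"
  assumes "finite I" "\<And>i j. i \<in> I \<Longrightarrow> j \<in> I \<Longrightarrow> u i \<noteq> 0 \<Longrightarrow> u j \<noteq> 0 \<Longrightarrow> i = j"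
  shows "\<bar>\<Sum>i\<in>I. a i * u i\<bar> powr p = (\<Sum>i\<in>I. \<bar>a i\<bar> powr p * \<bar>u i\<bar> powr p)"
proof (cases "\<exists>j\<in>I. u j \<noteq> 0")
  case True
  then obtain j where j: "j \<in> I" "u j \<noteq> 0" by blast
  then have 0: "u i = 0" if "i \<in> I - {j}" for i using assms(2) that by blast
  have "(\<Sum>i\<in>I. a i * u i) = a j * u j"
    by (subst sum.remove[OF assms(1) j(1)]) (simp add: 0)
  moreover have "(\<Sum>i\<in>I. \<bar>a i\<bar> powr p * \<bar>u i\<bar> powr p) = \<bar>a j\<bar> powr p * \<bar>u j\<bar> powr p"
    by (subst sum.remove[OF assms(1) j(1)]) (simp add: 0)
  ultimately show ?thesis by (simp add: abs_mult powr_mult)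
next
  case False
  then show ?thesis by simp
qed

section \<open>Charts and the metric in coordinates\<close>

locale riemannian_manifold =
  fixes M :: "('a::{t2_space, second_countable_topology}, 'n::finite) riem"
  assumes smooth_atlas: "smooth_atlas (atlas M)"
    and smooth_metric: "smooth_metric M"
begin

abbreviation image_of :: "('a, 'n) chart \<Rightarrow> (real ^ 'n) set" where
  "image_of c \<equiv> snd c ` fst c"

definition norm_at :: "('a, 'n) chart \<Rightarrow> 'a \<Rightarrow> real ^ 'n \<Rightarrow> real" where
  "norm_at c q u = sqrt (metric M c q u u)"

lemma chart_open: "c \<in> atlas M \<Longrightarrow> open (fst c)"
  and image_open: "c \<in> atlas M \<Longrightarrow> open (image_of c)"
  and chart_homeomorphism:
    "c \<in> atlas M \<Longrightarrow> homeomorphism (fst c) (image_of c) (snd c) (chart_inv c)"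
  and charts_cover: "(\<Union>c\<in>atlas M. fst c) = UNIV"
  and transition_smooth:
    "c \<in> atlas M \<Longrightarrow> c' \<in> atlas M \<Longrightarrow> smooth_on (snd c ` (fst c \<inter> fst c')) (transition c c')"
  using smooth_atlas[unfolded smooth_atlas_def] by (blast, blast, blast, blast, blast)

lemma chart_exists: obtains c where "c \<in> atlas M" "q \<in> fst c"
  using charts_cover by blast

lemma chart_at: "chart_at M q \<in> atlas M" "q \<in> fst (chart_at M q)"
proof -
  have "\<exists>c. c \<in> atlas M \<and> q \<in> fst c" using charts_cover by blast
  from someI_ex[OF this] show "chart_at M q \<in> atlas M" "q \<in> fst (chart_at M q)"
    unfolding chart_at_def by auto
qed

lemma chart_continuous: "c \<in> atlas M \<Longrightarrow> continuous_on (fst c) (snd c)"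
  by (rule homeomorphism_cont1[OF chart_homeomorphism])

lemma chart_inv_continuous: "c \<in> atlas M \<Longrightarrow> continuous_on (image_of c) (chart_inv c)"
  by (rule homeomorphism_cont2[OF chart_homeomorphism])

lemma chart_inv_chart [simp]: "c \<in> atlas M \<Longrightarrow> q \<in> fst c \<Longrightarrow> chart_inv c (snd c q) = q"
  by (rule homeomorphism_apply1[OF chart_homeomorphism])

lemma chart_chart_inv [simp]: "c \<in> atlas M \<Longrightarrow> y \<in> image_of c \<Longrightarrow> snd c (chart_inv c y) = y"
  by (rule homeomorphism_apply2[OF chart_homeomorphism])

lemma chart_inv_in: "c \<in> atlas M \<Longrightarrow> y \<in> image_of c \<Longrightarrow> chart_inv c y \<in> fst c"
  by auto

lemma chart_image_open:
  assumes c: "c \<in> atlas M" and "open S" "S \<subseteq> fst c"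
  shows "open (snd c ` S)"
proof -
  have "openin (top_of_set (image_of c)) (snd c ` S)"
    using homeomorphism_imp_open_map[OF chart_homeomorphism[OF c]] assms
    by (metis openin_open_eq chart_open)
  then show ?thesis using image_open[OF c] openin_open_eq by blast
qed

lemma overlap_open:
  "c \<in> atlas M \<Longrightarrow> c' \<in> atlas M \<Longrightarrow> open (snd c ` (fst c \<inter> fst c'))"
  by (rule chart_image_open) (auto intro: chart_open)

lemma transition_has_derivative:
  assumes "c \<in> atlas M" "c' \<in> atlas M" "q \<in> fst c \<inter> fst c'"
  shows "(transition c c' has_derivative dtransition c c' q) (at (snd c q))"
proof -
  have "Ck_on 1 (snd c ` (fst c \<inter> fst c')) (transition c c')"
    using transition_smooth[OF assms(1,2)] by (simp add: smooth_on_def)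
  then show ?thesis
    using assms(3) unfolding dtransition_def frechet_derivative_works[symmetric] by auto
qed

lemma dtransition_linear:
  assumes "c \<in> atlas M" "c' \<in> atlas M" "q \<in> fst c \<inter> fst c'"
  shows "linear (dtransition c c' q)"
  using transition_has_derivative[OF assms] has_derivative_linear by blast

lemma dtransition_continuous:
  assumes "c \<in> atlas M" "c' \<in> atlas M"
  shows "continuous_on (snd c ` (fst c \<inter> fst c')) (\<lambda>y. dtransition c c' (chart_inv c y) u)"
proof -
  have "Ck_on 1 (snd c ` (fst c \<inter> fst c')) (transition c c')"
    using transition_smooth[OF assms] by (simp add: smooth_on_def)
  then have "continuous_on (snd c ` (fst c \<inter> fst c')) (\<lambda>y. frechet_derivative (transition c c') (at
      y) u)"
    by simp
  then show ?thesis
    by (rule continuous_on_eq) (use assms in \<open>auto simp: dtransition_def\<close>)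
qed

lemma transition_chart: "c \<in> atlas M \<Longrightarrow> q \<in> fst c \<Longrightarrow> transition c c' (snd c q) = snd c' q"
  by (simp add: transition_def)

text \<open>The chain rule for the two transition maps, which are inverse to each other near the point.\<close>

lemma dtransition_inverse:
  assumes c: "c \<in> atlas M" "c' \<in> atlas M" and q: "q \<in> fst c \<inter> fst c'"
  shows "dtransition c' c q (dtransition c c' q u) = u"
proof -
  have q': "q \<in> fst c' \<inter> fst c" using q by auto
  have "((\<lambda>y. transition c' c (transition c c' y)) has_derivative
      (\<lambda>u. dtransition c' c q (dtransition c c' q u))) (at (snd c q))"
  proof (rule has_derivative_compose[OF transition_has_derivative[OF c q]])
    have "transition c c' (snd c q) = snd c' q" using transition_chart c q by blast
    then show "(transition c' c has_derivative dtransition c' c q) (at (transition c c' (snd c q)))"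
      using transition_has_derivative[OF c(2,1) q'] by (simp only:)
  qed
  moreover have "((\<lambda>y. transition c' c (transition c c' y)) has_derivative (\<lambda>u. u)) (at (snd c q))"
    by (rule has_derivative_transform_within_open[OF has_derivative_ident overlap_open[OF c]])
       (use q c in \<open>auto simp: transition_def\<close>)
  ultimately have "(\<lambda>u. dtransition c' c q (dtransition c c' q u)) = (\<lambda>u. u)"
    by (rule has_derivative_unique)
  then show ?thesis by (rule fun_cong)
qed

lemma metric_bilinear: "c \<in> atlas M \<Longrightarrow> q \<in> fst c \<Longrightarrow> bilinear (metric M c q)"
  and metric_sym: "c \<in> atlas M \<Longrightarrow> q \<in> fst c \<Longrightarrow> metric M c q u w = metric M c q w u"
  and metric_pos: "c \<in> atlas M \<Longrightarrow> q \<in> fst c \<Longrightarrow> u \<noteq> 0 \<Longrightarrow> 0 < metric M c q u u"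
  and metric_transition: "c \<in> atlas M \<Longrightarrow> c' \<in> atlas M \<Longrightarrow> q \<in> fst c \<inter> fst c' \<Longrightarrow>
        metric M c q u w = metric M c' q (dtransition c c' q u) (dtransition c c' q w)"
  using smooth_metric unfolding smooth_metric_def by blast+

lemma metric_continuous:
  assumes c: "c \<in> atlas M"
  shows "continuous_on (fst c) (\<lambda>q. metric M c q u w)"
proof -
  have "continuous_on (image_of c) (\<lambda>y. metric M c (chart_inv c y) u w)"
    using smooth_metric c unfolding smooth_metric_def smooth_on_def
    by (metis Ck_on.simps(1))
  then have "continuous_on (fst c) (\<lambda>q. metric M c (chart_inv c (snd c q)) u w)"
    by (rule continuous_on_compose2[OF _ chart_continuous[OF c]]) auto
  then show ?thesis by (rule continuous_on_eq) (use c in auto)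
qed

lemma metric_expand:
  assumes "c \<in> atlas M" "q \<in> fst c"
  shows "metric M c q u w = (\<Sum>i\<in>UNIV. \<Sum>j\<in>UNIV. u $ i * w $ j * metric M c q (axis i 1) (axis j 1))"
proof -
  have b: "bilinear (metric M c q)" using metric_bilinear assms by blast
  have *: "(\<Sum>i\<in>UNIV. x $ i *\<^sub>R axis i 1) = x" for x :: "real^'n"
    by (simp add: basis_expansion scalar_mult_eq_scaleR[symmetric])
  have "metric M c q u w = metric M c q (\<Sum>i\<in>UNIV. u $ i *\<^sub>R axis i 1) (\<Sum>i\<in>UNIV. w $ i *\<^sub>R axis i 1)"
    by (simp add: *)
  also have "\<dots> = (\<Sum>(i, j)\<in>UNIV \<times> UNIV. metric M c q (u $ i *\<^sub>R axis i 1) (w $ j *\<^sub>R axis j 1))"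
    by (rule bilinear_sum[OF b])
  also have "\<dots> = (\<Sum>i\<in>UNIV. \<Sum>j\<in>UNIV. u $ i * w $ j * metric M c q (axis i 1) (axis j 1))"
    by (subst sum.cartesian_product[symmetric])
       (simp add: bilinear_lmul[OF b] bilinear_rmul[OF b] algebra_simps)
  finally show ?thesis .
qed

lemma metric_continuous_vector:
  assumes c: "c \<in> atlas M" and S: "S \<subseteq> fst c" and "continuous_on S X" "continuous_on S Y"
  shows "continuous_on S (\<lambda>q. metric M c q (X q) (Y q))"
proof -
  have "continuous_on S (\<lambda>q. \<Sum>i\<in>UNIV. \<Sum>j\<in>UNIV. X q $ i * Y q $ j * metric M c q (axis i 1) (axis j 1))"
    by (intro continuous_intros continuous_on_subset[OF metric_continuous[OF c] S]) (rule assms)+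
  then show ?thesis
  proof (rule continuous_on_eq)
    fix q assume "q \<in> S"
    then have "q \<in> fst c" using S by blast
    from metric_expand[OF c this, of "X q" "Y q", symmetric]
    show "(\<Sum>i\<in>UNIV. \<Sum>j\<in>UNIV. X q $ i * Y q $ j * metric M c q (axis i 1) (axis j 1)) =
        metric M c q (X q) (Y q)" .
  qed
qed

lemma metric_nonneg: "c \<in> atlas M \<Longrightarrow> q \<in> fst c \<Longrightarrow> 0 \<le> metric M c q u u"
  by (cases "u = 0") (simp_all add: less_imp_le metric_pos bilinear_lzero[OF metric_bilinear])

lemma norm_at_nonneg: "c \<in> atlas M \<Longrightarrow> q \<in> fst c \<Longrightarrow> 0 \<le> norm_at c q u"
  by (simp add: norm_at_def metric_nonneg)

lemma norm_at_square: "c \<in> atlas M \<Longrightarrow> q \<in> fst c \<Longrightarrow> (norm_at c q u)\<^sup>2 = metric M c q u u"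
  by (simp add: norm_at_def metric_nonneg)

lemma norm_at_pos: "c \<in> atlas M \<Longrightarrow> q \<in> fst c \<Longrightarrow> u \<noteq> 0 \<Longrightarrow> 0 < norm_at c q u"
  by (simp add: norm_at_def metric_pos)

lemma norm_at_scale:
  "c \<in> atlas M \<Longrightarrow> q \<in> fst c \<Longrightarrow> norm_at c q (a *\<^sub>R u) = \<bar>a\<bar> * norm_at c q u"
  by (simp add: norm_at_def bilinear_lmul[OF metric_bilinear] bilinear_rmul[OF metric_bilinear]
      mult.assoc[symmetric] real_sqrt_mult)

lemma norm_at_transition:
  "c \<in> atlas M \<Longrightarrow> c' \<in> atlas M \<Longrightarrow> q \<in> fst c \<inter> fst c' \<Longrightarrow>
    norm_at c' q (dtransition c c' q u) = norm_at c q u"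
  by (simp add: norm_at_def metric_transition[symmetric])

lemma metric_Cauchy_Schwarz:
  assumes "c \<in> atlas M" "q \<in> fst c"
  shows "\<bar>metric M c q u w\<bar> \<le> norm_at c q u * norm_at c q w"
proof (cases "w = 0")
  case True
  then show ?thesis by (simp add: bilinear_rzero[OF metric_bilinear[OF assms]] norm_at_def)
next
  case False
  have b: "bilinear (metric M c q)" using metric_bilinear assms by blast
  define A B D where "A = metric M c q u u" "B = metric M c q u w" "D = metric M c q w w"
  have D: "D > 0" using metric_pos[OF assms False] by (simp add: A_B_D_def)
  have "0 \<le> metric M c q (D *\<^sub>R u - B *\<^sub>R w) (D *\<^sub>R u - B *\<^sub>R w)"
    using metric_nonneg assms by blast
  also have "\<dots> = D * (A * D - B\<^sup>2)"
    using b metric_sym[OF assms, of w u]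
    by (simp add: bilinear_lsub bilinear_rsub bilinear_lmul bilinear_rmul A_B_D_def power2_eq_square
        algebra_simps)
  finally have "B\<^sup>2 \<le> A * D" using D by (simp add: zero_le_mult_iff)
  then have "sqrt (B\<^sup>2) \<le> sqrt (A * D)" by (rule real_sqrt_le_mono)
  then show ?thesis by (simp add: A_B_D_def norm_at_def real_sqrt_mult)
qed

text \<open>Along the segment from the identity to the Gram matrix all matrices are positive definite, so the
  determinant never vanishes and keeps its sign.\<close>

lemma gram_det_pos:
  assumes "c \<in> atlas M" "q \<in> fst c"
  shows "0 < det (gram_matrix M c q)"
proof -
  define G where "G t = (\<chi> i j. (1 - t) * (mat 1 :: real^'n^'n) $ i $ j + t * gram_matrix M c q $ i
      $ j)" for t :: real
  have quad: "u \<bullet> (G t *v u) = (1 - t) * (u \<bullet> u) + t * metric M c q u u" for t u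
  proof -
    have "G t *v u = (1 - t) *\<^sub>R (mat 1 *v u) + t *\<^sub>R (gram_matrix M c q *v u)"
      by (simp add: vec_eq_iff G_def matrix_vector_mult_def sum_distrib_left sum.distrib
          sum_subtractf algebra_simps)
    then have "u \<bullet> (G t *v u) = (1 - t) * (u \<bullet> (mat 1 *v u)) + t * (u \<bullet> (gram_matrix M c q *v u))"
      by (simp add: inner_add_right)
    moreover have "u \<bullet> (gram_matrix M c q *v u) = metric M c q u u"
      by (subst metric_expand[OF assms])
         (simp add: gram_matrix_def inner_vec_def matrix_vector_mult_def sum_distrib_left algebra_simps)
    ultimately show ?thesis by simp
  qed
  have ne: "det (G t) \<noteq> 0" if "0 \<le> t" "t \<le> 1" for t
  proof
    assume "det (G t) = 0"
    then have "\<not> invertible (G t)" by (simp add: invertible_det_nz)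
    then obtain u where u: "u \<noteq> 0" "G t *v u = 0"
      using invertible_left_inverse[of "G t"] matrix_left_invertible_ker[of "G t"] by blast
    have "(1 - t) * (u \<bullet> u) + t * metric M c q u u = 0" using quad[of u t] u(2) by simp
    moreover have "0 < u \<bullet> u" "0 < metric M c q u u" using u metric_pos[OF assms] by auto
    ultimately show False using that
      by (smt (verit) mult_nonneg_nonneg mult_pos_pos)
  qed
  have "continuous_on {0..1} (\<lambda>t. det (G t))"
    unfolding det_def G_def by (intro continuous_intros)
  moreover have "det (G 0) = 1" "det (G 1) = det (gram_matrix M c q)"
  proof -
    have "G 0 = mat 1" "G 1 = gram_matrix M c q" by (simp_all add: G_def vec_eq_iff)
    then show "det (G 0) = 1" "det (G 1) = det (gram_matrix M c q)" by simp_all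
  qed
  ultimately have G: "continuous_on {0..1} (\<lambda>t. det (G t))" "det (G 0) = 1"
    "det (G 1) = det (gram_matrix M c q)" by auto
  show ?thesis
  proof (rule ccontr)
    assume "\<not> 0 < det (gram_matrix M c q)"
    then have "\<exists>t\<ge>0. t \<le> 1 \<and> det (G t) = 0" using G by (intro IVT2') auto
    then show False using ne by blast
  qed
qed

lemma gram_det_continuous:
  assumes "c \<in> atlas M"
  shows "continuous_on (fst c) (\<lambda>q. det (gram_matrix M c q))"
  unfolding det_def gram_matrix_def vec_lambda_beta
  by (intro continuous_intros metric_continuous[OF assms])

lemma continuous_if_continuous_in_charts:
  fixes h :: "'a \<Rightarrow> real"
  assumes "\<And>c. c \<in> atlas M \<Longrightarrow> continuous_on (image_of c) (\<lambda>y. h (chart_inv c y))"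
  shows "continuous_on UNIV h"
proof -
  have "continuous_on (fst c) h" if c: "c \<in> atlas M" for c
  proof -
    have "continuous_on (fst c) (\<lambda>q. h (chart_inv c (snd c q)))"
      by (rule continuous_on_compose2[OF assms[OF c] chart_continuous[OF c]]) auto
    then show ?thesis by (rule continuous_on_eq) (use c in auto)
  qed
  then have "continuous_on (\<Union>c\<in>atlas M. fst c) h"
    by (intro continuous_on_open_UN chart_open)
  then show ?thesis by (simp add: charts_cover)
qed

lemma smooth_function_continuous:
  assumes "smooth_function M h"
  shows "continuous_on UNIV h"
  using assms unfolding smooth_function_def smooth_on_def
  by (intro continuous_if_continuous_in_charts) (metis Ck_on.simps(1))

section \<open>Continuously differentiable functions with a pointwise gradient bound\<close>

text \<open>The maps \<open>d c y\<close> represent the differential in the coordinates of \<open>c\<close>, and \<open>G q\<close> bounds its dual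
  norm at \<open>q\<close>, that is, the norm of the gradient. Carrying the bound along lets the chain rule act
  on functions and on gradient bounds at once.\<close>

definition has_differential ::
  "('a \<Rightarrow> real) \<Rightarrow> (('a, 'n) chart \<Rightarrow> real ^ 'n \<Rightarrow> real ^ 'n \<Rightarrow> real) \<Rightarrow> ('a \<Rightarrow> real) \<Rightarrow> bool" where
  "has_differential \<phi> d G \<longleftrightarrow>
     (\<forall>c\<in>atlas M. \<forall>y\<in>image_of c. ((\<lambda>y. \<phi> (chart_inv c y)) has_derivative d c y) (at y)) \<and>
     (\<forall>c\<in>atlas M. \<forall>u. continuous_on (image_of c) (\<lambda>y. d c y u)) \<and>
     (\<forall>c\<in>atlas M. \<forall>y\<in>image_of c. \<forall>u.
        \<bar>d c y u\<bar> \<le> G (chart_inv c y) * norm_at c (chart_inv c y) u)"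

definition C1_slope :: "('a \<Rightarrow> real) \<Rightarrow> ('a \<Rightarrow> real) \<Rightarrow> bool" where
  "C1_slope \<phi> G \<longleftrightarrow> (\<exists>d. has_differential \<phi> d G)"

lemma C1_slopeI:
  assumes "\<And>c y. c \<in> atlas M \<Longrightarrow> y \<in> image_of c \<Longrightarrow> ((\<lambda>y. \<phi> (chart_inv c y)) has_derivative d c y) (at y)"
    and "\<And>c u. c \<in> atlas M \<Longrightarrow> continuous_on (image_of c) (\<lambda>y. d c y u)"
    and "\<And>c y u. c \<in> atlas M \<Longrightarrow> y \<in> image_of c \<Longrightarrow>
          \<bar>d c y u\<bar> \<le> G (chart_inv c y) * norm_at c (chart_inv c y) u"
  shows "C1_slope \<phi> G"
  unfolding C1_slope_def has_differential_def
  by (intro exI[of _ d] conjI ballI allI assms)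

lemma has_differentialD:
  assumes "has_differential \<phi> d G"
  shows "c \<in> atlas M \<Longrightarrow> y \<in> image_of c \<Longrightarrow> ((\<lambda>y. \<phi> (chart_inv c y)) has_derivative d c y) (at y)"
    and "c \<in> atlas M \<Longrightarrow> continuous_on (image_of c) (\<lambda>y. d c y u)"
    and "c \<in> atlas M \<Longrightarrow> y \<in> image_of c \<Longrightarrow>
          \<bar>d c y u\<bar> \<le> G (chart_inv c y) * norm_at c (chart_inv c y) u"
  by (rule assms[unfolded has_differential_def, THEN conjunct1, rule_format]
      assms[unfolded has_differential_def, THEN conjunct2, THEN conjunct1, rule_format]
      assms[unfolded has_differential_def, THEN conjunct2, THEN conjunct2, rule_format]; assumption)+

lemma C1_slope_continuous:
  assumes "C1_slope \<phi> G"
  shows "continuous_on UNIV \<phi>"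
proof -
  obtain d where "has_differential \<phi> d G" using assms unfolding C1_slope_def by blast
  note d = has_differentialD[OF this]
  show ?thesis
  proof (rule continuous_if_continuous_in_charts)
    fix c assume "c \<in> atlas M"
    then show "continuous_on (image_of c) (\<lambda>y. \<phi> (chart_inv c y))"
      by (rule has_derivative_continuous_on[OF has_derivative_at_withinI[OF d(1)]])
  qed
qed

lemma C1_slope_mono:
  assumes "C1_slope \<phi> G" "\<And>q. G q \<le> G' q"
  shows "C1_slope \<phi> G'"
proof -
  obtain d where "has_differential \<phi> d G" using assms(1) unfolding C1_slope_def by blast
  note d = has_differentialD[OF this]
  show ?thesis
  proof (rule C1_slopeI[of _ d])
    fix c y u assume c: "c \<in> atlas M" "y \<in> image_of c"
    have "G (chart_inv c y) * norm_at c (chart_inv c y) u \<le> G' (chart_inv c y) * norm_at c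
        (chart_inv c y) u"
      using c by (intro mult_right_mono assms norm_at_nonneg chart_inv_in)
    then show "\<bar>d c y u\<bar> \<le> G' (chart_inv c y) * norm_at c (chart_inv c y) u" using d(3)[OF c,
        of u] by linarith
  qed (rule d(1), assumption, assumption, rule d(2), assumption)
qed

lemma C1_slope_const: "C1_slope (\<lambda>_. a) (\<lambda>_. 0)"
  by (rule C1_slopeI[of _ "\<lambda>_ _ _. 0"]) auto

lemma C1_slope_add:
  assumes "C1_slope \<phi> G" "C1_slope \<psi> H"
  shows "C1_slope (\<lambda>q. \<phi> q + \<psi> q) (\<lambda>q. G q + H q)"
proof -
  obtain d where "has_differential \<phi> d G" using assms(1) unfolding C1_slope_def by blast
  note d = has_differentialD[OF this]
  obtain e where "has_differential \<psi> e H" using assms(2) unfolding C1_slope_def by blast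
  note e = has_differentialD[OF this]
  show ?thesis
  proof (rule C1_slopeI[of _ "\<lambda>c y u. d c y u + e c y u"])
    fix c y u assume c: "c \<in> atlas M" "y \<in> image_of c"
    show "\<bar>d c y u + e c y u\<bar> \<le> (G (chart_inv c y) + H (chart_inv c y)) * norm_at c (chart_inv c y) u"
      using d(3)[OF c, of u] e(3)[OF c, of u] by (simp add: distrib_right)
    show "((\<lambda>y. \<phi> (chart_inv c y) + \<psi> (chart_inv c y)) has_derivative (\<lambda>u. d c y u + e c y u)) (at y)"
      by (intro has_derivative_add d(1) e(1) c)
  next
    fix c u assume c: "c \<in> atlas M"
    show "continuous_on (image_of c) (\<lambda>y. d c y u + e c y u)"
      by (intro continuous_on_add d(2) e(2) c)
  qed
qed

lemma C1_slope_compose: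
  assumes "C1_slope \<phi> G" and h: "\<And>t. (h has_real_derivative h' t) (at t)" "continuous_on UNIV h'"
  shows "C1_slope (\<lambda>q. h (\<phi> q)) (\<lambda>q. \<bar>h' (\<phi> q)\<bar> * G q)"
proof -
  obtain d where "has_differential \<phi> d G" using assms(1) unfolding C1_slope_def by blast
  note d = has_differentialD[OF this]
  show ?thesis
  proof (rule C1_slopeI[of _ "\<lambda>c y u. h' (\<phi> (chart_inv c y)) * d c y u"])
    fix c y u assume c: "c \<in> atlas M" "y \<in> image_of c"
    from DERIV_compose_FDERIV[OF h(1) d(1)[OF c]]
    show "((\<lambda>y. h (\<phi> (chart_inv c y))) has_derivative (\<lambda>u. h' (\<phi> (chart_inv c y)) * d c y u)) (at y)"
      by (simp add: mult.commute)
    have "\<bar>h' (\<phi> (chart_inv c y))\<bar> * \<bar>d c y u\<bar> \<le>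
        \<bar>h' (\<phi> (chart_inv c y))\<bar> * (G (chart_inv c y) * norm_at c (chart_inv c y) u)"
      by (intro mult_left_mono d(3) c) simp
    then show "\<bar>h' (\<phi> (chart_inv c y)) * d c y u\<bar> \<le>
        \<bar>h' (\<phi> (chart_inv c y))\<bar> * G (chart_inv c y) * norm_at c (chart_inv c y) u"
      by (simp add: abs_mult mult.assoc)
  next
    fix c u assume c: "c \<in> atlas M"
    have "continuous_on (image_of c) (\<lambda>y. \<phi> (chart_inv c y))"
      by (rule continuous_on_compose2[OF C1_slope_continuous[OF assms(1)] chart_inv_continuous[OF
          c]]) auto
    then show "continuous_on (image_of c) (\<lambda>y. h' (\<phi> (chart_inv c y)) * d c y u)"
      by (intro continuous_on_mult d(2)[OF c] continuous_on_compose2[OF h(2)]) auto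
  qed
qed

lemma C1_slope_cmult:
  assumes "C1_slope \<phi> G"
  shows "C1_slope (\<lambda>q. a * \<phi> q) (\<lambda>q. \<bar>a\<bar> * G q)"
  by (rule C1_slope_compose[OF assms, of "\<lambda>t. a * t" "\<lambda>_. a"]) (auto intro!: derivative_eq_intros)

lemma C1_slope_sum:
  assumes "\<And>i. i \<in> I \<Longrightarrow> C1_slope (\<phi> i) (G i)"
  shows "C1_slope (\<lambda>q. \<Sum>i\<in>I. \<phi> i q) (\<lambda>q. \<Sum>i\<in>I. G i q)"
  using assms
proof (induction I rule: infinite_finite_induct)
  case (insert i I)
  then have "C1_slope (\<lambda>q. \<phi> i q + (\<Sum>i\<in>I. \<phi> i q)) (\<lambda>q. G i q + (\<Sum>i\<in>I. G i q))"
    by (intro C1_slope_add) simp_all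
  then show ?case using insert(1,2) by simp
qed (simp_all add: C1_slope_const)

text \<open>The derivative of a smooth maximum is a convex combination of the derivatives of its arguments,
  so the common bound survives.\<close>

lemma C1_slope_smooth_max:
  assumes "C1_slope \<phi> (\<lambda>_. C)" "C1_slope \<psi> (\<lambda>_. C)" "0 < e"
  shows "C1_slope (\<lambda>q. \<psi> q + (\<phi> q - \<psi> q + sqrt ((\<phi> q - \<psi> q)\<^sup>2 + e\<^sup>2)) / 2) (\<lambda>_. C)"
proof -
  obtain d where "has_differential \<phi> d (\<lambda>_. C)" using assms(1) unfolding C1_slope_def by blast
  note d = has_differentialD[OF this]
  obtain d' where "has_differential \<psi> d' (\<lambda>_. C)" using assms(2) unfolding C1_slope_def by blast
  note d' = has_differentialD[OF this]
  define m where "m t = (t + sqrt (t\<^sup>2 + e\<^sup>2)) / 2" for t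
  define m' where "m' t = (1 + t / sqrt (t\<^sup>2 + e\<^sup>2)) / 2" for t
  have pos: "0 < t\<^sup>2 + e\<^sup>2" for t using assms(3) by (simp add: add_nonneg_pos)
  have m: "(m has_real_derivative m' t) (at t)" for t
    unfolding m_def[abs_def] m'_def using pos[of t]
    by (auto intro!: derivative_eq_intros simp: field_simps)
  have cm': "continuous_on UNIV m'"
    unfolding m'_def[abs_def] using pos by (intro continuous_intros) (auto simp: less_imp_neq[THEN
        not_sym])
  have m'01: "0 \<le> m' t" "m' t \<le> 1" for t
  proof -
    have "\<bar>t\<bar> \<le> sqrt (t\<^sup>2 + e\<^sup>2)" by (rule real_le_rsqrt) simp
    then have "\<bar>t / sqrt (t\<^sup>2 + e\<^sup>2)\<bar> \<le> 1" using pos[of t] by (simp add: abs_divide)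
    then have "- 1 \<le> t / sqrt (t\<^sup>2 + e\<^sup>2)" "t / sqrt (t\<^sup>2 + e\<^sup>2) \<le> 1" by linarith+
    then show "0 \<le> m' t" "m' t \<le> 1" by (simp_all add: m'_def del: abs_divide)
  qed
  have "C1_slope (\<lambda>q. \<psi> q + m (\<phi> q - \<psi> q)) (\<lambda>_. C)"
  proof (rule C1_slopeI[of _ "\<lambda>c y u. d' c y u + m' (\<phi> (chart_inv c y) - \<psi> (chart_inv c y)) * (d c y
      u - d' c y u)"])
    fix c y u assume c: "c \<in> atlas M" "y \<in> image_of c"
    let ?t = "\<phi> (chart_inv c y) - \<psi> (chart_inv c y)"
    have "((\<lambda>y. \<phi> (chart_inv c y) - \<psi> (chart_inv c y)) has_derivative (\<lambda>u. d c y u - d' c y u)) (at y)"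
      by (intro has_derivative_diff d(1) d'(1) c)
    from has_derivative_add[OF d'(1)[OF c] DERIV_compose_FDERIV[OF m this]]
    show "((\<lambda>y. \<psi> (chart_inv c y) + m (\<phi> (chart_inv c y) - \<psi> (chart_inv c y))) has_derivative
        (\<lambda>u. d' c y u + m' ?t * (d c y u - d' c y u))) (at y)"
      by (simp add: mult.commute)
    have "d' c y u + m' ?t * (d c y u - d' c y u) = (1 - m' ?t) * d' c y u + m' ?t * d c y u"
      by (simp add: algebra_simps)
    also have "\<bar>\<dots>\<bar> \<le> (1 - m' ?t) * \<bar>d' c y u\<bar> + m' ?t * \<bar>d c y u\<bar>"
      using m'01[of ?t] by (intro order_trans[OF abs_triangle_ineq]) (simp add: abs_mult)
    also have "\<dots> \<le> (1 - m' ?t) * (C * norm_at c (chart_inv c y) u) + m' ?t * (C * norm_at c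
        (chart_inv c y) u)"
      using m'01[of ?t] by (intro add_mono mult_left_mono d(3) d'(3) c) auto
    also have "\<dots> = C * norm_at c (chart_inv c y) u" by (simp add: algebra_simps)
    finally show "\<bar>d' c y u + m' ?t * (d c y u - d' c y u)\<bar> \<le> C * norm_at c (chart_inv c y) u" .
  next
    fix c u assume c: "c \<in> atlas M"
    have cc: "continuous_on (image_of c) (\<lambda>y. \<phi> (chart_inv c y))" "continuous_on (image_of c) (\<lambda>y. \<psi>
        (chart_inv c y))"
      by (rule continuous_on_compose2[OF C1_slope_continuous[OF assms(1)] chart_inv_continuous[OF c]]
               continuous_on_compose2[OF C1_slope_continuous[OF assms(2)] chart_inv_continuous[OF
                   c]]; simp)+
    show "continuous_on (image_of c) (\<lambda>y. d' c y u + m' (\<phi> (chart_inv c y) - \<psi> (chart_inv c y)) * (d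
        c y u - d' c y u))"
      by (intro continuous_intros d(2)[OF c] d'(2)[OF c] continuous_on_compose2[OF cm'
          continuous_on_diff[OF cc]]) auto
  qed
  then show ?thesis by (simp add: m_def)
qed

text \<open>Iterating the smooth maximum, with halved smoothing parameters so that the errors sum to at most
  \<open>e\<close>.\<close>

lemma C1_slope_finite_smooth_max:
  assumes "finite I" "\<And>i. i \<in> I \<Longrightarrow> C1_slope (w i) (\<lambda>_. C)" "0 \<le> C" "0 < e"
  obtains u where "C1_slope u (\<lambda>_. C)" "\<And>i q. i \<in> I \<Longrightarrow> w i q \<le> u q"
    "\<And>q. (\<forall>i\<in>I. w i q = 0) \<Longrightarrow> u q \<le> e"
  using assms(1,2,4)
proof (induction I arbitrary: e thesis rule: finite_induct)
  case empty
  have "C1_slope (\<lambda>_. 0) (\<lambda>_. C)" by (rule C1_slope_mono[OF C1_slope_const]) (rule assms(3))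
  then show ?case by (rule empty(1)) (use empty(3) in auto)
next
  case (insert i I)
  obtain u where u: "C1_slope u (\<lambda>_. C)" "\<And>i q. i \<in> I \<Longrightarrow> w i q \<le> u q"
    "\<And>q. (\<forall>i\<in>I. w i q = 0) \<Longrightarrow> u q \<le> e / 2"
    using insert.IH[of "e / 2"] insert.prems by auto
  define v where "v q = u q + (w i q - u q + sqrt ((w i q - u q)\<^sup>2 + e\<^sup>2)) / 2" for q
  have low: "\<bar>t\<bar> \<le> sqrt (t\<^sup>2 + e\<^sup>2)" for t by (rule real_le_rsqrt) simp
  have up: "sqrt (t\<^sup>2 + e\<^sup>2) \<le> \<bar>t\<bar> + e" for t
    using insert.prems(3) by (intro real_le_lsqrt) (auto simp: power2_eq_square algebra_simps)
  show ?case
  proof (rule insert.prems(1)[of v])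
    show "C1_slope v (\<lambda>_. C)"
      unfolding v_def using insert.prems u(1) by (intro C1_slope_smooth_max) auto
    show "w j q \<le> v q" if "j \<in> insert i I" for j q
    proof -
      let ?s = "sqrt ((w i q - u q)\<^sup>2 + e\<^sup>2)"
      have "w i q - u q \<le> ?s" "- (w i q - u q) \<le> ?s" using low[of "w i q - u q"] by (auto simp:
          abs_le_iff)
      then have "u q \<le> v q" "w i q \<le> v q" unfolding v_def by (simp_all only: field_simps)
      then show ?thesis using that u(2)[of j q] by auto
    qed
    show "v q \<le> e" if "\<forall>j\<in>insert i I. w j q = 0" for q
    proof -
      have "u q \<le> e / 2" "w i q = 0" using that u(3) by auto
      moreover have "v q \<le> u q + (w i q - u q + \<bar>w i q - u q\<bar> + e) / 2"
        using up[of "w i q - u q"] by (simp add: v_def)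
      ultimately show ?thesis using insert.prems(3) by (simp add: abs_if field_simps split: if_splits)
    qed
  qed
qed

text \<open>A compactly supported function in one chart is regular in every other chart: on the overlap by the
  chain rule, and elsewhere because it vanishes near the point. For the latter the support must be
  closed in the whole manifold, which holds because it is compact and the space is Hausdorff.\<close>

lemma C1_slope_extend_by_zero:
  assumes c0: "c0 \<in> atlas M"
    and W: "\<And>y. y \<in> image_of c0 \<Longrightarrow> (W has_derivative d y) (at y)"
    and d: "\<And>u. continuous_on (image_of c0) (\<lambda>y. d y u)"
    and K: "compact K" "K \<subseteq> image_of c0" "\<And>y. y \<in> image_of c0 \<Longrightarrow> y \<notin> K \<Longrightarrow> W y = 0"
    and bound: "\<And>y u. y \<in> image_of c0 \<Longrightarrow> \<bar>d y u\<bar> \<le> C * norm_at c0 (chart_inv c0 y) u"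
    and C: "0 \<le> C"
  shows "C1_slope (\<lambda>q. if q \<in> fst c0 then W (snd c0 q) else 0) (\<lambda>_. C)" (is "C1_slope ?w _")
proof (rule C1_slopeI)
  define D where "D c y u = (let q = chart_inv c y in
     if q \<in> fst c0 then d (snd c0 q) (dtransition c c0 q u) else 0)" for c y u
  have d0: "d y u = 0" if "y \<in> image_of c0" "y \<notin> K" for y u
  proof -
    have "open (image_of c0 - K)" using image_open[OF c0] K(1) by (auto intro: compact_imp_closed)
    then have "(W has_derivative (\<lambda>_. 0)) (at y)"
      by (rule has_derivative_transform_within_open[OF has_derivative_const]) (use that K(3) in auto)
    from has_derivative_unique[OF this W[OF that(1)]] show ?thesis by (metis)
  qed
  fix c assume c: "c \<in> atlas M"
  let ?O = "snd c ` (fst c \<inter> fst c0)" and ?V = "snd c ` (fst c - chart_inv c0 ` K)"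
  have "compact (chart_inv c0 ` K)"
    using K chart_inv_continuous[OF c0] by (intro compact_continuous_image) (auto intro:
        continuous_on_subset)
  then have V: "open ?V"
    using c by (intro chart_image_open) (auto intro!: open_Diff chart_open compact_imp_closed)
  have O: "open ?O" using overlap_open c c0 by blast
  have "fst c = (fst c \<inter> fst c0) \<union> (fst c - chart_inv c0 ` K)" using K(2) c0 chart_inv_in by blast
  then have image: "image_of c = ?O \<union> ?V" by (metis image_Un)
  have V0: "?w (chart_inv c y) = 0" "D c y = (\<lambda>_. 0)" if yV: "y \<in> ?V" for y
  proof -
    obtain q where q: "q \<in> fst c" "q \<notin> chart_inv c0 ` K" "y = snd c q" using yV by blast
    have "snd c0 q \<notin> K" if "q \<in> fst c0" using q(2) that c0 by (metis chart_inv_chart image_eqI)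
    then show "?w (chart_inv c y) = 0" "D c y = (\<lambda>_. 0)"
      using q c K(3) d0 by (auto simp: D_def Let_def fun_eq_iff)
  qed
  show "((\<lambda>y. ?w (chart_inv c y)) has_derivative D c y) (at y)" if y: "y \<in> image_of c" for y
  proof (cases "y \<in> ?O")
    case True
    then obtain q where q: "q \<in> fst c \<inter> fst c0" "y = snd c q" by auto
    have t: "transition c c0 y = snd c0 q" using q c by (auto simp: transition_chart)
    have "(W has_derivative d (snd c0 q)) (at (transition c c0 y))"
      unfolding t by (rule W) (use q in auto)
    from has_derivative_compose[OF transition_has_derivative[OF c c0 q(1), folded q(2)] this]
    have "((\<lambda>y. W (transition c c0 y)) has_derivative (\<lambda>u. d (snd c0 q) (dtransition c c0 q u))) (at
        y)" .
    then have "((\<lambda>y. ?w (chart_inv c y)) has_derivative (\<lambda>u. d (snd c0 q) (dtransition c c0 q u)))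
        (at y)"
      by (rule has_derivative_transform_within_open[OF _ O True]) (use c in \<open>auto simp: transition_def\<close>)
    moreover have "D c y = (\<lambda>u. d (snd c0 q) (dtransition c c0 q u))"
      using q c by (auto simp: D_def Let_def)
    ultimately show ?thesis by simp
  next
    case False
    then have yV: "y \<in> ?V" using y image by blast
    have "((\<lambda>y. ?w (chart_inv c y)) has_derivative (\<lambda>_. 0)) (at y)"
      by (rule has_derivative_transform_within_open[OF has_derivative_const V yV]) (use V0(1) in simp)
    then show ?thesis using V0(2)[OF yV] by simp
  qed
  show "continuous_on (image_of c) (\<lambda>y. D c y u)" for u
    unfolding image
  proof (rule continuous_on_open_Un[OF O V])
    have "continuous_on ?V (\<lambda>_. 0)" by (rule continuous_on_const)
    then show "continuous_on ?V (\<lambda>y. D c y u)"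
      by (rule continuous_on_eq) (use V0(2) in simp)
    have tc: "continuous_on ?O (transition c c0)"
      by (rule has_derivative_continuous_on[of _ _ "\<lambda>y. dtransition c c0 (chart_inv c y)"],
          rule has_derivative_at_withinI)
         (use transition_has_derivative[OF c c0] c in auto)
    have ti: "transition c c0 ` ?O \<subseteq> image_of c0" using c by (auto simp: transition_chart)
    have "continuous_on ?O (\<lambda>y. \<Sum>i\<in>UNIV. dtransition c c0 (chart_inv c y) u $ i * d (transition c c0
        y) (axis i 1))"
      by (intro continuous_on_sum continuous_on_mult continuous_on_component
          dtransition_continuous[OF c c0]
          continuous_on_compose2[OF d tc ti])
    then show "continuous_on ?O (\<lambda>y. D c y u)"
    proof (rule continuous_on_eq)
      fix y assume "y \<in> ?O"
      then obtain q where q: "q \<in> fst c \<inter> fst c0" "y = snd c q" by auto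
      have t: "transition c c0 y = snd c0 q" using q c by (auto simp: transition_chart)
      have "linear (d (snd c0 q))" using W[of "snd c0 q"] q has_derivative_linear by blast
      from linear_expand_axis[OF this, of "dtransition c c0 q u"]
      show "(\<Sum>i\<in>UNIV. dtransition c c0 (chart_inv c y) u $ i * d (transition c c0 y) (axis i 1)) =
          D c y u"
        using q c t by (simp add: D_def Let_def)
    qed
  qed
  show "\<bar>D c y u\<bar> \<le> C * norm_at c (chart_inv c y) u" if "y \<in> image_of c" for y u
  proof (cases "chart_inv c y \<in> fst c0")
    case True
    let ?q = "chart_inv c y"
    have q: "?q \<in> fst c \<inter> fst c0" using True chart_inv_in c that by blast
    have "\<bar>d (snd c0 ?q) (dtransition c c0 ?q u)\<bar> \<le> C * norm_at c0 ?q (dtransition c c0 ?q u)"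
      using bound[of "snd c0 ?q" "dtransition c c0 ?q u"] True c0 by simp
    then show ?thesis using True norm_at_transition[OF c c0 q, of u] by (simp add: D_def Let_def)
  next
    case False
    then show ?thesis using C norm_at_nonneg[OF c chart_inv_in[OF c that], of u] by (simp add: D_def)
  qed
qed

section \<open>Chains of coordinate segments\<close>

text \<open>The points \<open>x\<close> and \<open>y\<close> are joined by a straight segment in some chart, along which the constant
  coordinate velocity has norm at most \<open>l\<close>; so the segment has length at most \<open>l\<close>.\<close>

definition edge :: "'a \<Rightarrow> real \<Rightarrow> 'a \<Rightarrow> bool" where
  "edge x l y \<longleftrightarrow> (\<exists>c\<in>atlas M. x \<in> fst c \<and> y \<in> fst c \<and>
     closed_segment (snd c x) (snd c y) \<subseteq> image_of c \<and>
     (\<forall>z\<in>closed_segment (snd c x) (snd c y). norm_at c (chart_inv c z) (snd c y - snd c x) \<le> l))"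

inductive chain :: "'a \<Rightarrow> real \<Rightarrow> 'a \<Rightarrow> bool" where
  chain_refl: "chain x 0 x"
| chain_step: "chain x L y \<Longrightarrow> edge y l z \<Longrightarrow> chain x (L + l) z"

lemma edge_sym:
  assumes "edge x l y"
  shows "edge y l x"
proof -
  obtain c where c: "c \<in> atlas M" "x \<in> fst c" "y \<in> fst c"
     "closed_segment (snd c x) (snd c y) \<subseteq> image_of c"
     "\<And>z. z \<in> closed_segment (snd c x) (snd c y) \<Longrightarrow> norm_at c (chart_inv c z) (snd c y - snd c x) \<le> l"
    using assms unfolding edge_def by blast
  have "norm_at c (chart_inv c z) (snd c x - snd c y) \<le> l" if z: "z \<in> closed_segment (snd c x) (snd
      c y)" for z
  proof -
    have "chart_inv c z \<in> fst c" using z c(1,4) chart_inv_in by blast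
    from norm_at_scale[OF c(1) this, of "-1" "snd c y - snd c x"] c(5)[OF z] show ?thesis by simp
  qed
  then show ?thesis
    unfolding edge_def closed_segment_commute[of "snd _ y"] using c(1-4) by blast
qed

lemma edge_refl: "edge x 0 x"
proof -
  obtain c where c: "c \<in> atlas M" "x \<in> fst c" by (rule chart_exists)
  then have "norm_at c x 0 = 0" using norm_at_scale[OF c, of 0 0] by simp
  then show ?thesis unfolding edge_def using c by auto
qed

lemma edge_nonneg:
  assumes "edge x l y"
  shows "0 \<le> l"
proof -
  obtain c where c: "c \<in> atlas M" "x \<in> fst c"
     "norm_at c (chart_inv c (snd c x)) (snd c y - snd c x) \<le> l"
    using assms unfolding edge_def by blast
  then show ?thesis using norm_at_nonneg[OF c(1,2), of "snd c y - snd c x"] by simp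
qed

lemma chain_trans:
  assumes "chain y L' z" "chain x L y"
  shows "chain x (L + L') z"
  using assms
proof (induction rule: chain.induct)
  case (chain_refl y)
  then show ?case by simp
next
  case (chain_step y L' z l w)
  from chain.chain_step[OF chain_step(3)[OF chain_step(4)] chain_step(2)]
  show ?case by (simp add: add.assoc)
qed

lemma edge_chain: "edge x l y \<Longrightarrow> chain x l y"
  using chain_step[OF chain_refl] by force

lemma chain_sym:
  assumes "chain x L y"
  shows "chain y L x"
  using assms
proof (induction rule: chain.induct)
  case (chain_refl x)
  then show ?case by (rule chain.chain_refl)
next
  case (chain_step x L y l z)
  from chain_trans[OF chain_step(3) edge_chain[OF edge_sym[OF chain_step(2)]]]
  show ?case by (simp add: add.commute)
qed

lemma chain_sequence:
  assumes "chain x L y"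
  obtains N z l where "0 < N" "z 0 = x" "z N = y" "\<And>i. i < N \<Longrightarrow> edge (z i) (l i) (z (Suc i))"
    "L = (\<Sum>i<N. l i)"
proof -
  have "\<exists>N z l. 0 < N \<and> z 0 = x \<and> z N = y \<and> (\<forall>i<N. edge (z i) (l i) (z (Suc i))) \<and> L = (\<Sum>i<N. l i)"
    using assms
  proof (induction rule: chain.induct)
    case (chain_refl x)
    show ?case
      by (rule exI[of _ 1], rule exI[of _ "\<lambda>_. x"], rule exI[of _ "\<lambda>_. 0"]) (simp add: edge_refl)
  next
    case (chain_step x L y k w)
    then obtain N z l where *: "0 < N" "z 0 = x" "z N = y" "\<forall>i<N. edge (z i) (l i) (z (Suc i))"
      "L = (\<Sum>i<N. l i)" by blast
    show ?case
    proof (rule exI[of _ "Suc N"], rule exI[of _ "z(Suc N := w)"], rule exI[of _ "l(N := k)"],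
        intro conjI allI impI)
      show "edge ((z(Suc N := w)) i) ((l(N := k)) i) ((z(Suc N := w)) (Suc i))" if "i < Suc N" for i
        using that * chain_step(2) by (cases "i = N") auto
      show "L + k = (\<Sum>i<Suc N. (l(N := k)) i)" using *(5) by simp
    qed (use * in auto)
  qed
  then show thesis using that by blast
qed

text \<open>A straight segment in the chart \<open>c0\<close>, viewed in another chart, has the velocity that the
    transition
  map assigns to the coordinate velocity.\<close>

lemma coordinate_segment_derivative:
  assumes c0: "c0 \<in> atlas M" and c: "c \<in> atlas M" and t: "t \<in> {a..b}"
    and image: "\<And>s. s \<in> {a..b} \<Longrightarrow> A + s *\<^sub>R V \<in> image_of c0"
    and \<gamma>: "\<And>s. s \<in> {a..b} \<Longrightarrow> \<gamma> s = chart_inv c0 (A + s *\<^sub>R V)"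
    and "\<gamma> t \<in> fst c"
  shows "((snd c \<circ> \<gamma>) has_vector_derivative dtransition c0 c (\<gamma> t) V) (at t within {a..b})"
proof -
  have q: "\<gamma> t \<in> fst c0 \<inter> fst c" using assms(6) \<gamma>[OF t] image[OF t] chart_inv_in[OF c0] by auto
  have st: "snd c0 (\<gamma> t) = A + t *\<^sub>R V" using \<gamma>[OF t] image[OF t] c0 by auto
  have lin: "linear (dtransition c0 c (\<gamma> t))" by (rule dtransition_linear[OF c0 c q])
  have "((\<lambda>s. A + s *\<^sub>R V) has_derivative (\<lambda>s. s *\<^sub>R V)) (at t within {a..b})"
    by (auto intro!: derivative_eq_intros)
  from has_derivative_compose[OF this transition_has_derivative[OF c0 c q, unfolded st]]
  have "((\<lambda>s. transition c0 c (A + s *\<^sub>R V)) has_vector_derivative dtransition c0 c (\<gamma> t) V) (at t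
      within {a..b})"
    by (simp add: has_vector_derivative_def linear_scale[OF lin])
  then show ?thesis
    by (rule has_vector_derivative_transform[OF t, rotated]) (use \<gamma> in \<open>simp add: transition_def\<close>)
qed

lemma coordinate_segment_C1:
  assumes c0: "c0 \<in> atlas M" and "a < b"
    and image: "\<And>s. s \<in> {a..b} \<Longrightarrow> A + s *\<^sub>R V \<in> image_of c0"
    and \<gamma>: "\<And>s. s \<in> {a..b} \<Longrightarrow> \<gamma> s = chart_inv c0 (A + s *\<^sub>R V)"
  shows "C1_curve_on M a b \<gamma>"
  unfolding C1_curve_on_def
proof (intro conjI ballI)
  have aff: "continuous_on S (\<lambda>s. A + s *\<^sub>R V)" for S by (intro continuous_intros)
  have "continuous_on {a..b} (\<lambda>s. chart_inv c0 (A + s *\<^sub>R V))"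
    by (rule continuous_on_compose2[OF chart_inv_continuous[OF c0] aff]) (use image in blast)
  then show "continuous_on {a..b} \<gamma>"
    by (rule continuous_on_eq) (use \<gamma> in simp)
  fix c assume c: "c \<in> atlas M"
  have der: "((snd c \<circ> \<gamma>) has_vector_derivative dtransition c0 c (\<gamma> t) V) (at t within {a..b})"
    if "t \<in> {a..b} \<inter> \<gamma> -` fst c" for t
    using that by (intro coordinate_segment_derivative[OF c0 c _ image \<gamma>]) auto
  show "(snd c \<circ> \<gamma>) differentiable at t within {a..b}" if "t \<in> {a..b} \<inter> \<gamma> -` fst c" for t
    using der[OF that] by (rule differentiableI_vector)
  have sub: "(\<lambda>s. A + s *\<^sub>R V) ` ({a..b} \<inter> \<gamma> -` fst c) \<subseteq> snd c0 ` (fst c0 \<inter> fst c)"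
  proof
    fix y assume "y \<in> (\<lambda>s. A + s *\<^sub>R V) ` ({a..b} \<inter> \<gamma> -` fst c)"
    then obtain s where s: "s \<in> {a..b}" "\<gamma> s \<in> fst c" "y = A + s *\<^sub>R V" by blast
    then have "y = snd c0 (\<gamma> s)" "\<gamma> s \<in> fst c0"
      using \<gamma>[OF s(1)] image[OF s(1)] c0 chart_inv_in[OF c0] by auto
    then show "y \<in> snd c0 ` (fst c0 \<inter> fst c)" using s(2) by blast
  qed
  have "continuous_on ({a..b} \<inter> \<gamma> -` fst c) (\<lambda>t. dtransition c0 c (chart_inv c0 (A + t *\<^sub>R V)) V)"
    by (rule continuous_on_compose2[OF dtransition_continuous[OF c0 c] aff sub])
  then show "continuous_on ({a..b} \<inter> \<gamma> -` fst c) (\<lambda>t. vector_derivative (snd c \<circ> \<gamma>) (at t within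
      {a..b}))"
  proof (rule continuous_on_eq)
    fix t assume t: "t \<in> {a..b} \<inter> \<gamma> -` fst c"
    then have tab: "t \<in> {a..b}" by blast
    from vector_derivative_within_closed_interval[OF \<open>a < b\<close> tab der[OF t]]
    show "dtransition c0 c (chart_inv c0 (A + t *\<^sub>R V)) V = vector_derivative (snd c \<circ> \<gamma>) (at t
        within {a..b})"
      using \<gamma>[OF tab] by simp
  qed
qed

lemma coordinate_segment_speed:
  assumes c0: "c0 \<in> atlas M" and t: "a < t" "t < b"
    and image: "\<And>s. s \<in> {a..b} \<Longrightarrow> A + s *\<^sub>R V \<in> image_of c0"
    and \<gamma>: "\<And>s. s \<in> {a..b} \<Longrightarrow> \<gamma> s = chart_inv c0 (A + s *\<^sub>R V)"
  shows "speed M \<gamma> t = norm_at c0 (\<gamma> t) V"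
proof -
  define c where "c = chart_at M (\<gamma> t)"
  have c: "c \<in> atlas M" "\<gamma> t \<in> fst c" unfolding c_def by (rule chart_at)+
  have tab: "t \<in> {a..b}" using t by simp
  have q: "\<gamma> t \<in> fst c0 \<inter> fst c" using c(2) \<gamma>[OF tab] image[OF tab] chart_inv_in[OF c0] by auto
  have "((snd c \<circ> \<gamma>) has_vector_derivative dtransition c0 c (\<gamma> t) V) (at t within {a..b})"
    by (rule coordinate_segment_derivative[OF c0 c(1) tab image \<gamma> c(2)])
  then have "((snd c \<circ> \<gamma>) has_vector_derivative dtransition c0 c (\<gamma> t) V) (at t)"
    using t by (simp add: at_within_Icc_at)
  then have "vector_derivative (snd c \<circ> \<gamma>) (at t) = dtransition c0 c (\<gamma> t) V"
    by (rule vector_derivative_at)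
  then have "speed M \<gamma> t = norm_at c (\<gamma> t) (dtransition c0 c (\<gamma> t) V)"
    by (simp add: speed_def Let_def c_def[symmetric] norm_at_def)
  also have "\<dots> = norm_at c0 (\<gamma> t) V" by (rule norm_at_transition[OF c0 c(1) q])
  finally show ?thesis .
qed

text \<open>The \<open>N\<close> segments of the chain are traversed one after the other, each in time \<open>1/N\<close>. Segment \<open>i\<close>
  is then run with speed at most \<open>N * l i\<close> and contributes at most \<open>l i\<close> to the length.\<close>

lemma riem_dist_le_chain:
  assumes "chain x L y"
  shows "riem_dist M x y \<le> ennreal L"
proof -
  obtain N z l where N: "0 < N" "z 0 = x" "z N = y" "\<And>i. i < N \<Longrightarrow> edge (z i) (l i) (z (Suc i))"
    "L = (\<Sum>i<N. l i)" using chain_sequence[OF assms] by blast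
  have "\<exists>c. \<forall>i<N. c i \<in> atlas M \<and> z i \<in> fst (c i) \<and> z (Suc i) \<in> fst (c i) \<and>
     closed_segment (snd (c i) (z i)) (snd (c i) (z (Suc i))) \<subseteq> image_of (c i) \<and>
     (\<forall>w\<in>closed_segment (snd (c i) (z i)) (snd (c i) (z (Suc i))).
        norm_at (c i) (chart_inv (c i) w) (snd (c i) (z (Suc i)) - snd (c i) (z i)) \<le> l i)"
    using N(4) unfolding edge_def by (intro choice) blast
  then obtain c where c: "\<And>i. i < N \<Longrightarrow> c i \<in> atlas M" "\<And>i. i < N \<Longrightarrow> z i \<in> fst (c i)"
     "\<And>i. i < N \<Longrightarrow> z (Suc i) \<in> fst (c i)"
     "\<And>i. i < N \<Longrightarrow> closed_segment (snd (c i) (z i)) (snd (c i) (z (Suc i))) \<subseteq> image_of (c i)"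
     "\<And>i w. i < N \<Longrightarrow> w \<in> closed_segment (snd (c i) (z i)) (snd (c i) (z (Suc i))) \<Longrightarrow>
        norm_at (c i) (chart_inv (c i) w) (snd (c i) (z (Suc i)) - snd (c i) (z i)) \<le> l i"
    by blast
  define a where "a i = snd (c i) (z i)" for i
  define v where "v i = snd (c i) (z (Suc i)) - snd (c i) (z i)" for i
  define P where "P i \<tau> = chart_inv (c i) (a i + \<tau> *\<^sub>R v i)" for i \<tau>
  \<comment> \<open>On \<open>[i/N, (i+1)/N)\<close> the curve runs through segment \<open>i\<close>; the endpoint is set separately.\<close>
  define \<gamma> where "\<gamma> t = (if 1 \<le> t then z N else P (nat \<lfloor>real N * t\<rfloor>) (real N * t - real (nat \<lfloor>real N
      * t\<rfloor>)))" for t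
  define s where "s i = real i / real N" for i
  have P0: "P i 0 = z i" if "i < N" for i using c(1,2)[OF that] by (simp add: P_def a_def)
  have P1: "P i 1 = z (Suc i)" if "i < N" for i using c(1,3)[OF that] by (simp add: P_def a_def v_def)
  have piece: "\<gamma> t = P i (real N * t - real i)" if i: "i < N" and t: "t \<in> {s i..s (Suc i)}" for i t
  proof (cases "t = s (Suc i)")
    case True
    then have Nt: "real N * t = real (Suc i)" using N(1) by (simp add: s_def)
    show ?thesis
    proof (cases "Suc i = N")
      case True
      then have "1 \<le> t" using Nt N(1) by simp
      moreover have "real N * t - real i = 1" using Nt by simp
      ultimately show ?thesis using P1[OF i] True by (simp add: \<gamma>_def)
    next
      case False
      then have "Suc i < N" using i by simp
      then have "real N * t < real N * 1" unfolding Nt by simp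
      then have "t < 1" using N(1) by (simp only: mult_less_cancel_left_pos of_nat_0_less_iff)
      moreover have "nat \<lfloor>real N * t\<rfloor> = Suc i" unfolding Nt by linarith
      ultimately show ?thesis using P1[OF i] P0[OF \<open>Suc i < N\<close>] Nt by (simp add: \<gamma>_def)
    qed
  next
    case False
    then have "real i \<le> real N * t" "real N * t < real i + 1"
      using t N(1) by (auto simp: s_def field_simps)
    moreover from this have "real N * t < real N" using i by linarith
    then have "t < 1" using N(1) by simp
    moreover have "nat \<lfloor>real N * t\<rfloor> = i" using calculation by linarith
    ultimately show ?thesis by (simp add: \<gamma>_def)
  qed
  have affine: "\<gamma> t = chart_inv (c i) ((a i - real i *\<^sub>R v i) + t *\<^sub>R (real N *\<^sub>R v i))"
    and segment: "(a i - real i *\<^sub>R v i) + t *\<^sub>R (real N *\<^sub>R v i) \<in> closed_segment (snd (c i) (z i))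
        (snd (c i) (z (Suc i)))"
    if i: "i < N" and t: "t \<in> {s i..s (Suc i)}" for i t
  proof -
    have eq: "(a i - real i *\<^sub>R v i) + t *\<^sub>R (real N *\<^sub>R v i) = a i + (real N * t - real i) *\<^sub>R v i"
      by (simp add: algebra_simps)
    show "\<gamma> t = chart_inv (c i) ((a i - real i *\<^sub>R v i) + t *\<^sub>R (real N *\<^sub>R v i))"
      unfolding eq piece[OF i t] P_def ..
    have "0 \<le> real N * t - real i" "real N * t - real i \<le> 1"
      using t N(1) by (auto simp: s_def field_simps)
    then show "(a i - real i *\<^sub>R v i) + t *\<^sub>R (real N *\<^sub>R v i) \<in> closed_segment (snd (c i) (z i))
        (snd (c i) (z (Suc i)))"
      unfolding eq a_def v_def in_segment
      by (intro exI[of _ "real N * t - real i"]) (simp add: algebra_simps)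
  qed
  have s_less: "s i < s (Suc i)" for i using N(1) by (simp add: s_def divide_strict_right_mono)
  have curve: "piecewise_C1_curve M \<gamma>"
    unfolding piecewise_C1_curve_def
  proof (intro exI[of _ N] exI[of _ s] conjI allI impI)
    fix i assume i: "i < N"
    show "C1_curve_on M (s i) (s (Suc i)) \<gamma>"
      by (rule coordinate_segment_C1[OF c(1)[OF i] s_less _ affine[OF i]])
         (use segment[OF i] c(4)[OF i] in blast)+
  qed (use N(1) s_less in \<open>auto simp: s_def\<close>)
  have ends: "\<gamma> 0 = x" "\<gamma> 1 = y"
    using N(1-3) P0[of 0] by (simp_all add: \<gamma>_def)
  have speed_le: "speed M \<gamma> t \<le> real N * l i" if i: "i < N" and t: "s i < t" "t < s (Suc i)" for i t
  proof -
    have tt: "t \<in> {s i..s (Suc i)}" using t by simp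
    have im: "(a i - real i *\<^sub>R v i) + t *\<^sub>R (real N *\<^sub>R v i) \<in> image_of (c i)"
        if "t \<in> {s i..s (Suc i)}" for t
      using segment[OF i that] c(4)[OF i] by blast
    have "speed M \<gamma> t = norm_at (c i) (\<gamma> t) (real N *\<^sub>R v i)"
      by (rule coordinate_segment_speed[OF c(1)[OF i] t im affine[OF i]])
    also have "\<dots> = real N * norm_at (c i) (\<gamma> t) (v i)"
      using norm_at_scale[OF c(1)[OF i], of "\<gamma> t" "real N" "v i"] affine[OF i tt] im[OF tt]
        chart_inv_in[OF c(1)[OF i]] by auto
    also have "\<dots> \<le> real N * l i"
      using c(5)[OF i segment[OF i tt]] affine[OF i tt] by (intro mult_left_mono) (simp_all add: v_def)
    finally show ?thesis .
  qed
  have l0: "0 \<le> l i" if "i < N" for i using edge_nonneg N(4)[OF that] by blast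
  have "curve_length M \<gamma> \<le> (\<integral>\<^sup>+ t. (\<Sum>i<N. ennreal (real N * l i) * indicator {s i<..<s (Suc i)} t)
      \<partial>lborel)"
    unfolding curve_length_def
  proof (rule nn_integral_mono_AE)
    \<comment> \<open>The speed is known only away from the finitely many break points.\<close>
    have "AE t in lborel. \<forall>i\<in>{..N}. t \<noteq> s i"
      by (subst AE_ball_countable) (auto simp: AE_lborel_singleton)
    then show "AE t in lborel. ennreal (speed M \<gamma> t) * indicator {0..1} t \<le>
        (\<Sum>i<N. ennreal (real N * l i) * indicator {s i<..<s (Suc i)} t)"
    proof eventually_elim
      case (elim t)
      show ?case
      proof (cases "t \<in> {0..1}")
        case True
        have "t \<noteq> s 0" "t \<noteq> s N" using elim by blast+
        then have "t \<noteq> 0" "t \<noteq> 1" using N(1) by (simp_all add: s_def)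
        then have t01: "0 < t" "t < 1" using True by simp_all
        define i where "i = nat \<lfloor>real N * t\<rfloor>"
        have "0 < real N * t" "real N * t < real N" using t01 N(1) by auto
        then have i: "i < N" "real i \<le> real N * t" "real N * t < real i + 1"
          unfolding i_def by linarith+
        then have "s i \<le> t" "t < s (Suc i)" using N(1) by (auto simp: s_def field_simps)
        moreover have "t \<noteq> s i" using elim i(1) by auto
        ultimately have st: "s i < t" "t < s (Suc i)" by simp_all
        have "ennreal (speed M \<gamma> t) * indicator {0..1} t \<le> ennreal (real N * l i) * indicator {s
            i<..<s (Suc i)} t"
          using st True speed_le[OF i(1) st] by (simp add: ennreal_leI)
        also have "\<dots> \<le> (\<Sum>i<N. ennreal (real N * l i) * indicator {s i<..<s (Suc i)} t)"
          by (rule member_le_sum[of i]) (use i in auto)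
        finally show ?thesis .
      qed simp
    qed
  qed
  also have "\<dots> = (\<Sum>i<N. \<integral>\<^sup>+ t. ennreal (real N * l i) * indicator {s i<..<s (Suc i)} t \<partial>lborel)"
    by (rule nn_integral_sum) simp
  also have "\<dots> = (\<Sum>i<N. ennreal (l i))"
  proof (rule sum.cong)
    fix i assume "i \<in> {..<N}"
    have "(\<integral>\<^sup>+ t. ennreal (real N * l i) * indicator {s i<..<s (Suc i)} t \<partial>lborel) = ennreal (real N
        * l i) * ennreal (s (Suc i) - s i)"
      using s_less[of i] by (subst nn_integral_cmult_indicator) (auto simp: less_imp_le)
    also have "s (Suc i) - s i = 1 / real N" by (simp add: s_def diff_divide_distrib[symmetric])
    also have "ennreal (real N * l i) * ennreal (1 / real N) = ennreal (l i)"
      using N(1) l0 \<open>i \<in> {..<N}\<close> by (subst ennreal_mult[symmetric]) auto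
    finally show "(\<integral>\<^sup>+ t. ennreal (real N * l i) * indicator {s i<..<s (Suc i)} t \<partial>lborel) =
        ennreal (l i)" .
  qed simp
  also have "\<dots> = ennreal L" unfolding N(5) using l0 by (subst sum_ennreal) auto
  finally have "curve_length M \<gamma> \<le> ennreal L" .
  moreover have "riem_dist M x y \<le> curve_length M \<gamma>"
    unfolding riem_dist_def by (rule INF_lower) (use curve ends in auto)
  ultimately show ?thesis by (rule order_trans[rotated])
qed

section \<open>Cut-off functions adapted to chain neighbourhoods\<close>

lemma norm_at_triangle:
  assumes "c \<in> atlas M" "q \<in> fst c"
  shows "norm_at c q (u + w) \<le> norm_at c q u + norm_at c q w"
proof (rule power2_le_imp_le)
  have b: "bilinear (metric M c q)" using metric_bilinear assms by blast
  have "(norm_at c q (u + w))\<^sup>2 = metric M c q u u + 2 * metric M c q u w + metric M c q w w"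
    using metric_sym[OF assms, of w u]
    by (simp add: norm_at_square[OF assms] bilinear_ladd[OF b] bilinear_radd[OF b])
  also have "\<dots> \<le> (norm_at c q u)\<^sup>2 + 2 * (norm_at c q u * norm_at c q w) + (norm_at c q w)\<^sup>2"
    using metric_Cauchy_Schwarz[OF assms, of u w] by (simp add: norm_at_square[OF assms])
  also have "\<dots> = (norm_at c q u + norm_at c q w)\<^sup>2" by (simp add: power2_eq_square algebra_simps)
  finally show "(norm_at c q (u + w))\<^sup>2 \<le> (norm_at c q u + norm_at c q w)\<^sup>2" .
  show "0 \<le> norm_at c q u + norm_at c q w" using norm_at_nonneg[OF assms] by (simp add:
      add_nonneg_nonneg)
qed

lemma norm_at_continuous:
  assumes "c \<in> atlas M" "q \<in> fst c" "continuous_on S f"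
  shows "continuous_on S (\<lambda>x. norm_at c q (f x))"
proof -
  have "continuous_on S (\<lambda>x. \<Sum>i\<in>UNIV. \<Sum>j\<in>UNIV. f x $ i * f x $ j * metric M c q (axis i 1) (axis j 1))"
    by (intro continuous_intros assms(3))
  moreover have "metric M c q (f x) (f x) =
      (\<Sum>i\<in>UNIV. \<Sum>j\<in>UNIV. f x $ i * f x $ j * metric M c q (axis i 1) (axis j 1))" for x
    by (rule metric_expand[OF assms(1,2)])
  ultimately have "continuous_on S (\<lambda>x. metric M c q (f x) (f x))" by (simp only:)
  then show ?thesis unfolding norm_at_def by (rule continuous_on_real_sqrt)
qed

text \<open>The norm attains a positive minimum on the compact Euclidean unit sphere.\<close>

lemma norm_at_ge_euclidean:
  assumes "c \<in> atlas M" "q \<in> fst c"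
  obtains \<kappa> where "0 < \<kappa>" "\<And>u. \<kappa> * norm u \<le> norm_at c q u"
proof -
  have "continuous_on (sphere 0 1) (\<lambda>u. norm_at c q u)"
    by (intro norm_at_continuous assms continuous_on_id)
  moreover have "sphere 0 1 \<noteq> ({} :: (real ^ 'n) set)"
    by (metis mem_sphere_0 norm_axis_1 empty_iff)
  ultimately obtain w :: "real ^ 'n" where w: "w \<in> sphere 0 1" "\<And>u. u \<in> sphere 0 1 \<Longrightarrow> norm_at c q w \<le>
      norm_at c q u"
    using continuous_attains_inf[OF compact_sphere, of 0 1 "\<lambda>u. norm_at c q u"] by blast
  show thesis
  proof (rule that[of "norm_at c q w"])
    have "w \<noteq> 0" using w(1) by auto
    then show "0 < norm_at c q w" by (rule norm_at_pos[OF assms])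
    show "norm_at c q w * norm u \<le> norm_at c q u" for u
    proof (cases "u = 0")
      case True
      then show ?thesis using norm_at_nonneg[OF assms, of u] by simp
    next
      case False
      have "norm_at c q w \<le> norm_at c q ((1 / norm u) *\<^sub>R u)"
        by (rule w(2)) (use False in simp)
      also have "\<dots> = (1 / norm u) * norm_at c q u" by (simp add: norm_at_scale[OF assms])
      finally show ?thesis using False by (simp add: field_simps)
    qed
  qed
qed

lemma metric_diff_le:
  assumes c: "c \<in> atlas M" and "q \<in> fst c" "q' \<in> fst c"
  shows "\<bar>metric M c q u u - metric M c q' u u\<bar> \<le>
    (\<Sum>i\<in>UNIV. \<Sum>j\<in>UNIV. \<bar>metric M c q (axis i 1) (axis j 1) - metric M c q' (axis i 1) (axis j 1)\<bar>) *
        (norm u)\<^sup>2"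
proof -
  have "metric M c q u u - metric M c q' u u =
     (\<Sum>i\<in>UNIV. \<Sum>j\<in>UNIV. u $ i * u $ j * (metric M c q (axis i 1) (axis j 1) - metric M c q' (axis i
         1) (axis j 1)))"
    unfolding metric_expand[OF assms(1,2), of u u] metric_expand[OF assms(1,3), of u u]
    by (simp add: sum_subtractf[symmetric] right_diff_distrib)
  also have "\<bar>\<dots>\<bar> \<le> (\<Sum>i\<in>UNIV. \<Sum>j\<in>UNIV. \<bar>u $ i * u $ j * (metric M c q (axis i 1) (axis j 1) - metric
      M c q' (axis i 1) (axis j 1))\<bar>)"
    by (intro order_trans[OF sum_abs] sum_mono sum_abs)
  also have "\<dots> \<le> (\<Sum>i\<in>UNIV. \<Sum>j\<in>UNIV. \<bar>metric M c q (axis i 1) (axis j 1) - metric M c q' (axis i 1)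
      (axis j 1)\<bar> * (norm u)\<^sup>2)"
  proof (intro sum_mono)
    fix i j :: 'n
    have "\<bar>u $ i\<bar> * \<bar>u $ j\<bar> \<le> norm u * norm u"
      by (intro mult_mono component_le_norm_cart) auto
    then have "\<bar>u $ i * u $ j\<bar> \<le> (norm u)\<^sup>2" by (simp add: abs_mult power2_eq_square)
    then have "\<bar>u $ i * u $ j\<bar> * \<bar>metric M c q (axis i 1) (axis j 1) - metric M c q' (axis i 1)
        (axis j 1)\<bar>
       \<le> (norm u)\<^sup>2 * \<bar>metric M c q (axis i 1) (axis j 1) - metric M c q' (axis i 1) (axis j 1)\<bar>"
      by (rule mult_right_mono) simp
    then show "\<bar>u $ i * u $ j * (metric M c q (axis i 1) (axis j 1) - metric M c q' (axis i 1) (axis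
        j 1))\<bar> \<le>
       \<bar>metric M c q (axis i 1) (axis j 1) - metric M c q' (axis i 1) (axis j 1)\<bar> * (norm u)\<^sup>2"
      by (simp only: abs_mult mult.commute)
  qed
  finally show ?thesis by (simp only: sum_distrib_right)
qed

text \<open>On the ball of radius \<open>r\<close> about \<open>x\<close>, taken in coordinates and with respect to the norm at \<open>q\<close>, the
  Riemannian norm and the norm at \<open>q\<close> agree up to the factor \<open>1 + \<epsilon>\<close>. The centre \<open>x\<close> differs from the
  reference point \<open>q\<close>, so that finitely many \<open>q\<close> can serve all \<open>x\<close>.\<close>

definition nearly_flat :: "real \<Rightarrow> real \<Rightarrow> ('a, 'n) chart \<Rightarrow> 'a \<Rightarrow> 'a \<Rightarrow> bool" where
  "nearly_flat \<epsilon> r c q x \<longleftrightarrow> c \<in> atlas M \<and> q \<in> fst c \<and> x \<in> fst c \<and>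
     (\<forall>y. norm_at c q (y - snd c x) \<le> r \<longrightarrow> y \<in> image_of c \<and>
        (\<forall>u. norm_at c (chart_inv c y) u \<le> (1 + \<epsilon>) * norm_at c q u \<and>
             norm_at c q u \<le> (1 + \<epsilon>) * norm_at c (chart_inv c y) u))"

text \<open>The metric coefficients are continuous, and a small change of the coefficients is small
    relative to
  the norm at \<open>q\<close> because that norm dominates a multiple of the Euclidean norm.\<close>

lemma nearly_flat_at_point:
  assumes "0 < \<epsilon>"
  obtains c r where "0 < r" "nearly_flat \<epsilon> r c q q"
proof -
  obtain c where c: "c \<in> atlas M" and q: "q \<in> fst c" by (rule chart_exists)
  obtain \<kappa> where \<kappa>: "0 < \<kappa>" "\<And>u. \<kappa> * norm u \<le> norm_at c q u"
    by (rule norm_at_ge_euclidean[OF c q]) blast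
  define E where "E y = (\<Sum>i\<in>UNIV. \<Sum>j\<in>UNIV. \<bar>metric M c (chart_inv c y) (axis i 1) (axis j 1) -
      metric M c q (axis i 1) (axis j 1)\<bar>)" for y
  have E_cont: "continuous_on (image_of c) E"
    unfolding E_def
    by (intro continuous_intros continuous_on_compose2[OF metric_continuous[OF c]
        chart_inv_continuous[OF c]])
       (use chart_inv_in[OF c] in blast)
  have E0: "E (snd c q) = 0" using c q by (simp add: E_def)
  have qi: "snd c q \<in> image_of c" using q by blast
  \<comment> \<open>Chosen so that both \<open>1 + \<epsilon>'\<close> and \<open>1 / (1 - \<epsilon>')\<close> are at most \<open>1 + \<epsilon>\<close>.\<close>
  define \<epsilon>' where "\<epsilon>' = \<epsilon> / (1 + \<epsilon>)"
  have \<epsilon>': "0 < \<epsilon>'" "\<epsilon>' \<le> \<epsilon>" "(1 + \<epsilon>) * (1 - \<epsilon>') = 1"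
    using assms by (auto simp: \<epsilon>'_def field_simps)
  obtain d1 where d1: "0 < d1" "\<And>y. y \<in> image_of c \<Longrightarrow> dist y (snd c q) < d1 \<Longrightarrow> dist (E y) (E (snd c
      q)) < \<kappa>\<^sup>2 * \<epsilon>'"
    using E_cont[unfolded continuous_on_iff, rule_format, OF qi, of "\<kappa>\<^sup>2 * \<epsilon>'"] \<kappa>(1) \<epsilon>'(1) by auto
  obtain d2 where d2: "0 < d2" "ball (snd c q) d2 \<subseteq> image_of c"
    using image_open[OF c] qi openE by blast
  define r where "r = \<kappa> * min d1 d2 / 2"
  have r: "0 < r" using \<kappa> d1 d2 by (simp add: r_def)
  show thesis
  proof (rule that[OF r])
    show "nearly_flat \<epsilon> r c q q"
      unfolding nearly_flat_def
    proof (intro conjI allI impI c q)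
      fix y assume y: "norm_at c q (y - snd c q) \<le> r"
      have "\<kappa> * norm (y - snd c q) \<le> \<kappa> * (min d1 d2 / 2)" using \<kappa>(2)[of "y - snd c q"] y
          by (simp add: r_def)
      then have "norm (y - snd c q) \<le> min d1 d2 / 2" using \<kappa>(1) by simp
      then have dy: "dist y (snd c q) < d1" "dist (snd c q) y < d2" using d1(1) d2(1)
          by (auto simp: dist_norm norm_minus_commute)
      then show yi: "y \<in> image_of c" using d2(2) by auto
      have yq: "chart_inv c y \<in> fst c" by (rule chart_inv_in[OF c yi])
      have Ey: "E y \<le> \<kappa>\<^sup>2 * \<epsilon>'" using d1(2)[OF yi dy(1)] E0 by (simp add: dist_real_def)
      fix u
      have "\<bar>metric M c (chart_inv c y) u u - metric M c q u u\<bar> \<le> E y * (norm u)\<^sup>2"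
        unfolding E_def by (rule metric_diff_le[OF c yq q])
      also have "\<dots> \<le> \<kappa>\<^sup>2 * \<epsilon>' * (norm u)\<^sup>2" by (rule mult_right_mono[OF Ey]) simp
      also have "\<dots> = \<epsilon>' * (\<kappa> * norm u)\<^sup>2" by (simp add: power2_eq_square)
      also have "\<dots> \<le> \<epsilon>' * (norm_at c q u)\<^sup>2"
        using \<kappa> \<epsilon>'(1) by (intro mult_left_mono power_mono) auto
      finally have diff: "\<bar>metric M c (chart_inv c y) u u - metric M c q u u\<bar> \<le> \<epsilon>' * metric M c q u u"
        by (simp add: norm_at_square[OF c q])
      have g0: "0 \<le> metric M c q u u" "0 \<le> metric M c (chart_inv c y) u u"
        using metric_nonneg c q yq by blast+
      have sq: "1 + \<epsilon> \<le> (1 + \<epsilon>)\<^sup>2" using assms by (simp add: power2_eq_square algebra_simps)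
      have "metric M c (chart_inv c y) u u \<le> (1 + \<epsilon>') * metric M c q u u"
        using diff by (simp add: algebra_simps)
      also have "\<dots> \<le> (1 + \<epsilon>) * metric M c q u u" using \<epsilon>'(2) by (intro mult_right_mono g0) simp
      also have "\<dots> \<le> (1 + \<epsilon>)\<^sup>2 * metric M c q u u" by (intro mult_right_mono g0 sq)
      finally have "sqrt (metric M c (chart_inv c y) u u) \<le> sqrt ((1 + \<epsilon>)\<^sup>2 * metric M c q u u)"
        by (rule real_sqrt_le_mono)
      then show "norm_at c (chart_inv c y) u \<le> (1 + \<epsilon>) * norm_at c q u"
        using assms by (simp add: norm_at_def real_sqrt_mult)
      have "(1 - \<epsilon>') * metric M c q u u \<le> metric M c (chart_inv c y) u u"
        using diff by (simp add: algebra_simps)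
      then have "(1 + \<epsilon>) * ((1 - \<epsilon>') * metric M c q u u) \<le> (1 + \<epsilon>) * metric M c (chart_inv c y) u u"
        using assms by (intro mult_left_mono) auto
      then have "metric M c q u u \<le> (1 + \<epsilon>) * metric M c (chart_inv c y) u u"
        by (simp add: mult.assoc[symmetric] \<epsilon>'(3))
      also have "\<dots> \<le> (1 + \<epsilon>)\<^sup>2 * metric M c (chart_inv c y) u u" by (intro mult_right_mono g0 sq)
      finally have "sqrt (metric M c q u u) \<le> sqrt ((1 + \<epsilon>)\<^sup>2 * metric M c (chart_inv c y) u u)"
        by (rule real_sqrt_le_mono)
      then show "norm_at c q u \<le> (1 + \<epsilon>) * norm_at c (chart_inv c y) u"
        using assms by (simp add: norm_at_def real_sqrt_mult)
    qed
  qed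
qed

lemma coordinate_ball_open:
  assumes c: "c \<in> atlas M" and "q \<in> fst c"
  shows "open {y \<in> fst c. norm_at c q (snd c y - z) < r}"
proof -
  have "continuous_on (fst c) (\<lambda>y. norm_at c q (snd c y - z))"
    by (intro norm_at_continuous assms continuous_intros chart_continuous)
  then have "open (fst c \<inter> (\<lambda>y. norm_at c q (snd c y - z)) -` {..<r})"
    by (rule continuous_open_preimage[OF _ chart_open[OF c]]) simp
  then show ?thesis by (simp add: Collect_conj_eq vimage_def)
qed

text \<open>Compactness: halves of the balls from \<open>nearly_flat_at_point\<close> around finitely many points cover the
  manifold, and a ball of half the radius about a point of such a half-ball stays in the full ball.\<close>

lemma nearly_flat_uniform:
  assumes "compact (UNIV :: 'a set)" "0 < \<epsilon>"
  obtains r where "0 < r" "\<And>x. \<exists>c q. nearly_flat \<epsilon> r c q x"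
proof -
  have "\<forall>q. \<exists>c r. 0 < r \<and> nearly_flat \<epsilon> r c q q"
    using nearly_flat_at_point[OF assms(2)] by metis
  then obtain c r where cr: "\<And>q. 0 < r q" "\<And>q. nearly_flat \<epsilon> (r q) (c q) q q" by metis
  have c: "c q \<in> atlas M" "q \<in> fst (c q)" for q using cr(2)[of q] by (auto simp: nearly_flat_def)
  define V where "V q = {y \<in> fst (c q). norm_at (c q) q (snd (c q) y - snd (c q) q) < r q / 2}" for q
  have V_open: "open (V q)" for q unfolding V_def by (rule coordinate_ball_open[OF c])
  have "q \<in> V q" for q
    using c[of q] cr(1)[of q] norm_at_scale[OF c, of q 0 0] by (simp add: V_def)
  then have "UNIV \<subseteq> (\<Union>q\<in>UNIV. V q)" by blast
  then obtain Q where Q: "finite Q" "UNIV \<subseteq> (\<Union>q\<in>Q. V q)"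
    by (rule compactE_image[OF assms(1) V_open])
  then have "Q \<noteq> {}" by auto
  define r0 where "r0 = Min ((\<lambda>q. r q / 2) ` Q)"
  have r0: "0 < r0" using Q(1) \<open>Q \<noteq> {}\<close> cr(1) by (simp add: r0_def)
  show thesis
  proof (rule that[OF r0])
    fix x
    obtain q where q: "q \<in> Q" "x \<in> V q" using Q(2) by blast
    have r0q: "r0 \<le> r q / 2" unfolding r0_def using Q(1) q(1) by (intro Min_le) auto
    have "nearly_flat \<epsilon> r0 (c q) q x"
      unfolding nearly_flat_def
    proof (intro conjI c)
      show "x \<in> fst (c q)" using q(2) by (simp add: V_def)
      show "\<forall>y. norm_at (c q) q (y - snd (c q) x) \<le> r0 \<longrightarrow> y \<in> image_of (c q) \<and>
        (\<forall>u. norm_at (c q) (chart_inv (c q) y) u \<le> (1 + \<epsilon>) * norm_at (c q) q u \<and>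
             norm_at (c q) q u \<le> (1 + \<epsilon>) * norm_at (c q) (chart_inv (c q) y) u)"
      proof (intro allI impI)
        fix y assume "norm_at (c q) q (y - snd (c q) x) \<le> r0"
        moreover have "norm_at (c q) q (snd (c q) x - snd (c q) q) < r q / 2" using q(2)
            by (simp add: V_def)
        moreover have "norm_at (c q) q (y - snd (c q) q) \<le>
           norm_at (c q) q (y - snd (c q) x) + norm_at (c q) q (snd (c q) x - snd (c q) q)"
          using norm_at_triangle[OF c, of q "y - snd (c q) x" "snd (c q) x - snd (c q) q"] by simp
        ultimately have "norm_at (c q) q (y - snd (c q) q) \<le> r q" using r0q by linarith
        then show "y \<in> image_of (c q) \<and>
          (\<forall>u. norm_at (c q) (chart_inv (c q) y) u \<le> (1 + \<epsilon>) * norm_at (c q) q u \<and>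
             norm_at (c q) q u \<le> (1 + \<epsilon>) * norm_at (c q) (chart_inv (c q) y) u)"
          using cr(2)[of q] unfolding nearly_flat_def by blast
      qed
    qed
    then show "\<exists>c q. nearly_flat \<epsilon> r0 c q x" by blast
  qed
qed

lemma nearly_flat_edge:
  assumes nf: "nearly_flat \<epsilon> r c q x" and "0 < \<epsilon>" and y: "y \<in> fst c" "norm_at c q (snd c y - snd c
      x) \<le> l" "l \<le> r"
  shows "edge x ((1 + \<epsilon>) * l) y"
proof -
  have c: "c \<in> atlas M" "q \<in> fst c" "x \<in> fst c" using nf by (auto simp: nearly_flat_def)
  let ?v = "snd c y - snd c x"
  have z: "z \<in> image_of c \<and> norm_at c (chart_inv c z) ?v \<le> (1 + \<epsilon>) * l" if z: "z \<in> closed_segment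
      (snd c x) (snd c y)" for z
  proof -
    obtain t where t: "0 \<le> t" "t \<le> 1" "z = (1 - t) *\<^sub>R snd c x + t *\<^sub>R snd c y" using z
        by (auto simp: in_segment)
    then have "z - snd c x = t *\<^sub>R ?v" by (simp add: algebra_simps)
    then have "norm_at c q (z - snd c x) = t * norm_at c q ?v" using norm_at_scale[OF c(1,2),
        of t ?v] t(1) by simp
    also have "\<dots> \<le> norm_at c q ?v"
      using t norm_at_nonneg[OF c(1,2), of ?v] by (intro mult_left_le_one_le) auto
    finally have "norm_at c q (z - snd c x) \<le> r" using y by linarith
    then have *: "z \<in> image_of c" "norm_at c (chart_inv c z) ?v \<le> (1 + \<epsilon>) * norm_at c q ?v"
      using nf unfolding nearly_flat_def by blast+
    have "(1 + \<epsilon>) * norm_at c q ?v \<le> (1 + \<epsilon>) * l" using y(2) assms(2) by (intro mult_left_mono) auto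
    then show ?thesis using * by linarith
  qed
  then show ?thesis unfolding edge_def using c y(1) by blast
qed

definition chain_nbhd :: "'a set \<Rightarrow> real \<Rightarrow> 'a set" where
  "chain_nbhd E r = {x. \<exists>e\<in>E. \<exists>L\<le>r. chain e L x}"

lemma chain_nbhd_superset: "0 \<le> r \<Longrightarrow> E \<subseteq> chain_nbhd E r"
  unfolding chain_nbhd_def using chain_refl by blast

lemma chain_nbhd_mono: "r \<le> r' \<Longrightarrow> chain_nbhd E r \<subseteq> chain_nbhd E r'"
  unfolding chain_nbhd_def using order_trans by blast

lemma chain_nbhd_chain_nbhd: "chain_nbhd (chain_nbhd E r) r' \<subseteq> chain_nbhd E (r + r')"
proof
  fix x assume "x \<in> chain_nbhd (chain_nbhd E r) r'"
  then obtain e y L L' where *: "e \<in> E" "L \<le> r" "chain e L y" "L' \<le> r'" "chain y L' x"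
    unfolding chain_nbhd_def by blast
  then have "chain e (L + L') x" "L + L' \<le> r + r'" using chain_trans by auto
  then show "x \<in> chain_nbhd E (r + r')" unfolding chain_nbhd_def using *(1) by blast
qed

text \<open>A plateau of height \<open>1\<close> on the coordinate ball of radius \<open>a\<close> about \<open>x\<close> that falls to \<open>0\<close> at
  radius \<open>b\<close>. The cone over the norm is smoothed at its tip by replacing the norm \<open>N\<close> with
  \<open>sqrt (N\<^sup>2 + a\<^sup>2)\<close>, whose derivative is still bounded by the norm by Cauchy-Schwarz.\<close>

lemma exists_cone:
  assumes nf: "nearly_flat \<epsilon> r c q x" and \<epsilon>: "0 < \<epsilon>" and b: "0 < a" "2 * a < b" "b \<le> r"
  obtains w where "C1_slope w (\<lambda>_. (1 + \<epsilon>) * (1 + \<epsilon>) / (b - 2 * a))"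
    "\<And>y. y \<in> fst c \<Longrightarrow> norm_at c q (snd c y - snd c x) < a \<Longrightarrow> w y = 1"
    "\<And>y. w y \<noteq> 0 \<Longrightarrow> y \<in> fst c \<and> norm_at c q (snd c y - snd c x) \<le> b"
proof -
  have c: "c \<in> atlas M" "q \<in> fst c" "x \<in> fst c" using nf by (auto simp: nearly_flat_def)
  define N where "N u = norm_at c q u" for u
  define B where "B = metric M c q"
  have bil: "bilinear B" unfolding B_def by (rule metric_bilinear[OF c(1,2)])
  obtain \<sigma> \<sigma>' :: "real \<Rightarrow> real" where \<sigma>: "\<And>t. (\<sigma> has_real_derivative \<sigma>' t) (at t)"
      "continuous_on UNIV \<sigma>'"
    "\<And>t. t \<le> 0 \<Longrightarrow> \<sigma> t = 0" "\<And>t. t \<le> 0 \<Longrightarrow> \<sigma>' t = 0"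
    "\<And>t. 1 \<le> t \<Longrightarrow> \<sigma> t = 1" "\<And>t. 0 \<le> \<sigma>' t" "\<And>t. \<sigma>' t \<le> 1 + \<epsilon>"
    using exists_C1_step[OF \<epsilon>] by metis
  define h where "h = b - 2 * a"
  have h: "0 < h" using b by (simp add: h_def)
  define R where "R y = sqrt (B (y - snd c x) (y - snd c x) + a\<^sup>2)" for y
  have B0: "0 \<le> B u u" "B u u = (N u)\<^sup>2" for u
    unfolding B_def N_def using metric_nonneg[OF c(1,2)] norm_at_square[OF c(1,2)] by auto
  have R2: "0 < B (y - snd c x) (y - snd c x) + a\<^sup>2" for y using B0(1) b(1)
      by (simp add: add_nonneg_pos)
  have Rpos: "0 < R y" for y using R2[of y] by (simp add: R_def)
  define dR where "dR y u = B (y - snd c x) u / R y" for y u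
  have R_der: "(R has_derivative dR y) (at y)" for y
  proof -
    have sym: "B u w = B w u" for u w unfolding B_def by (rule metric_sym[OF c(1,2)])
    have bb: "bounded_bilinear B" using bil by (simp add: bilinear_conv_bounded_bilinear)
    have "((\<lambda>y. y - snd c x) has_derivative (\<lambda>u. u)) (at y)" by (auto intro!: derivative_eq_intros)
    from bounded_bilinear.FDERIV[OF bb this this]
    have "((\<lambda>y. B (y - snd c x) (y - snd c x) + a\<^sup>2) has_derivative (\<lambda>u. 2 * B (y - snd c x) u)) (at y)"
      by (intro has_derivative_eq_rhs[OF has_derivative_add[OF _ has_derivative_const]]) (auto simp:
          sym)
    from DERIV_compose_FDERIV[OF DERIV_real_sqrt[OF R2] this]
    show ?thesis
      unfolding R_def[abs_def] dR_def by (rule has_derivative_eq_rhs) (simp add: fun_eq_iff field_simps)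
  qed
  have dR_le: "\<bar>dR y u\<bar> \<le> N u" for y u
  proof -
    have "\<bar>B (y - snd c x) u\<bar> \<le> N (y - snd c x) * N u"
      unfolding B_def N_def by (rule metric_Cauchy_Schwarz[OF c(1,2)])
    also have "\<dots> \<le> R y * N u"
    proof (rule mult_right_mono)
      show "N (y - snd c x) \<le> R y" unfolding R_def B0(2) by (rule real_le_rsqrt) simp
      show "0 \<le> N u" unfolding N_def by (rule norm_at_nonneg[OF c(1,2)])
    qed
    finally show ?thesis using Rpos[of y] by (simp add: dR_def abs_divide field_simps)
  qed
  define W where "W y = \<sigma> ((b - R y) / h)" for y
  define d where "d y u = \<sigma>' ((b - R y) / h) * (- dR y u / h)" for y u
  have W_der: "(W has_derivative d y) (at y)" for y
  proof -
    have "((\<lambda>y. (b - R y) / h) has_derivative (\<lambda>u. (0 - dR y u) / h)) (at y)"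
      by (rule bounded_linear.has_derivative[OF bounded_linear_divide has_derivative_diff[OF
          has_derivative_const R_der]])
    from DERIV_compose_FDERIV[OF \<sigma>(1) this]
    show ?thesis unfolding W_def[abs_def] d_def by (rule has_derivative_eq_rhs) (simp add: fun_eq_iff)
  qed
  have R_cont: "continuous_on S R" for S
    by (rule has_derivative_continuous_on[OF has_derivative_at_withinI[OF R_der]])
  have d_cont: "continuous_on S (\<lambda>y. d y u)" for S u
  proof -
    have lin: "linear (\<lambda>v. B v u)" using bil by (simp add: bilinear_def)
    have "continuous_on S (\<lambda>y. B (y - snd c x) u)"
      by (rule linear_continuous_on_compose[OF _ lin]) (intro continuous_intros)
    moreover have "continuous_on S (\<lambda>y. \<sigma>' ((b - R y) / h))"
      by (rule continuous_on_compose2[OF \<sigma>(2)]) (use h in \<open>auto intro!: continuous_intros R_cont\<close>)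
    moreover have "R y \<noteq> 0" for y using Rpos[of y] by simp
    ultimately show ?thesis
      unfolding d_def dR_def using h by (intro continuous_intros R_cont) auto
  qed
  define K where "K = {y. N (y - snd c x) \<le> b}"
  have N_le_R: "N (y - snd c x) \<le> R y" for y unfolding R_def B0(2) by (rule real_le_rsqrt) simp
  have out: "(b - R y) / h \<le> 0" if "y \<notin> K" for y
    using that N_le_R[of y] h by (simp add: K_def field_simps)
  have K_comp: "compact K"
  proof -
    obtain \<kappa> where \<kappa>: "0 < \<kappa>" "\<And>u. \<kappa> * norm u \<le> norm_at c q u"
      by (rule norm_at_ge_euclidean[OF c(1,2)]) blast
    have "K \<subseteq> cball (snd c x) (b / \<kappa>)"
    proof
      fix y assume "y \<in> K"
      then have "\<kappa> * norm (y - snd c x) \<le> b" using \<kappa>(2)[of "y - snd c x"] by (simp add: K_def N_def)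
      then show "y \<in> cball (snd c x) (b / \<kappa>)" using \<kappa>(1) by (simp add: dist_norm norm_minus_commute
          field_simps)
    qed
    then have "bounded K" using bounded_cball bounded_subset by blast
    moreover have "closed K"
      unfolding K_def N_def
      by (intro closed_Collect_le norm_at_continuous c continuous_intros)
    ultimately show ?thesis by (simp add: compact_eq_bounded_closed)
  qed
  have K_sub: "K \<subseteq> image_of c" using nf b(3) unfolding nearly_flat_def K_def N_def by force
  define C where "C = (1 + \<epsilon>) * (1 + \<epsilon>) / h"
  have C: "0 \<le> C" using \<epsilon> h by (simp add: C_def)
  have bound: "\<bar>d y u\<bar> \<le> C * norm_at c (chart_inv c y) u" if y: "y \<in> image_of c" for y u
  proof (cases "y \<in> K")
    case True
    then have "N u \<le> (1 + \<epsilon>) * norm_at c (chart_inv c y) u"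
      using nf b(3) unfolding nearly_flat_def K_def N_def by force
    then have "\<bar>dR y u\<bar> \<le> (1 + \<epsilon>) * norm_at c (chart_inv c y) u" using dR_le[of y u] by linarith
    then have "\<sigma>' ((b - R y) / h) * \<bar>dR y u\<bar> \<le> (1 + \<epsilon>) * ((1 + \<epsilon>) * norm_at c (chart_inv c y) u)"
      using \<sigma>(6,7) \<epsilon> by (intro mult_mono) auto
    moreover have "\<bar>d y u\<bar> = \<sigma>' ((b - R y) / h) * \<bar>dR y u\<bar> / h"
      using h \<sigma>(6) by (simp add: d_def abs_mult abs_divide)
    ultimately show ?thesis using h by (simp add: C_def divide_right_mono)
  next
    case False
    then have "d y u = 0" using \<sigma>(4)[OF out] by (simp add: d_def)
    then show ?thesis using C norm_at_nonneg[OF c(1) chart_inv_in[OF c(1) y]] by simp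
  qed
  show thesis
  proof (rule that[of "\<lambda>y. if y \<in> fst c then W (snd c y) else 0"])
    show "C1_slope (\<lambda>y. if y \<in> fst c then W (snd c y) else 0) (\<lambda>_. (1 + \<epsilon>) * (1 + \<epsilon>) / (b - 2 * a))"
      unfolding h_def[symmetric] C_def[symmetric]
    proof (rule C1_slope_extend_by_zero[OF c(1) W_der d_cont K_comp K_sub _ bound C])
      show "W y = 0" if "y \<notin> K" for y using \<sigma>(3)[OF out[OF that]] by (simp add: W_def)
    qed
    show "(if y \<in> fst c then W (snd c y) else 0) = 1" if "y \<in> fst c" "norm_at c q (snd c y - snd c
        x) < a" for y
    proof -
      have "R (snd c y) \<le> 2 * a"
        unfolding R_def B0(2)
      proof (rule real_le_lsqrt)
        have "0 \<le> N (snd c y - snd c x)" unfolding N_def by (rule norm_at_nonneg[OF c(1,2)])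
        then have "(N (snd c y - snd c x))\<^sup>2 \<le> a\<^sup>2" using that(2) by (intro power_mono) (auto simp:
            N_def)
        moreover have "(2 * a)\<^sup>2 = 4 * a\<^sup>2" "0 \<le> a\<^sup>2" by (simp_all add: power_mult_distrib)
        ultimately show "(N (snd c y - snd c x))\<^sup>2 + a\<^sup>2 \<le> (2 * a)\<^sup>2" by linarith
      qed (use b in simp)
      then have "1 \<le> (b - R (snd c y)) / h" using h by (simp add: h_def field_simps)
      then show ?thesis using that(1) \<sigma>(5) by (simp add: W_def)
    qed
    show "y \<in> fst c \<and> norm_at c q (snd c y - snd c x) \<le> b" if "(if y \<in> fst c then W (snd c y) else
        0) \<noteq> 0" for y
    proof -
      have y: "y \<in> fst c" "W (snd c y) \<noteq> 0" using that by (auto split: if_splits)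
      then have "snd c y \<in> K" using \<sigma>(3)[OF out[of "snd c y"]] by (auto simp: W_def)
      then show ?thesis using y by (simp add: K_def N_def)
    qed
  qed
qed

text \<open>The set \<open>E\<close> is covered by the plateaus of finitely many cones of radius slightly less than
    \<open>\<delta>\<close>; the
  layer is a smooth maximum of these cones, cut off below at the smoothing error and above at \<open>1\<close>. A
  point in the support of a cone reaches \<open>E\<close> through the centre of the cone by a chain of two edges.\<close>

lemma exists_layer:
  assumes compact: "compact (UNIV :: 'a set)"
    and nf: "\<And>x. \<exists>c q. nearly_flat \<eta> r c q x"
    and \<eta>: "0 < \<eta>" "\<eta> < 1" "3 * \<eta> < 1 / (1 + \<eta>)"
    and \<delta>: "0 < \<delta>" "\<delta> \<le> r"
  obtains s where
    "C1_slope s (\<lambda>x. if x \<in> E \<or> x \<notin> chain_nbhd E \<delta> then 0 else layer_slope \<eta> / \<delta>)"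
    "\<And>x. x \<in> E \<Longrightarrow> s x = 1" "\<And>x. x \<notin> chain_nbhd E \<delta> \<Longrightarrow> s x = 0" "\<And>x. 0 \<le> s x"
proof -
  define a where "a = \<eta> * \<delta>"
  \<comment> \<open>The largest radius for which two edges, of coordinate lengths \<open>a\<close> and \<open>b\<close>, both distorted
      by \<open>1 + \<eta>\<close>, have total length \<open>\<delta>\<close>.\<close>
  define b where "b = (1 / (1 + \<eta>) - \<eta>) * \<delta>"
  have ab: "0 < a" "2 * a < b" "b \<le> r" "b - 2 * a = (1 / (1 + \<eta>) - 3 * \<eta>) * \<delta>"
  proof -
    show "0 < a" using \<eta> \<delta> by (simp add: a_def)
    show e: "b - 2 * a = (1 / (1 + \<eta>) - 3 * \<eta>) * \<delta>" by (simp add: a_def b_def algebra_simps)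
    have "0 < (1 / (1 + \<eta>) - 3 * \<eta>) * \<delta>" using \<eta> \<delta> by (intro mult_pos_pos) auto
    then show "2 * a < b" using e by linarith
    have "1 / (1 + \<eta>) \<le> 1" using \<eta>(1) by simp
    then have "1 / (1 + \<eta>) - \<eta> \<le> 1" using \<eta>(1) by linarith
    then have "b \<le> 1 * \<delta>" unfolding b_def by (rule mult_right_mono) (use \<delta> in simp)
    then show "b \<le> r" using \<delta> by simp
  qed
  have total: "(1 + \<eta>) * a + (1 + \<eta>) * b = \<delta>"
    using \<eta>(1) by (simp add: a_def b_def field_simps)
  obtain c q where cq: "\<And>x. nearly_flat \<eta> r (c x) (q x) x" using nf by metis
  have c: "c x \<in> atlas M" "q x \<in> fst (c x)" "x \<in> fst (c x)" for x using cq[of x] by (auto simp: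
      nearly_flat_def)
  define C where "C = (1 + \<eta>) * (1 + \<eta>) / (b - 2 * a)"
  have C: "0 \<le> C" using \<eta> ab by (simp add: C_def)
  have "\<exists>w. C1_slope w (\<lambda>_. C) \<and>
    (\<forall>y. y \<in> fst (c x) \<longrightarrow> norm_at (c x) (q x) (snd (c x) y - snd (c x) x) < a \<longrightarrow> w y = 1) \<and>
    (\<forall>y. w y \<noteq> 0 \<longrightarrow> y \<in> fst (c x) \<and> norm_at (c x) (q x) (snd (c x) y - snd (c x) x) \<le> b)" for x
    unfolding C_def by (rule exists_cone[OF cq[of x] \<eta>(1) ab(1-3)]) blast
  then obtain w where w: "\<And>x. C1_slope (w x) (\<lambda>_. C)"
    "\<And>x y. y \<in> fst (c x) \<Longrightarrow> norm_at (c x) (q x) (snd (c x) y - snd (c x) x) < a \<Longrightarrow> w x y = 1"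
    "\<And>x y. w x y \<noteq> 0 \<Longrightarrow> y \<in> fst (c x) \<and> norm_at (c x) (q x) (snd (c x) y - snd (c x) x) \<le> b"
    by metis
  define V where "V x = {y \<in> fst (c x). norm_at (c x) (q x) (snd (c x) y - snd (c x) x) < a}" for x
  have V_open: "open (V x)" for x unfolding V_def by (rule coordinate_ball_open[OF c(1,2)])
  have "x \<in> V x" for x
    using c[of x] ab(1) norm_at_scale[OF c(1,2), of x 0 0] by (simp add: V_def)
  then have "UNIV \<subseteq> (\<Union>x\<in>UNIV. V x)" by blast
  then obtain X where X: "finite X" "UNIV \<subseteq> (\<Union>x\<in>X. V x)"
    by (rule compactE_image[OF compact V_open])
  define I where "I = {x \<in> X. V x \<inter> E \<noteq> {}}"
  have I: "finite I" using X(1) by (simp add: I_def)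
  obtain u where u: "C1_slope u (\<lambda>_. C)" "\<And>x y. x \<in> I \<Longrightarrow> w x y \<le> u y"
    "\<And>y. (\<forall>x\<in>I. w x y = 0) \<Longrightarrow> u y \<le> \<eta>"
    by (rule C1_slope_finite_smooth_max[where w=w, OF I w(1) C \<eta>(1)]) blast
  obtain \<sigma> \<sigma>' :: "real \<Rightarrow> real" where \<sigma>: "\<And>t. (\<sigma> has_real_derivative \<sigma>' t) (at t)"
      "continuous_on UNIV \<sigma>'"
    "\<And>t. t \<le> 0 \<Longrightarrow> \<sigma> t = 0" "\<And>t. t \<le> 0 \<Longrightarrow> \<sigma>' t = 0"
    "\<And>t. 1 \<le> t \<Longrightarrow> \<sigma> t = 1" "\<And>t. 1 \<le> t \<Longrightarrow> \<sigma>' t = 0" "\<And>t. 0 \<le> \<sigma>' t" "\<And>t. \<sigma>' t \<le> 1 + \<eta>"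
    "\<And>t. 0 \<le> \<sigma> t"
    using exists_C1_step[OF \<eta>(1)] by metis
  define f where "f t = (t - \<eta>) / (1 - \<eta>)" for t
  have u1: "1 \<le> f (u e)" if e: "e \<in> E" for e
  proof -
    obtain x where x: "x \<in> X" "e \<in> V x" using X(2) by blast
    then have "x \<in> I" using e by (auto simp: I_def)
    moreover have "w x e = 1" using x(2) w(2) by (simp add: V_def)
    ultimately have "1 \<le> u e" using u(2)[of x e] by simp
    then show ?thesis using \<eta>(2) by (simp add: f_def)
  qed
  have u0: "f (u y) \<le> 0" if y: "y \<notin> chain_nbhd E \<delta>" for y
  proof -
    have "w x y = 0" if x: "x \<in> I" for x
    proof (rule ccontr)
      assume "w x y \<noteq> 0"
      then have y': "y \<in> fst (c x)" "norm_at (c x) (q x) (snd (c x) y - snd (c x) x) \<le> b" using w(3)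
          by blast+
      obtain e where e: "e \<in> E" "e \<in> V x" using x by (auto simp: I_def)
      have "edge x ((1 + \<eta>) * a) e"
        by (rule nearly_flat_edge[OF cq \<eta>(1)]) (use e(2) ab in \<open>auto simp: V_def\<close>)
      moreover have "edge x ((1 + \<eta>) * b) y"
        by (rule nearly_flat_edge[OF cq \<eta>(1) y' ab(3)])
      ultimately have "chain e ((1 + \<eta>) * a + (1 + \<eta>) * b) y"
        by (intro chain_step[OF edge_chain[OF edge_sym]])
      then show False using y e(1) unfolding total chain_nbhd_def by blast
    qed
    then have "u y \<le> \<eta>" using u(3) by blast
    then show ?thesis using \<eta>(2) by (simp add: f_def divide_nonpos_pos)
  qed
  have der: "((\<lambda>t. \<sigma> (f t)) has_real_derivative \<sigma>' (f t) * (1 / (1 - \<eta>))) (at t)" for t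
    by (rule DERIV_chain2[OF \<sigma>(1)]) (use \<eta>(2) in \<open>auto simp: f_def[abs_def] intro!:
        derivative_eq_intros\<close>)
  have cont: "continuous_on UNIV (\<lambda>t. \<sigma>' (f t) * (1 / (1 - \<eta>)))"
    by (intro continuous_intros continuous_on_compose2[OF \<sigma>(2)]) (use \<eta>(2) in \<open>auto simp:
        f_def[abs_def] intro!: continuous_intros\<close>)
  show thesis
  proof (rule that[of "\<lambda>y. \<sigma> (f (u y))"])
    show "C1_slope (\<lambda>y. \<sigma> (f (u y))) (\<lambda>x. if x \<in> E \<or> x \<notin> chain_nbhd E \<delta> then 0 else layer_slope \<eta> / \<delta>)"
    proof (rule C1_slope_mono[OF C1_slope_compose[OF u(1) der cont]])
      fix y
      show "\<bar>\<sigma>' (f (u y)) * (1 / (1 - \<eta>))\<bar> * C \<le> (if y \<in> E \<or> y \<notin> chain_nbhd E \<delta> then 0 else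
          layer_slope \<eta> / \<delta>)"
      proof (cases "y \<in> E \<or> y \<notin> chain_nbhd E \<delta>")
        case True
        then have "\<sigma>' (f (u y)) = 0" using u1[of y] u0[of y] \<sigma>(4,6) by blast
        then show ?thesis using True by simp
      next
        case False
        have "\<bar>\<sigma>' (f (u y)) * (1 / (1 - \<eta>))\<bar> \<le> (1 + \<eta>) / (1 - \<eta>)"
          using \<sigma>(7,8)[of "f (u y)"] \<eta>(2) by (simp add: abs_mult divide_right_mono)
        then have "\<bar>\<sigma>' (f (u y)) * (1 / (1 - \<eta>))\<bar> * C \<le> (1 + \<eta>) / (1 - \<eta>) * C"
          using C by (rule mult_right_mono)
        also have "\<dots> = layer_slope \<eta> / \<delta>"
          unfolding C_def ab(4) layer_slope_def by simp
        finally show ?thesis using False by simp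
      qed
    qed
  qed (use u0 u1 \<sigma> in auto)
qed

text \<open>The layers around \<open>A\<close>, its \<open>\<delta>\<close>-neighbourhood, its \<open>2\<delta>\<close>-neighbourhood and so on have gradients
  supported in disjoint shells, so the slope of the sum is the slope of a single layer, although
  the sum rises to the full height \<open>T\<close>.\<close>

lemma exists_cutoff:
  assumes compact: "compact (UNIV :: 'a set)" and T: "0 < T" and \<epsilon>: "0 < \<epsilon>"
  obtains s where "C1_slope s (\<lambda>x. if x \<in> A then 0 else 1 + \<epsilon>)"
    "\<And>x. x \<in> A \<Longrightarrow> s x = T" "\<And>x. x \<notin> chain_nbhd A T \<Longrightarrow> s x = 0" "\<And>x. 0 \<le> s x"
proof -
  obtain \<eta> where \<eta>: "0 < \<eta>" "\<eta> < 1" "3 * \<eta> < 1 / (1 + \<eta>)" "layer_slope \<eta> < 1 + \<epsilon>"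
    by (rule layer_slope_close_to_1[OF \<epsilon>])
  obtain r where r: "0 < r" "\<And>x. \<exists>c q. nearly_flat \<eta> r c q x"
    by (rule nearly_flat_uniform[OF compact \<eta>(1)]) blast
  \<comment> \<open>The number of layers, large enough for their thickness \<open>T / J\<close> to be at most \<open>r\<close>.\<close>
  define J where "J = Suc (nat \<lceil>T / r\<rceil>)"
  define \<delta> where "\<delta> = T / real J"
  have J: "0 < J" "real J * \<delta> = T" by (simp_all add: J_def \<delta>_def)
  have "T / r \<le> real J" unfolding J_def by linarith
  then have \<delta>: "0 < \<delta>" "\<delta> \<le> r" using T r(1) J(1) by (simp_all add: \<delta>_def field_simps)
  define E where "E j = chain_nbhd A (real j * \<delta>)" for j :: nat
  have E_step: "chain_nbhd (E j) \<delta> \<subseteq> E (Suc j)" for j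
    using chain_nbhd_chain_nbhd[of A "real j * \<delta>" \<delta>] by (simp add: E_def algebra_simps)
  have E_mono: "E i \<subseteq> E j" if "i \<le> j" for i j
    unfolding E_def using that \<delta>(1) by (intro chain_nbhd_mono mult_right_mono) auto
  have A_E: "A \<subseteq> E j" for j unfolding E_def using \<delta>(1) by (intro chain_nbhd_superset) simp
  have "\<exists>s. C1_slope s (\<lambda>x. if x \<in> E j \<or> x \<notin> chain_nbhd (E j) \<delta> then 0 else layer_slope \<eta> / \<delta>) \<and>
     (\<forall>x. x \<in> E j \<longrightarrow> s x = 1) \<and> (\<forall>x. x \<notin> chain_nbhd (E j) \<delta> \<longrightarrow> s x = 0) \<and> (\<forall>x. 0 \<le> s x)" for j
    by (rule exists_layer[OF compact r(2) \<eta>(1-3) \<delta>, of "E j"]) blast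
  then have "\<forall>j. \<exists>s. C1_slope s (\<lambda>x. if x \<in> E j \<or> x \<notin> chain_nbhd (E j) \<delta> then 0 else layer_slope \<eta> /
      \<delta>) \<and>
     (\<forall>x. x \<in> E j \<longrightarrow> s x = 1) \<and> (\<forall>x. x \<notin> chain_nbhd (E j) \<delta> \<longrightarrow> s x = 0) \<and> (\<forall>x. 0 \<le> s x)" ..
  from choice[OF this]
  obtain s where s: "\<And>j. C1_slope (s j) (\<lambda>x. if x \<in> E j \<or> x \<notin> chain_nbhd (E j) \<delta> then 0 else
      layer_slope \<eta> / \<delta>)"
     "\<And>j x. x \<in> E j \<Longrightarrow> s j x = 1" "\<And>j x. x \<notin> chain_nbhd (E j) \<delta> \<Longrightarrow> s j x = 0" "\<And>j x. 0 \<le> s j x"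
    by blast
  define G where "G j x = (if x \<in> E j \<or> x \<notin> chain_nbhd (E j) \<delta> then 0 else layer_slope \<eta> / \<delta>)" for j x
  have slope: "C1_slope (\<lambda>x. \<Sum>j<J. \<delta> * s j x) (\<lambda>x. \<Sum>j<J. \<bar>\<delta>\<bar> * G j x)"
    unfolding G_def by (intro C1_slope_sum C1_slope_cmult s(1))
  show thesis
  proof (rule that[of "\<lambda>x. \<Sum>j<J. \<delta> * s j x"])
    show "C1_slope (\<lambda>x. \<Sum>j<J. \<delta> * s j x) (\<lambda>x. if x \<in> A then 0 else 1 + \<epsilon>)"
    proof (rule C1_slope_mono[OF slope])
      fix x
      show "(\<Sum>j<J. \<bar>\<delta>\<bar> * G j x) \<le> (if x \<in> A then 0 else 1 + \<epsilon>)"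
      proof (cases "\<exists>j<J. G j x \<noteq> 0")
        case False
        then have "(\<Sum>j<J. \<bar>\<delta>\<bar> * G j x) = 0" by (intro sum.neutral) auto
        then show ?thesis using \<epsilon> by simp
      next
        case True
        then obtain i where i: "i < J" "G i x \<noteq> 0" by blast
        then have xi: "x \<notin> E i" "x \<in> E (Suc i)" using E_step by (auto simp: G_def split: if_splits)
        have "G j x = 0" if "j \<noteq> i" for j
        proof (cases "j < i")
          case True
          then have "x \<notin> chain_nbhd (E j) \<delta>" using xi E_step[of j] E_mono[of "Suc j" i] by auto
          then show ?thesis by (simp add: G_def)
        next
          case False
          then have "x \<in> E j" using xi(2) E_mono[of "Suc i" j] that by auto
          then show ?thesis by (simp add: G_def)
        qed
        then have "(\<Sum>j<J. \<bar>\<delta>\<bar> * G j x) = (\<Sum>j\<in>{i}. \<bar>\<delta>\<bar> * G j x)"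
          using i(1) by (intro sum.mono_neutral_right) auto
        also have "\<dots> = layer_slope \<eta>" using i(2) \<delta>(1) by (auto simp: G_def)
        finally show ?thesis using \<eta>(4) xi(1) A_E[of i] by auto
      qed
    qed
    show "(\<Sum>j<J. \<delta> * s j x) = T" if "x \<in> A" for x
    proof -
      have "s j x = 1" for j using that A_E s(2) by blast
      then show ?thesis using J(2) by simp
    qed
    show "(\<Sum>j<J. \<delta> * s j x) = 0" if "x \<notin> chain_nbhd A T" for x
    proof (intro sum.neutral ballI)
      fix j assume "j \<in> {..<J}"
      then have "chain_nbhd (E j) \<delta> \<subseteq> E J" using E_step[of j] E_mono[of "Suc j" J] by auto
      then have "x \<notin> chain_nbhd (E j) \<delta>" using that J(2) by (auto simp: E_def)
      then show "\<delta> * s j x = 0" using s(3) by simp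
    qed
    show "0 \<le> (\<Sum>j<J. \<delta> * s j x)" for x using \<delta>(1) s(4) by (intro sum_nonneg) simp
  qed
qed

text \<open>A nonnegative function has vanishing differential at its zeros. This localises gradients to
  supports.\<close>

lemma C1_slope_zero_at_minimum:
  assumes "C1_slope \<phi> G" "\<And>q. 0 \<le> \<phi> q"
  shows "C1_slope \<phi> (\<lambda>q. if \<phi> q = 0 then 0 else G q)"
proof -
  obtain d where "has_differential \<phi> d G" using assms(1) unfolding C1_slope_def by blast
  note d = has_differentialD[OF this]
  show ?thesis
  proof (rule C1_slopeI[OF d(1,2)])
    fix c y u assume c: "c \<in> atlas M" "y \<in> image_of c"
    show "\<bar>d c y u\<bar> \<le> (if \<phi> (chart_inv c y) = 0 then 0 else G (chart_inv c y)) * norm_at c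
        (chart_inv c y) u"
    proof (cases "\<phi> (chart_inv c y) = 0")
      case True
      have "d c y = (\<lambda>v. 0)"
        by (rule differential_zero_maxmin[OF c(2) image_open[OF c(1)] d(1)[OF c]]) (use True
            assms(2) in simp)
      then show ?thesis using True by simp
    qed (use d(3)[OF c, of u] in simp)
  qed
qed

text \<open>The function \<open>H(\<kappa> s)\<close> for the cut-off \<open>s\<close> of height \<open>T\<close>. Its gradient bound is
  \<open>\<kappa> H'(\<kappa> s) = \<kappa> max 1 \<phi>\<close>, up to the factor \<open>1 + \<epsilon>\<close>.\<close>

lemma exists_test_function:
  assumes compact: "compact (UNIV :: 'a set)" and "0 < T" "0 < \<epsilon>" "0 < \<kappa>"
  obtains \<phi> where
    "C1_slope \<phi> (\<lambda>x. if x \<in> A \<or> \<phi> x = 0 then 0 else \<kappa> * (1 + \<epsilon>) * max 1 (\<phi> x))"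
    "\<And>x. x \<in> A \<Longrightarrow> \<phi> x = linear_then_exp (\<kappa> * T)" "\<And>x. \<phi> x \<noteq> 0 \<Longrightarrow> x \<in> chain_nbhd A T"
    "\<And>x. 0 \<le> \<phi> x"
proof -
  obtain s where s: "C1_slope s (\<lambda>x. if x \<in> A then 0 else 1 + \<epsilon>)"
    "\<And>x. x \<in> A \<Longrightarrow> s x = T" "\<And>x. x \<notin> chain_nbhd A T \<Longrightarrow> s x = 0" "\<And>x. 0 \<le> s x"
    by (rule exists_cutoff[OF compact assms(2,3)]) blast
  define \<phi> where "\<phi> x = linear_then_exp (\<kappa> * s x)" for x
  have nn: "0 \<le> \<phi> x" for x
  proof -
    have "0 \<le> \<kappa> * s x" using s(4) assms(4) by simp
    then show ?thesis using linear_then_exp_pos[of "\<kappa> * s x"] linear_then_exp_values(1)[of 0]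
      by (cases "\<kappa> * s x = 0") (auto simp: \<phi>_def)
  qed
  have cont: "continuous_on UNIV (\<lambda>t::real. exp (max (t - 1) 0))" by (intro continuous_intros)
  have "C1_slope \<phi> (\<lambda>x. \<bar>exp (max (\<kappa> * s x - 1) 0)\<bar> * (\<bar>\<kappa>\<bar> * (if x \<in> A then 0 else 1 + \<epsilon>)))"
    unfolding \<phi>_def
    by (rule C1_slope_compose[OF C1_slope_cmult[OF s(1)] linear_then_exp_derivative cont])
  then have "C1_slope \<phi> (\<lambda>x. if x \<in> A then 0 else \<kappa> * (1 + \<epsilon>) * max 1 (\<phi> x))"
  proof (rule C1_slope_mono)
    fix x
    have "exp (max (\<kappa> * s x - 1) 0) * (\<kappa> * (1 + \<epsilon>)) \<le> max 1 (\<phi> x) * (\<kappa> * (1 + \<epsilon>))"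
      unfolding \<phi>_def using assms(3,4) by (intro mult_right_mono linear_then_exp_derivative_le) auto
    then show "\<bar>exp (max (\<kappa> * s x - 1) 0)\<bar> * (\<bar>\<kappa>\<bar> * (if x \<in> A then 0 else 1 + \<epsilon>)) \<le>
        (if x \<in> A then 0 else \<kappa> * (1 + \<epsilon>) * max 1 (\<phi> x))"
      using assms(4) by (simp add: mult.commute)
  qed
  from C1_slope_zero_at_minimum[OF this nn]
  have "C1_slope \<phi> (\<lambda>x. if x \<in> A \<or> \<phi> x = 0 then 0 else \<kappa> * (1 + \<epsilon>) * max 1 (\<phi> x))"
    by (rule C1_slope_mono) simp
  then show thesis
  proof (rule that)
    show "x \<in> chain_nbhd A T" if "\<phi> x \<noteq> 0" for x
      using that s(3)[of x] linear_then_exp_values(1)[of 0]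
      by (cases "x \<in> chain_nbhd A T") (simp_all add: \<phi>_def)
  qed (use s(2) nn in \<open>auto simp: \<phi>_def\<close>)
qed

section \<open>Weak gradients of continuously differentiable functions\<close>

lemma metric_component_measurable:
  assumes c: "c \<in> atlas M" and X: "X \<in> borel_measurable (restrict_space borel (fst c))"
  shows "(\<lambda>q. metric M c q (X q) u) \<in> borel_measurable (restrict_space borel (fst c))"
proof -
  have [measurable]: "(\<lambda>q. X q $ i) \<in> borel_measurable (restrict_space borel (fst c))" for i
    by (rule measurable_compose[OF X]) (intro borel_measurable_continuous_onI continuous_intros)
  have [measurable]: "(\<lambda>q. metric M c q a b) \<in> borel_measurable (restrict_space borel (fst c))" for a b
    by (rule borel_measurable_continuous_on_restrict[OF metric_continuous[OF c]])
  have "(\<lambda>q. \<Sum>i\<in>UNIV. \<Sum>j\<in>UNIV. X q $ i * u $ j * metric M c q (axis i 1) (axis j 1))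
      \<in> borel_measurable (restrict_space borel (fst c))"
    by measurable
  moreover have "metric M c q (X q) u = (\<Sum>i\<in>UNIV. \<Sum>j\<in>UNIV. X q $ i * u $ j * metric M c q (axis i 1)
      (axis j 1))"
    if "q \<in> space (restrict_space borel (fst c))" for q
    using that metric_expand[OF c, of q "X q" u] by (simp add: space_restrict_space)
  ultimately show ?thesis by (simp cong: measurable_cong)
qed

lemma chart_inv_measurable:
  assumes c: "c \<in> atlas M"
  shows "chart_inv c \<in> measurable (restrict_space borel (image_of c)) (restrict_space borel (fst c))"
proof (rule measurable_restrict_space2)
  show "chart_inv c \<in> space (restrict_space borel (image_of c)) \<rightarrow> fst c"
    using chart_inv_in[OF c] by (auto simp: space_restrict_space)
  show "chart_inv c \<in> borel_measurable (restrict_space borel (image_of c))"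
    by (rule borel_measurable_continuous_on_restrict[OF chart_inv_continuous[OF c]])
qed

lemma metric_eq_0_imp_eq_0:
  assumes "c \<in> atlas M" "q \<in> fst c" "\<And>i. metric M c q Z (axis i 1) = 0"
  shows "Z = 0"
proof (rule ccontr)
  assume "Z \<noteq> 0"
  have lin: "linear (\<lambda>w. metric M c q Z w)" using metric_bilinear[OF assms(1,2)] by (simp add:
      bilinear_def)
  have "metric M c q Z Z = (\<Sum>i\<in>UNIV. Z $ i * metric M c q Z (axis i 1))"
      by (rule linear_expand_axis[OF lin])
  then show False using assms metric_pos[OF assms(1,2) \<open>Z \<noteq> 0\<close>] by simp
qed

text \<open>The vector dual to the differential with respect to the metric, written by Cramer's rule,
    from which
  its continuity is evident.\<close>

definition gradient_field ::
  "(('a, 'n) chart \<Rightarrow> real ^ 'n \<Rightarrow> real ^ 'n \<Rightarrow> real) \<Rightarrow> ('a, 'n) vfield" where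
  "gradient_field d c q = (\<chi> k. det (\<chi> i j. if j = k then d c (snd c q) (axis i 1)
     else gram_matrix M c q $ i $ j) / det (gram_matrix M c q))"

lemma metric_gradient_field:
  assumes d: "has_differential \<phi> d G" and c: "c \<in> atlas M" and q: "q \<in> fst c"
  shows "metric M c q (gradient_field d c q) u = d c (snd c q) u"
proof -
  let ?X = "gradient_field d c q" and ?b = "\<chi> i. d c (snd c q) (axis i 1)"
  have "det (gram_matrix M c q) \<noteq> 0" using gram_det_pos[OF c q] by simp
  moreover have "?X = (\<chi> k. det (\<chi> i j. if j = k then ?b $ i else gram_matrix M c q $ i $ j) / det
      (gram_matrix M c q))"
    by (simp only: gradient_field_def vec_lambda_beta)
  ultimately have AX: "gram_matrix M c q *v ?X = ?b" using cramer by blast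
  have bil: "bilinear (metric M c q)" by (rule metric_bilinear[OF c q])
  have lin: "linear (\<lambda>w. metric M c q w a)" "linear (\<lambda>w. metric M c q a w)" for a
    using bil by (simp_all add: bilinear_def)
  have ax: "metric M c q ?X (axis i 1) = d c (snd c q) (axis i 1)" for i
  proof -
    have "metric M c q ?X (axis i 1) = (\<Sum>j\<in>UNIV. ?X $ j * metric M c q (axis j 1) (axis i 1))"
      by (rule linear_expand_axis[OF lin(1)])
    also have "\<dots> = (gram_matrix M c q *v ?X) $ i"
      unfolding matrix_vector_mult_def gram_matrix_def
      by (simp add: metric_sym[OF c q, of "axis i 1"] mult.commute)
    finally show ?thesis by (simp add: AX)
  qed
  have ld: "linear (d c (snd c q))"
    using has_differentialD(1)[OF d c, of "snd c q"] q has_derivative_linear by blast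
  show ?thesis
    using linear_expand_axis[OF lin(2), of ?X u] linear_expand_axis[OF ld, of u] by (simp add: ax)
qed

lemma gradient_field_continuous:
  assumes d: "has_differential \<phi> d G" and c: "c \<in> atlas M"
  shows "continuous_on (fst c) (gradient_field d c)"
proof -
  have dc: "continuous_on (fst c) (\<lambda>q. d c (snd c q) u)" for u
    by (rule continuous_on_compose2[OF has_differentialD(2)[OF d c] chart_continuous[OF c]]) simp
  have if_cont: "continuous_on (fst c) (\<lambda>q. if P then g q else h q)"
    if "continuous_on (fst c) g" "continuous_on (fst c) h" for P and g h :: "'a \<Rightarrow> real"
    using that by (cases P) simp_all
  have nz: "det (gram_matrix M c q) \<noteq> 0" if "q \<in> fst c" for q using gram_det_pos[OF c that] by simp
  have gc: "continuous_on (fst c) (\<lambda>q. gram_matrix M c q $ i $ j)" for i j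
    unfolding gram_matrix_def vec_lambda_beta by (rule metric_continuous[OF c])
  have "continuous_on (fst c) (\<lambda>q. det (\<chi> i j. if j = k then d c (snd c q) (axis i 1) else
      gram_matrix M c q $ i $ j)
       / det (gram_matrix M c q))" for k
  proof (rule continuous_on_divide)
    show "continuous_on (fst c) (\<lambda>q. det (\<chi> i j. if j = k then d c (snd c q) (axis i 1) else
        gram_matrix M c q $ i $ j))"
      unfolding det_def vec_lambda_beta by (intro continuous_intros if_cont dc gc)
  qed (use nz gram_det_continuous[OF c] in auto)
  then show ?thesis
    unfolding gradient_field_def[abs_def] by (rule continuous_on_vec_lambda)
qed

text \<open>Both sides of the transformation rule represent the same differential with respect to the
  nondegenerate metric of the second chart.\<close>

lemma gradient_field_vector_field:
  assumes d: "has_differential \<phi> d G"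
  shows "vector_field M (gradient_field d)"
  unfolding vector_field_def
proof (intro ballI)
  fix c c' q assume c: "c \<in> atlas M" and c': "c' \<in> atlas M" and q: "q \<in> fst c \<inter> fst c'"
  have q1: "q \<in> fst c" "q \<in> fst c'" "q \<in> fst c' \<inter> fst c" using q by auto
  let ?T = "dtransition c c' q" and ?S = "dtransition c' c q"
  have chain: "d c' (snd c' q) w = d c (snd c q) (?S w)" for w
  proof -
    have t: "transition c' c (snd c' q) = snd c q" by (rule transition_chart[OF c' q1(2)])
    have "((\<lambda>y. \<phi> (chart_inv c y)) has_derivative d c (snd c q)) (at (transition c' c (snd c' q)))"
      unfolding t by (rule has_differentialD(1)[OF d c]) (use q1 in blast)
    from has_derivative_compose[OF transition_has_derivative[OF c' c q1(3)] this]
    have "((\<lambda>y. \<phi> (chart_inv c (transition c' c y))) has_derivative (\<lambda>w. d c (snd c q) (?S w))) (at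
        (snd c' q))" .
    then have "((\<lambda>y. \<phi> (chart_inv c' y)) has_derivative (\<lambda>w. d c (snd c q) (?S w))) (at (snd c' q))"
      by (rule has_derivative_transform_within_open[OF _ overlap_open[OF c' c]])
         (use q1 c c' in \<open>auto simp: transition_def\<close>)
    moreover have "((\<lambda>y. \<phi> (chart_inv c' y)) has_derivative d c' (snd c' q)) (at (snd c' q))"
      by (rule has_differentialD(1)[OF d c']) (use q1 in blast)
    ultimately have "(\<lambda>w. d c (snd c q) (?S w)) = d c' (snd c' q)" by (rule has_derivative_unique)
    then show ?thesis by (rule fun_cong[symmetric])
  qed
  have bil: "bilinear (metric M c' q)" by (rule metric_bilinear[OF c' q1(2)])
  have "metric M c' q (gradient_field d c' q - ?T (gradient_field d c q)) w = 0" for w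
  proof -
    have "metric M c' q (gradient_field d c' q) w = d c (snd c q) (?S w)"
      using metric_gradient_field[OF d c' q1(2), of w] chain by simp
    also have "\<dots> = metric M c q (gradient_field d c q) (?S w)"
      using metric_gradient_field[OF d c q1(1), of "?S w"] by simp
    also have "\<dots> = metric M c' q (?T (gradient_field d c q)) (?T (?S w))"
      by (rule metric_transition[OF c c' q])
    also have "?T (?S w) = w" by (rule dtransition_inverse[OF c' c q1(3)])
    finally show ?thesis by (simp add: bilinear_lsub[OF bil])
  qed
  then have "gradient_field d c' q - ?T (gradient_field d c q) = 0"
    by (intro metric_eq_0_imp_eq_0[OF c' q1(2)])
  then show "gradient_field d c' q = ?T (gradient_field d c q)" by simp
qed

lemma test_functionD:
  assumes "test_function S \<eta>"
  obtains K where "compact K" "K \<subseteq> S" "\<And>y. y \<notin> K \<Longrightarrow> \<eta> y = 0"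
    "\<And>y. (\<eta> has_derivative frechet_derivative \<eta> (at y)) (at y)"
    "\<And>u. continuous_on UNIV (\<lambda>y. frechet_derivative \<eta> (at y) u)" "continuous_on UNIV \<eta>"
    "\<And>y u. y \<notin> K \<Longrightarrow> frechet_derivative \<eta> (at y) u = 0"
proof -
  obtain K where K: "compact K" "K \<subseteq> S" "\<And>y. y \<notin> K \<Longrightarrow> \<eta> y = 0"
    using assms unfolding test_function_def by blast
  have "Ck_on 1 UNIV \<eta>" using assms by (simp add: test_function_def smooth_on_def)
  then have d: "(\<eta> has_derivative frechet_derivative \<eta> (at y)) (at y)"
    and c: "continuous_on UNIV (\<lambda>y. frechet_derivative \<eta> (at y) u)" for y u
    by (simp_all add: frechet_derivative_works[symmetric])
  have c0: "continuous_on UNIV \<eta>" by (rule has_derivative_continuous_on[OF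
      has_derivative_at_withinI[OF d]])
  have "frechet_derivative \<eta> (at y) u = 0" if "y \<notin> K" for y u
  proof -
    have "open (- K)" using K(1) by (simp add: compact_imp_closed open_Compl)
    then have "(\<eta> has_derivative (\<lambda>_. 0)) (at y)"
      by (rule has_derivative_transform_within_open[OF has_derivative_const]) (use that K(3) in auto)
    from has_derivative_unique[OF this d] show ?thesis by (metis)
  qed
  then show thesis using that K d c c0 by blast
qed

lemma integrable_compact_support:
  fixes h :: "real ^ 'n \<Rightarrow> real"
  assumes "compact K" "K \<subseteq> U" "continuous_on U h" "\<And>y. y \<in> U \<Longrightarrow> y \<notin> K \<Longrightarrow> h y = 0"
  shows "set_integrable lborel U h"
proof -
  have "integrable lborel (\<lambda>y. indicator K y *\<^sub>R h y)"
    by (rule borel_integrable_compact[OF assms(1)]) (rule continuous_on_subset[OF assms(3,2)])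
  moreover have "(\<lambda>y. indicator K y *\<^sub>R h y) = (\<lambda>y. indicator U y *\<^sub>R h y)"
    using assms(2,4) by (auto simp: fun_eq_iff indicator_def)
  ultimately show ?thesis by (simp add: set_integrable_def)
qed

text \<open>In a chart, \<open>\<phi> \<eta>\<close> extended by zero is continuously differentiable with compact support, so the
  integrals of its derivatives vanish.\<close>

lemma weak_gradient_gradient_field:
  assumes d: "has_differential \<phi> d G"
  shows "weak_gradient M \<phi> (gradient_field d)"
  unfolding weak_gradient_def measurable_vector_field_def
proof (intro conjI ballI allI impI)
  show "vector_field M (gradient_field d)" by (rule gradient_field_vector_field[OF d])
  fix c assume c: "c \<in> atlas M"
  show "gradient_field d c \<in> borel_measurable (restrict_space borel (fst c))"
    by (rule borel_measurable_continuous_on_restrict[OF gradient_field_continuous[OF d c]])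
  fix u \<eta> assume "test_function (image_of c) \<eta>"
  then obtain K where K: "compact K" "K \<subseteq> image_of c" "\<And>y. y \<notin> K \<Longrightarrow> \<eta> y = 0"
    "\<And>y. (\<eta> has_derivative frechet_derivative \<eta> (at y)) (at y)"
    "\<And>u. continuous_on UNIV (\<lambda>y. frechet_derivative \<eta> (at y) u)" "continuous_on UNIV \<eta>"
    "\<And>y u. y \<notin> K \<Longrightarrow> frechet_derivative \<eta> (at y) u = 0"
    by (rule test_functionD) blast
  let ?U = "image_of c" and ?\<phi> = "\<lambda>y. \<phi> (chart_inv c y)" and ?D = "\<lambda>y. frechet_derivative \<eta> (at y)"
  have U: "open ?U" by (rule image_open[OF c])
  have \<phi>c: "continuous_on ?U ?\<phi>"
    by (rule has_derivative_continuous_on[OF has_derivative_at_withinI[OF has_differentialD(1)[OF d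
        c]]])
  define P where "P y = (if y \<in> ?U then ?\<phi> y * \<eta> y else 0)" for y
  define P' where "P' y u = (if y \<in> ?U then ?\<phi> y * ?D y u + d c y u * \<eta> y else 0)" for y u
  have V: "open (- K)" using K(1) by (simp add: compact_imp_closed open_Compl)
  have off: "P' y = (\<lambda>_. 0)" "P y = 0" if "y \<notin> K" for y
    using that K(3,7) by (simp_all add: P_def P'_def fun_eq_iff)
  have P_der: "(P has_derivative P' y) (at y)" for y
  proof (cases "y \<in> ?U")
    case True
    have "((\<lambda>y. ?\<phi> y * \<eta> y) has_derivative (\<lambda>u. ?\<phi> y * ?D y u + d c y u * \<eta> y)) (at y)"
      by (rule has_derivative_mult[OF has_differentialD(1)[OF d c True] K(4)])
    then have "(P has_derivative (\<lambda>u. ?\<phi> y * ?D y u + d c y u * \<eta> y)) (at y)"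
      by (rule has_derivative_transform_within_open[OF _ U True]) (simp add: P_def)
    then show ?thesis using True by (simp add: P'_def[abs_def])
  next
    case False
    then have yK: "y \<in> - K" using K(2) by blast
    have "(P has_derivative (\<lambda>_. 0)) (at y)"
      by (rule has_derivative_transform_within_open[OF has_derivative_const V yK]) (use off in simp)
    then show ?thesis using off(1) yK by simp
  qed
  have cU: "continuous_on ?U (\<lambda>y. ?\<phi> y * ?D y w)" "continuous_on ?U (\<lambda>y. d c y w * \<eta> y)" for w
    by (intro continuous_intros \<phi>c has_differentialD(2)[OF d c] continuous_on_subset[OF K(5)]
        continuous_on_subset[OF K(6)]; simp)+
  have P_cont: "continuous_on UNIV (\<lambda>y. P' y w)" for w
  proof -
    have "continuous_on ?U (\<lambda>y. P' y w)"
      by (rule continuous_on_eq[OF continuous_on_add[OF cU[of w]]]) (simp add: P'_def)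
    moreover have "continuous_on (- K) (\<lambda>y. P' y w)"
      by (rule continuous_on_eq[OF continuous_on_const[of _ 0]]) (use off in simp)
    moreover have "?U \<union> - K = UNIV" using K(2) by blast
    ultimately show ?thesis using continuous_on_open_Un[OF U V] by metis
  qed
  have "(LINT y|lborel. P' y u) = 0"
    by (rule integral_derivative_compact_support_zero[OF P_der P_cont K(1) off(2)])
  moreover have "(\<lambda>y. P' y u) = (\<lambda>y. indicator ?U y *\<^sub>R (?\<phi> y * ?D y u + d c y u * \<eta> y))"
    by (auto simp: P'_def fun_eq_iff)
  ultimately have "(LINT y:?U|lborel. ?\<phi> y * ?D y u + d c y u * \<eta> y) = 0"
    by (simp only: set_lebesgue_integral_def)
  moreover have "set_integrable lborel ?U (\<lambda>y. ?\<phi> y * ?D y u)" "set_integrable lborel ?U (\<lambda>y. d c y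
      u * \<eta> y)"
    by (rule integrable_compact_support[OF K(1,2) cU(1)], simp add: K(7),
        rule integrable_compact_support[OF K(1,2) cU(2)], simp add: K(3))
  ultimately have "(LINT y:?U|lborel. ?\<phi> y * ?D y u) = - (LINT y:?U|lborel. d c y u * \<eta> y)"
    by (simp add: set_integral_add(2))
  also have "(LINT y:?U|lborel. d c y u * \<eta> y) =
      (LINT y:?U|lborel. metric M c (chart_inv c y) (gradient_field d c (chart_inv c y)) u * \<eta> y)"
  proof (rule set_lebesgue_integral_cong)
    show "\<forall>y. y \<in> ?U \<longrightarrow> d c y u * \<eta> y = metric M c (chart_inv c y) (gradient_field d c (chart_inv c
        y)) u * \<eta> y"
      using metric_gradient_field[OF d c chart_inv_in[OF c]] c by simp
  qed (use U in simp)
  finally show "(LINT y:?U|lborel. ?\<phi> y * ?D y u) =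
      - (LINT y:?U|lborel. metric M c (chart_inv c y) (gradient_field d c (chart_inv c y)) u * \<eta> y)" .
qed

lemma vf_norm_eq:
  assumes "vector_field M X" and c: "c \<in> atlas M" "q \<in> fst c"
  shows "vf_norm M X q = norm_at c q (X c q)"
proof -
  define c' where "c' = chart_at M q"
  have c': "c' \<in> atlas M" "q \<in> fst c'" unfolding c'_def by (rule chart_at)+
  have "X c' q = dtransition c c' q (X c q)" using assms c' unfolding vector_field_def by blast
  then have "vf_norm M X q = norm_at c' q (dtransition c c' q (X c q))"
    by (simp add: vf_norm_def Let_def c'_def[symmetric] norm_at_def)
  also have "\<dots> = norm_at c q (X c q)" by (rule norm_at_transition[OF c(1) c'(1)]) (use c c' in blast)
  finally show ?thesis .
qed

lemma vf_norm_nonneg: "0 \<le> vf_norm M X q"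
  using metric_nonneg[OF chart_at] by (simp add: vf_norm_def Let_def)

lemma vf_norm_gradient_field_le:
  assumes d: "has_differential \<phi> d G" and G: "0 \<le> G q"
  shows "vf_norm M (gradient_field d) q \<le> G q"
proof -
  obtain c where c: "c \<in> atlas M" "q \<in> fst c" by (rule chart_exists)
  let ?X = "gradient_field d c q"
  have "(norm_at c q ?X)\<^sup>2 = d c (snd c q) ?X"
    by (simp add: norm_at_square[OF c] metric_gradient_field[OF d c])
  also have "\<dots> \<le> G q * norm_at c q ?X"
    using has_differentialD(3)[OF d c(1), of "snd c q" ?X] c by simp
  finally have "norm_at c q ?X * norm_at c q ?X \<le> G q * norm_at c q ?X" by (simp add: power2_eq_square)
  then have "norm_at c q ?X \<le> G q"
    using norm_at_nonneg[OF c, of ?X] G by (cases "norm_at c q ?X = 0") simp_all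
  then show ?thesis using vf_norm_eq[OF gradient_field_vector_field[OF d] c] by simp
qed

lemma vf_norm_gradient_field_continuous:
  assumes d: "has_differential \<phi> d G"
  shows "continuous_on UNIV (vf_norm M (gradient_field d))"
proof (rule continuous_if_continuous_in_charts)
  fix c assume c: "c \<in> atlas M"
  have "continuous_on (fst c) (\<lambda>q. norm_at c q (gradient_field d c q))"
    unfolding norm_at_def
    by (intro continuous_on_real_sqrt metric_continuous_vector[OF c order_refl]
        gradient_field_continuous[OF d c])
  then have "continuous_on (image_of c) (\<lambda>y. norm_at c (chart_inv c y) (gradient_field d c
      (chart_inv c y)))"
    by (rule continuous_on_compose2[OF _ chart_inv_continuous[OF c]]) (use chart_inv_in[OF c] in blast)
  then show "continuous_on (image_of c) (\<lambda>y. vf_norm M (gradient_field d) (chart_inv c y))"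
    by (rule continuous_on_eq)
       (use vf_norm_eq[OF gradient_field_vector_field[OF d] c chart_inv_in[OF c]] in simp)
qed

end

section \<open>The weighted measure in charts and uniqueness of weak gradients\<close>

locale weighted_manifold = riemannian_manifold M
  for M :: "('a::{t2_space, second_countable_topology}, 'n::finite) riem" +
  fixes v :: "'a measure" and f :: "'a \<Rightarrow> real"
  assumes compact_space: "compact (UNIV :: 'a set)"
    and volume: "riemannian_volume M v"
    and smooth_weight: "smooth_function M f"
    and total_mass: "(\<integral>x. exp (- f x) \<partial>v) = 1"
begin

abbreviation m :: "'a measure" where "m \<equiv> weighted_measure v f"

lemma sets_v [measurable_cong]: "sets v = sets borel"
  using volume by (simp add: riemannian_volume_def)

lemma sets_m [measurable_cong]: "sets m = sets borel"
  by (simp add: weighted_measure_def sets_v)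

lemma space_m: "space m = UNIV"
  using sets_eq_imp_space_eq[OF sets_m] by simp

lemma f_measurable [measurable]: "f \<in> borel_measurable borel"
  by (rule borel_measurable_continuous_onI[OF smooth_function_continuous[OF smooth_weight]])

lemma emeasure_m: "emeasure m (space m) = 1"
proof -
  have "integrable v (\<lambda>x. exp (- f x))"
    using total_mass not_integrable_integral_eq by fastforce
  then have "(\<integral>\<^sup>+x. ennreal (exp (- f x)) \<partial>v) = ennreal 1"
    using nn_integral_eq_integral[of v "\<lambda>x. exp (- f x)"] total_mass by simp
  moreover have "emeasure m (space m) = (\<integral>\<^sup>+x. ennreal (exp (- f x)) * indicator UNIV x \<partial>v)"
    unfolding space_m unfolding weighted_measure_def by (rule emeasure_density) (auto simp: sets_v)
  ultimately show ?thesis by simp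
qed

sublocale m: finite_measure m
  by standard (simp add: emeasure_m)

definition chart_density :: "('a, 'n) chart \<Rightarrow> real ^ 'n \<Rightarrow> real" where
  "chart_density c y = exp (- f (chart_inv c y)) * sqrt (det (gram_matrix M c (chart_inv c y)))"

lemma chart_density_pos: "c \<in> atlas M \<Longrightarrow> y \<in> image_of c \<Longrightarrow> 0 < chart_density c y"
  unfolding chart_density_def using gram_det_pos[OF _ chart_inv_in] by simp

lemma gram_det_chart_continuous:
  "c \<in> atlas M \<Longrightarrow> continuous_on (image_of c) (\<lambda>y. sqrt (det (gram_matrix M c (chart_inv c y))))"
  by (rule continuous_on_real_sqrt[OF continuous_on_compose2[OF gram_det_continuous
      chart_inv_continuous]])
     (auto intro: chart_inv_in)

lemma chart_density_continuous:
  assumes c: "c \<in> atlas M"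
  shows "continuous_on (image_of c) (chart_density c)"
proof -
  have "continuous_on (image_of c) (\<lambda>y. f (chart_inv c y))"
    by (rule continuous_on_compose2[OF smooth_function_continuous[OF smooth_weight]
        chart_inv_continuous[OF c]]) simp
  then show ?thesis
    unfolding chart_density_def[abs_def]
    by (intro continuous_on_mult continuous_on_exp continuous_on_minus gram_det_chart_continuous[OF c])
qed

text \<open>The defining property of the volume measure says that its restriction to a chart domain is the
    image
  of a measure with density under the inverse chart; this turns it into a change of variables.\<close>

lemma nn_integral_chart:
  assumes c: "c \<in> atlas M" and h [measurable]: "h \<in> borel_measurable borel"
  shows "(\<integral>\<^sup>+q. h q * indicator (fst c) q \<partial>m) =
    (\<integral>\<^sup>+y. h (chart_inv c y) * ennreal (chart_density c y) * indicator (image_of c) y \<partial>lborel)"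
proof -
  have U[measurable]: "image_of c \<in> sets borel" using image_open[OF c] by simp
  have F[measurable]: "fst c \<in> sets borel" using chart_open[OF c] by simp
  define \<psi> where "\<psi> y = (if y \<in> image_of c then chart_inv c y else undefined)" for y
  have \<psi>[measurable]: "\<psi> \<in> borel_measurable borel"
    unfolding \<psi>_def
    by (rule borel_measurable_continuous_on_if[OF U chart_inv_continuous[OF c] continuous_on_const])
  define J where "J y = ennreal (sqrt (det (gram_matrix M c (chart_inv c y)))) * indicator (image_of
      c) y" for y
  have "(\<lambda>y. indicator (image_of c) y *\<^sub>R sqrt (det (gram_matrix M c (chart_inv c y)))) \<in>
      borel_measurable borel"
    by (rule borel_measurable_continuous_on_indicator[OF U gram_det_chart_continuous[OF c]])
  then have "(\<lambda>y. ennreal (indicator (image_of c) y *\<^sub>R sqrt (det (gram_matrix M c (chart_inv c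
      y))))) \<in> borel_measurable borel"
    by measurable
  moreover have "(\<lambda>y. ennreal (indicator (image_of c) y *\<^sub>R sqrt (det (gram_matrix M c (chart_inv c
      y))))) = J"
    by (auto simp: J_def fun_eq_iff indicator_def)
  ultimately have J[measurable]: "J \<in> borel_measurable borel" by simp
  have eq: "density v (indicator (fst c)) = distr (density lborel J) borel \<psi>"
  proof (rule measure_eqI)
    fix B assume "B \<in> sets (density v (indicator (fst c)))"
    then have B[measurable]: "B \<in> sets borel" by (simp add: sets_v)
    have "emeasure (density v (indicator (fst c))) B = (\<integral>\<^sup>+q. indicator (fst c) q * indicator B q \<partial>v)"
      by (rule emeasure_density) (auto simp: sets_v)
    also have "\<dots> = (\<integral>\<^sup>+q. indicator (fst c \<inter> B) q \<partial>v)"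
      by (simp add: indicator_inter_arith)
    also have "\<dots> = emeasure v (fst c \<inter> B)" by (simp add: sets_v)
    also have "\<dots> = (\<integral>\<^sup>+ y\<in>snd c ` (fst c \<inter> B). ennreal (sqrt (det (gram_matrix M c (chart_inv c
        y)))) \<partial>lborel)"
      using volume c F B unfolding riemannian_volume_def by simp
    also have "\<dots> = (\<integral>\<^sup>+y. J y * indicator (\<psi> -` B) y \<partial>lborel)"
    proof (rule nn_integral_cong)
      fix y
      have "y \<in> snd c ` (fst c \<inter> B) \<longleftrightarrow> y \<in> image_of c \<and> \<psi> y \<in> B"
      proof
        assume "y \<in> image_of c \<and> \<psi> y \<in> B"
        then have "y = snd c (chart_inv c y)" "chart_inv c y \<in> fst c \<inter> B"
          using c chart_inv_in[OF c] by (auto simp: \<psi>_def)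
        then show "y \<in> snd c ` (fst c \<inter> B)" by blast
      next
        assume "y \<in> snd c ` (fst c \<inter> B)"
        then obtain q where "q \<in> fst c" "q \<in> B" "y = snd c q" by blast
        then show "y \<in> image_of c \<and> \<psi> y \<in> B" using c by (simp add: \<psi>_def)
      qed
      then show "ennreal (sqrt (det (gram_matrix M c (chart_inv c y)))) * indicator (snd c ` (fst c
          \<inter> B)) y =
          J y * indicator (\<psi> -` B) y"
        by (auto simp: J_def indicator_def)
    qed
    also have "\<dots> = emeasure (density lborel J) (\<psi> -` B)"
    proof (rule emeasure_density[symmetric])
      show "\<psi> -` B \<in> sets lborel" using measurable_sets[OF \<psi> B] by simp
    qed simp
    also have "\<dots> = emeasure (distr (density lborel J) borel \<psi>) B"
      by (subst emeasure_distr) auto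
    finally show "emeasure (density v (indicator (fst c))) B = emeasure (distr (density lborel J)
        borel \<psi>) B" .
  qed (simp add: sets_v)
  have "(\<integral>\<^sup>+q. h q * indicator (fst c) q \<partial>m) = (\<integral>\<^sup>+q. ennreal (exp (- f q)) * (h q * indicator (fst
      c) q) \<partial>v)"
    unfolding weighted_measure_def by (rule nn_integral_density) measurable
  also have "\<dots> = (\<integral>\<^sup>+q. indicator (fst c) q * (ennreal (exp (- f q)) * h q) \<partial>v)"
    by (simp add: ac_simps)
  also have "\<dots> = (\<integral>\<^sup>+q. ennreal (exp (- f q)) * h q \<partial>density v (indicator (fst c)))"
    by (rule nn_integral_density[symmetric]) measurable
  also have "\<dots> = (\<integral>\<^sup>+y. ennreal (exp (- f (\<psi> y))) * h (\<psi> y) \<partial>density lborel J)"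
    unfolding eq by (rule nn_integral_distr) measurable
  also have "\<dots> = (\<integral>\<^sup>+y. J y * (ennreal (exp (- f (\<psi> y))) * h (\<psi> y)) \<partial>lborel)"
    by (rule nn_integral_density) measurable
  also have "\<dots> = (\<integral>\<^sup>+y. h (chart_inv c y) * ennreal (chart_density c y) * indicator (image_of c) y
      \<partial>lborel)"
  proof (rule nn_integral_cong)
    fix y
    show "J y * (ennreal (exp (- f (\<psi> y))) * h (\<psi> y)) =
        h (chart_inv c y) * ennreal (chart_density c y) * indicator (image_of c) y"
      using gram_det_pos[OF c chart_inv_in[OF c], of y]
      by (cases "y \<in> image_of c") (auto simp: J_def \<psi>_def chart_density_def ennreal_mult less_imp_le
          ac_simps)
  qed
  finally show ?thesis .
qed

text \<open>The density in a chart is positive, so the measure and Lebesgue measure have the same null sets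
  there.\<close>

lemma null_set_chart_iff:
  assumes c: "c \<in> atlas M" and N [measurable]: "N \<in> sets borel"
  shows "emeasure m (N \<inter> fst c) = 0 \<longleftrightarrow> (AE y in lborel. y \<in> image_of c \<longrightarrow> chart_inv c y \<notin> N)"
proof -
  have F[measurable]: "fst c \<in> sets borel" using chart_open[OF c] by simp
  have U[measurable]: "image_of c \<in> sets borel" using image_open[OF c] by simp
  let ?g = "\<lambda>y. indicator N (chart_inv c y) * ennreal (chart_density c y) * indicator (image_of c) y"
  have "emeasure m (N \<inter> fst c) = (\<integral>\<^sup>+q. indicator N q * indicator (fst c) q \<partial>m)"
    by (simp add: indicator_inter_arith[symmetric] sets_m)
  also have "\<dots> = (\<integral>\<^sup>+y. ?g y \<partial>lborel)"
    by (rule nn_integral_chart[OF c]) measurable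
  finally have 1: "emeasure m (N \<inter> fst c) = (\<integral>\<^sup>+y. ?g y \<partial>lborel)" .
  have "(\<lambda>y. indicator N (chart_inv c y) * ennreal (chart_density c y)) \<in> borel_measurable
      (restrict_space borel (image_of c))"
  proof (rule borel_measurable_times_ennreal)
    have "indicator N \<in> borel_measurable (restrict_space borel (fst c))"
      by (rule measurable_restrict_space1[OF borel_measurable_indicator[OF N]])
    from measurable_compose[OF chart_inv_measurable[OF c] this]
    show "(\<lambda>y. indicator N (chart_inv c y) :: ennreal) \<in> borel_measurable (restrict_space borel
        (image_of c))" .
    have [measurable]: "chart_density c \<in> borel_measurable (restrict_space borel (image_of c))"
      by (rule borel_measurable_continuous_on_restrict[OF chart_density_continuous[OF c]])
    show "(\<lambda>y. ennreal (chart_density c y)) \<in> borel_measurable (restrict_space borel (image_of c))"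
        by measurable
  qed
  then have "?g \<in> borel_measurable borel"
    by (subst (asm) borel_measurable_restrict_space_iff_ennreal) (use U in auto)
  then have "(\<integral>\<^sup>+y. ?g y \<partial>lborel) = 0 \<longleftrightarrow> (AE y in lborel. ?g y = 0)"
    by (intro nn_integral_0_iff_AE) simp
  also have "\<dots> \<longleftrightarrow> (AE y in lborel. y \<in> image_of c \<longrightarrow> chart_inv c y \<notin> N)"
  proof (rule AE_cong)
    fix y
    show "?g y = 0 \<longleftrightarrow> (y \<in> image_of c \<longrightarrow> chart_inv c y \<notin> N)"
      using chart_density_pos[OF c, of y] by (auto simp: indicator_def)
  qed
  finally show ?thesis unfolding 1 .
qed

lemma AE_if_AE_in_charts:
  assumes "\<And>c. c \<in> atlas M \<Longrightarrow> AE q in m. q \<in> fst c \<longrightarrow> P q"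
  shows "AE q in m. P q"
proof -
  have "(UNIV :: 'a set) \<subseteq> (\<Union>c\<in>atlas M. fst c)" using charts_cover by simp
  then obtain C where C: "C \<subseteq> atlas M" "finite C" "UNIV \<subseteq> (\<Union>c\<in>C. fst c)"
    using compactE_image[OF compact_space, of "atlas M" fst] chart_open by blast
  have "AE q in m. \<forall>c\<in>C. q \<in> fst c \<longrightarrow> P q"
    using C assms by (intro AE_finite_allI) auto
  then show ?thesis by eventually_elim (use C(3) in blast)
qed

lemma le_1_plus_powr:
  fixes t :: real
  assumes "0 \<le> t" "1 \<le> p"
  shows "t \<le> 1 + t powr p"
proof (cases "t \<le> 1")
  case True
  then show ?thesis by (simp add: add_increasing2)
next
  case False
  then have "t powr 1 \<le> t powr p" using assms by (intro powr_mono) auto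
  then show ?thesis using assms by simp
qed

text \<open>On a compact subset of a chart the density is bounded below, which transfers \<open>p\<close>-integrability to
  Lebesgue measure; and \<open>t \<le> 1 + t\<^sup>p\<close> reduces it to integrability.\<close>

lemma p_integrable_field_locally_integrable:
  assumes X: "measurable_vector_field M X" and p: "1 \<le> p"
    and int: "integrable m (\<lambda>q. vf_norm M X q powr p)"
    and c: "c \<in> atlas M" and K: "compact K" "K \<subseteq> image_of c"
  shows "set_integrable lborel K (\<lambda>y. metric M c (chart_inv c y) (X c (chart_inv c y)) u)"
proof -
  have U: "image_of c \<in> sets borel" using image_open[OF c] by simp
  have Kb[measurable]: "K \<in> sets borel" using K(1) by (simp add: compact_imp_closed borel_closed)
  have vX: "vector_field M X" "X c \<in> borel_measurable (restrict_space borel (fst c))"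
    using X c by (auto simp: measurable_vector_field_def)
  let ?h = "\<lambda>y. metric M c (chart_inv c y) (X c (chart_inv c y)) u"
  let ?n = "\<lambda>y. vf_norm M X (chart_inv c y) powr p"
  have "?h \<in> borel_measurable (restrict_space borel (image_of c))"
    by (rule measurable_compose[OF chart_inv_measurable[OF c] metric_component_measurable[OF c vX(2)]])
  then have "(\<lambda>y. indicator (image_of c) y *\<^sub>R ?h y) \<in> borel_measurable borel"
    using U by (subst (asm) borel_measurable_restrict_space_iff) auto
  then have "(\<lambda>y. indicator K y * (indicator (image_of c) y *\<^sub>R ?h y)) \<in> borel_measurable borel"
    by measurable
  moreover have "(\<lambda>y. indicator K y * (indicator (image_of c) y *\<^sub>R ?h y)) = (\<lambda>y. indicator K y *\<^sub>R
      ?h y)"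
    using K(2) by (auto simp: fun_eq_iff indicator_def)
  ultimately have meas: "(\<lambda>y. indicator K y *\<^sub>R ?h y) \<in> borel_measurable lborel" by simp
  have nm: "(\<lambda>q. vf_norm M X q powr p) \<in> borel_measurable borel"
    using borel_measurable_integrable[OF int] by (simp add: measurable_cong_sets[OF sets_m refl])
  show ?thesis
  proof (cases "K = {}")
    case True
    then show ?thesis by (simp add: set_integrable_def)
  next
    case False
    have "continuous_on K (chart_density c)" using chart_density_continuous[OF c] K(2)
        continuous_on_subset by blast
    from continuous_attains_inf[OF K(1) False this]
    obtain y0 where y0: "y0 \<in> K" "\<And>y. y \<in> K \<Longrightarrow> chart_density c y0 \<le> chart_density c y" by blast
    define j where "j = chart_density c y0"
    have j: "0 < j" using y0(1) K(2) chart_density_pos[OF c] unfolding j_def by blast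
    have "continuous_on (fst c) (\<lambda>q. norm_at c q u)"
      unfolding norm_at_def by (rule continuous_on_real_sqrt[OF metric_continuous[OF c]])
    then have "continuous_on (image_of c) (\<lambda>y. norm_at c (chart_inv c y) u)"
      by (rule continuous_on_compose2[OF _ chart_inv_continuous[OF c]]) (use chart_inv_in[OF c] in
          blast)
    then have "continuous_on K (\<lambda>y. norm_at c (chart_inv c y) u)" using K(2) continuous_on_subset
        by blast
    from continuous_attains_sup[OF K(1) False this]
    obtain y1 where y1: "\<And>y. y \<in> K \<Longrightarrow> norm_at c (chart_inv c y) u \<le> norm_at c (chart_inv c y1) u"
        "y1 \<in> K" by blast
    define b where "b = norm_at c (chart_inv c y1) u"
    have b: "0 \<le> b" unfolding b_def using y1(2) K(2) chart_inv_in[OF c] norm_at_nonneg[OF c] by blast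
    have bound: "\<bar>?h y\<bar> \<le> (1 + ?n y) * b" if y: "y \<in> K" for y
    proof -
      have q: "chart_inv c y \<in> fst c" using y K(2) chart_inv_in[OF c] by blast
      have "\<bar>?h y\<bar> \<le> norm_at c (chart_inv c y) (X c (chart_inv c y)) * norm_at c (chart_inv c y) u"
        by (rule metric_Cauchy_Schwarz[OF c q])
      also have "\<dots> = vf_norm M X (chart_inv c y) * norm_at c (chart_inv c y) u"
        using vf_norm_eq[OF vX(1) c q] by simp
      also have "\<dots> \<le> (1 + ?n y) * b"
        using y1(1)[OF y] norm_at_nonneg[OF c q]
        by (intro mult_mono le_1_plus_powr vf_norm_nonneg p) (auto simp: b_def)
      finally show ?thesis .
    qed
    have fin: "(\<integral>\<^sup>+q. ennreal (vf_norm M X q powr p) \<partial>m) < \<infinity>"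
      using integrableD(2)[OF int] by (simp add: less_top)
    have "(\<integral>\<^sup>+y. ennreal j * (ennreal (?n y) * indicator K y) \<partial>lborel) \<le>
        (\<integral>\<^sup>+y. ennreal (?n y) * ennreal (chart_density c y) * indicator (image_of c) y \<partial>lborel)"
    proof (rule nn_integral_mono)
      fix y
      show "ennreal j * (ennreal (?n y) * indicator K y) \<le>
          ennreal (?n y) * ennreal (chart_density c y) * indicator (image_of c) y"
      proof (cases "y \<in> K")
        case True
        then have "ennreal j \<le> ennreal (chart_density c y)" using y0(2) by (simp add: j_def ennreal_leI)
        then have "ennreal (?n y) * ennreal j \<le> ennreal (?n y) * ennreal (chart_density c y)"
            by (rule mult_left_mono) simp
        then show ?thesis using True K(2) by (auto simp: ac_simps)
      qed simp
    qed
    also have "\<dots> = (\<integral>\<^sup>+q. ennreal (vf_norm M X q powr p) * indicator (fst c) q \<partial>m)"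
      by (rule nn_integral_chart[OF c, symmetric]) (use nm in measurable)
    also have "\<dots> \<le> (\<integral>\<^sup>+q. ennreal (vf_norm M X q powr p) \<partial>m)"
      by (intro nn_integral_mono) (simp add: indicator_def)
    finally have jfin: "(\<integral>\<^sup>+y. ennreal j * (ennreal (?n y) * indicator K y) \<partial>lborel) < \<infinity>"
      using fin by (rule le_less_trans)
    have n_meas: "(\<lambda>y. ennreal (?n y) * indicator K y) \<in> borel_measurable borel"
    proof -
      have "(\<lambda>q. vf_norm M X q powr p) \<in> borel_measurable (restrict_space borel (fst c))"
        using nm by (rule measurable_restrict_space1)
      from measurable_compose[OF chart_inv_measurable[OF c] this]
      have "(\<lambda>y. indicator (image_of c) y *\<^sub>R ?n y) \<in> borel_measurable borel"
        using U by (subst (asm) borel_measurable_restrict_space_iff) auto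
      then have "(\<lambda>y. ennreal (indicator (image_of c) y *\<^sub>R ?n y) * indicator K y) \<in>
          borel_measurable borel"
        by measurable
      moreover have "(\<lambda>y. ennreal (indicator (image_of c) y *\<^sub>R ?n y) * indicator K y) =
          (\<lambda>y. ennreal (?n y) * indicator K y)"
        using K(2) by (auto simp: fun_eq_iff indicator_def)
      ultimately show ?thesis by simp
    qed
    have nfin: "(\<integral>\<^sup>+y. ennreal (?n y) * indicator K y \<partial>lborel) < \<infinity>"
      using jfin n_meas j by (subst (asm) nn_integral_cmult) (auto simp: ennreal_mult_less_top)
    show ?thesis
      unfolding set_integrable_def
    proof (rule integrableI_bounded[OF meas])
      have "(\<integral>\<^sup>+y. ennreal (norm (indicator K y *\<^sub>R ?h y)) \<partial>lborel) \<le>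
          (\<integral>\<^sup>+y. ennreal b * (indicator K y + ennreal (?n y) * indicator K y) \<partial>lborel)"
      proof (rule nn_integral_mono)
        fix y
        show "ennreal (norm (indicator K y *\<^sub>R ?h y)) \<le> ennreal b * (indicator K y + ennreal (?n y)
            * indicator K y)"
        proof (cases "y \<in> K")
          case True
          have "ennreal (norm (indicator K y *\<^sub>R ?h y)) \<le> ennreal (b * (1 + ?n y))"
            using True bound[OF True] by (intro ennreal_leI) (simp add: mult.commute)
          also have "\<dots> = ennreal b * (1 + ennreal (?n y))"
            using b by (simp add: ennreal_mult)
          finally show ?thesis using True by simp
        qed simp
      qed
      also have "\<dots> = ennreal b * ((\<integral>\<^sup>+y. indicator K y \<partial>lborel) + (\<integral>\<^sup>+y. ennreal (?n y) * indicator
          K y \<partial>lborel))"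
        using n_meas by (simp add: nn_integral_cmult nn_integral_add)
      also have "\<dots> < \<infinity>"
        using nfin emeasure_compact_finite[OF K(1)] by (auto simp: ennreal_mult_less_top)
      finally show "(\<integral>\<^sup>+y. ennreal (norm (indicator K y *\<^sub>R ?h y)) \<partial>lborel) < \<infinity>" .
    qed
  qed
qed

lemma chart_integral_cong_AE:
  fixes \<psi> \<Psi> :: "'a \<Rightarrow> real"
  assumes c: "c \<in> atlas M" and \<psi> [measurable]: "\<psi> \<in> borel_measurable borel"
    and \<Psi> [measurable]: "\<Psi> \<in> borel_measurable borel" and ae: "AE q in m. \<psi> q = \<Psi> q"
    and D: "continuous_on UNIV D"
  shows "(LINT y:image_of c|lborel. \<psi> (chart_inv c y) * D y) = (LINT y:image_of c|lborel. \<Psi>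
      (chart_inv c y) * D y)"
proof -
  let ?U = "image_of c"
  have U: "open ?U" by (rule image_open[OF c])
  have F[measurable]: "fst c \<in> sets borel" using chart_open[OF c] by simp
  have [measurable]: "{q. \<psi> q \<noteq> \<Psi> q} \<in> sets borel" by measurable
  have "{q. \<psi> q \<noteq> \<Psi> q} \<in> sets m" by (simp add: sets_m)
  from AE_iff_measurable[OF this, of "\<lambda>q. \<psi> q = \<Psi> q"] ae
  have "emeasure m {q. \<psi> q \<noteq> \<Psi> q} = 0" by (simp add: space_m)
  then have "emeasure m ({q. \<psi> q \<noteq> \<Psi> q} \<inter> fst c) = 0"
    using emeasure_mono[of "{q. \<psi> q \<noteq> \<Psi> q} \<inter> fst c" "{q. \<psi> q \<noteq> \<Psi> q}" m] by (simp add: sets_m)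
  then have aeU: "AE y in lborel. y \<in> ?U \<longrightarrow> chart_inv c y \<notin> {q. \<psi> q \<noteq> \<Psi> q}"
    by (subst (asm) null_set_chart_iff[OF c]) auto
  show ?thesis
    unfolding set_lebesgue_integral_def
  proof (rule integral_cong_AE)
    have [measurable]: "D \<in> borel_measurable (restrict_space borel ?U)"
      by (rule borel_measurable_continuous_on_restrict[OF continuous_on_subset[OF D subset_UNIV]])
    have meas: "(\<lambda>y. indicator ?U y *\<^sub>R (g (chart_inv c y) * D y)) \<in> borel_measurable lborel"
      if g: "g \<in> borel_measurable borel" for g :: "'a \<Rightarrow> real"
    proof -
      have [measurable]: "(\<lambda>y. g (chart_inv c y)) \<in> borel_measurable (restrict_space borel ?U)"
        by (rule measurable_compose[OF chart_inv_measurable[OF c] measurable_restrict_space1[OF g]])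
      have "(\<lambda>y. g (chart_inv c y) * D y) \<in> borel_measurable (restrict_space borel ?U)" by measurable
      then show ?thesis using U by (subst (asm) borel_measurable_restrict_space_iff) auto
    qed
    show "(\<lambda>y. indicator ?U y *\<^sub>R (\<psi> (chart_inv c y) * D y)) \<in> borel_measurable lborel"
      by (rule meas[OF \<psi>])
    show "(\<lambda>y. indicator ?U y *\<^sub>R (\<Psi> (chart_inv c y) * D y)) \<in> borel_measurable lborel"
      by (rule meas[OF \<Psi>])
    show "AE y in lborel. indicator ?U y *\<^sub>R (\<psi> (chart_inv c y) * D y) =
        indicator ?U y *\<^sub>R (\<Psi> (chart_inv c y) * D y)"
      using aeU by eventually_elim (simp add: indicator_def)
  qed
qed

lemma weak_gradient_cong_AE:
  assumes \<psi>: "\<psi> \<in> borel_measurable borel" and \<Psi>: "\<Psi> \<in> borel_measurable borel"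
    and ae: "AE q in m. \<psi> q = \<Psi> q" and X: "weak_gradient M \<Psi> X"
  shows "weak_gradient M \<psi> X"
  unfolding weak_gradient_def
proof (intro conjI ballI allI impI)
  show "measurable_vector_field M X" using X by (simp add: weak_gradient_def)
  fix c u \<eta> assume c: "c \<in> atlas M" and \<eta>: "test_function (image_of c) \<eta>"
  have D: "continuous_on UNIV (\<lambda>y. frechet_derivative \<eta> (at y) u)"
    using \<eta> by (rule test_functionD)
  show "(LINT y:image_of c|lborel. \<psi> (chart_inv c y) * frechet_derivative \<eta> (at y) u) =
        - (LINT y:image_of c|lborel. metric M c (chart_inv c y) (X c (chart_inv c y)) u * \<eta> y)"
    unfolding chart_integral_cong_AE[OF c \<psi> \<Psi> ae D] using X c \<eta> unfolding weak_gradient_def by simp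
qed

text \<open>The difference of the two fields is locally integrable and orthogonal to all test functions in
    each
  chart, so the fundamental lemma applies. Integrability of the norm is essential: without it the
  identity that defines weak gradients does not determine the field.\<close>

lemma weak_gradient_unique:
  assumes d: "has_differential \<Psi> d G"
    and \<psi> [measurable]: "\<psi> \<in> borel_measurable borel" and ae: "AE q in m. \<psi> q = \<Psi> q"
    and X: "weak_gradient M \<psi> X" and p: "1 \<le> p" and int: "integrable m (\<lambda>q. vf_norm M X q powr p)"
  shows "AE q in m. vf_norm M X q = vf_norm M (gradient_field d) q"
proof (rule AE_if_AE_in_charts)
  fix c assume c: "c \<in> atlas M"
  let ?U = "image_of c" and ?X0 = "gradient_field d"
  have U: "open ?U" by (rule image_open[OF c])
  have F[measurable]: "fst c \<in> sets borel" using chart_open[OF c] by simp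
  have mX: "measurable_vector_field M X" using X by (simp add: weak_gradient_def)
  have wg0: "weak_gradient M \<Psi> ?X0" by (rule weak_gradient_gradient_field[OF d])
  have mX0: "measurable_vector_field M ?X0" using wg0 by (simp add: weak_gradient_def)
  have \<Psi>[measurable]: "\<Psi> \<in> borel_measurable borel"
    using C1_slope_continuous[of \<Psi> G] d unfolding C1_slope_def
        by (intro borel_measurable_continuous_onI) blast
  let ?g = "\<lambda>X u y. metric M c (chart_inv c y) (X c (chart_inv c y)) u"
  have h0: "AE y in lborel. y \<in> ?U \<longrightarrow> ?g X u y - ?g ?X0 u y = 0" for u
  proof (rule fundamental_lemma_calculus_of_variations[OF U])
    have cX0: "continuous_on ?U (?g ?X0 u)"
    proof -
      have "continuous_on (fst c) (\<lambda>q. metric M c q (?X0 c q) u)"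
        by (rule metric_continuous_vector[OF c order_refl gradient_field_continuous[OF d c]
            continuous_on_const])
      then show ?thesis
        by (rule continuous_on_compose2[OF _ chart_inv_continuous[OF c]]) (use chart_inv_in[OF c] in
            blast)
    qed
    have i0: "set_integrable lborel K (?g ?X0 u)" if K: "compact K" "K \<subseteq> ?U" for K
      unfolding set_integrable_def
      by (rule borel_integrable_compact[OF K(1) continuous_on_subset[OF cX0 K(2)]])
    have i1: "set_integrable lborel K (?g X u)" if K: "compact K" "K \<subseteq> ?U" for K
      by (rule p_integrable_field_locally_integrable[OF mX p int c K])
    show "set_integrable lborel K (\<lambda>y. ?g X u y - ?g ?X0 u y)" if K: "compact K" "K \<subseteq> ?U" for K
      by (rule set_integral_diff(1)[OF i1[OF K] i0[OF K]])
    fix \<eta> assume \<eta>: "test_function ?U \<eta>"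
    then obtain K where K: "compact K" "K \<subseteq> ?U" "\<And>y. y \<notin> K \<Longrightarrow> \<eta> y = 0" "continuous_on UNIV \<eta>"
      and D_cont: "continuous_on UNIV (\<lambda>y. frechet_derivative \<eta> (at y) u)"
      by (rule test_functionD) blast
    have times_\<eta>: "set_integrable lborel ?U (\<lambda>y. g y * \<eta> y)" if g: "set_integrable lborel K g" for g
    proof -
      obtain B where B: "\<And>y. y \<in> K \<Longrightarrow> norm (\<eta> y) \<le> B"
        using compact_imp_bounded[OF compact_continuous_image[OF continuous_on_subset[OF K(4)
            subset_UNIV] K(1)]]
        unfolding bounded_iff by blast
      have [measurable]: "\<eta> \<in> borel_measurable borel" using K(4)
          by (rule borel_measurable_continuous_onI)
      have "integrable lborel (\<lambda>y. \<eta> y * (indicator K y *\<^sub>R g y))"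
      proof (rule Bochner_Integration.integrable_bound[where f="\<lambda>y. B * \<bar>indicator K y *\<^sub>R g y\<bar>"])
        show "integrable lborel (\<lambda>y. B * \<bar>indicator K y *\<^sub>R g y\<bar>)"
          using g unfolding set_integrable_def by (intro integrable_mult_right integrable_abs)
        show "(\<lambda>y. \<eta> y * (indicator K y *\<^sub>R g y)) \<in> borel_measurable lborel"
          using g unfolding set_integrable_def by measurable
        show "AE y in lborel. norm (\<eta> y * (indicator K y *\<^sub>R g y)) \<le> norm (B * \<bar>indicator K y *\<^sub>R g y\<bar>)"
        proof (rule AE_I2)
          fix y
          show "norm (\<eta> y * (indicator K y *\<^sub>R g y)) \<le> norm (B * \<bar>indicator K y *\<^sub>R g y\<bar>)"
            using B[of y] by (cases "y \<in> K") (auto simp: abs_mult intro!: mult_right_mono)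
        qed
      qed
      moreover have "(\<lambda>y. \<eta> y * (indicator K y *\<^sub>R g y)) = (\<lambda>y. indicator ?U y *\<^sub>R (g y * \<eta> y))"
        using K(2,3) by (auto simp: fun_eq_iff indicator_def)
      ultimately show ?thesis by (simp add: set_integrable_def)
    qed
    let ?D = "\<lambda>y. frechet_derivative \<eta> (at y) u"
    have "(LINT y:?U|lborel. (?g X u y - ?g ?X0 u y) * \<eta> y) =
        (LINT y:?U|lborel. ?g X u y * \<eta> y) - (LINT y:?U|lborel. ?g ?X0 u y * \<eta> y)"
      unfolding left_diff_distrib
      by (rule set_integral_diff(2)[OF times_\<eta>[OF i1[OF K(1,2)]] times_\<eta>[OF i0[OF K(1,2)]]])
    also have "(LINT y:?U|lborel. ?g X u y * \<eta> y) = - (LINT y:?U|lborel. \<psi> (chart_inv c y) * ?D y)"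
      using X c \<eta> unfolding weak_gradient_def by simp
    also have "(LINT y:?U|lborel. ?g ?X0 u y * \<eta> y) = - (LINT y:?U|lborel. \<Psi> (chart_inv c y) * ?D y)"
      using wg0 c \<eta> unfolding weak_gradient_def by simp
    also have "(LINT y:?U|lborel. \<psi> (chart_inv c y) * ?D y) = (LINT y:?U|lborel. \<Psi> (chart_inv c y) *
        ?D y)"
      by (rule chart_integral_cong_AE[OF c \<psi> \<Psi> ae D_cont])
    finally show "(LINT y:?U|lborel. (?g X u y - ?g ?X0 u y) * \<eta> y) = 0" by simp
  qed
  define N where "N = {q \<in> fst c. X c q \<noteq> ?X0 c q}"
  have N: "N \<in> sets borel"
  proof -
    have [measurable]: "X c \<in> borel_measurable (restrict_space borel (fst c))"
      "?X0 c \<in> borel_measurable (restrict_space borel (fst c))"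
      using mX mX0 c by (auto simp: measurable_vector_field_def)
    have "{q \<in> space (restrict_space borel (fst c)). X c q \<noteq> ?X0 c q} \<in> sets (restrict_space borel
        (fst c))"
      by measurable
    then show ?thesis by (simp add: N_def space_restrict_space sets_restrict_space_iff)
  qed
  have "AE y in lborel. \<forall>i\<in>UNIV. y \<in> ?U \<longrightarrow> ?g X (axis i 1) y - ?g ?X0 (axis i 1) y = 0"
  proof (rule AE_finite_allI)
    fix i show "AE y in lborel. y \<in> ?U \<longrightarrow> ?g X (axis i 1) y - ?g ?X0 (axis i 1) y = 0" by (rule h0)
  qed simp
  then have "AE y in lborel. y \<in> ?U \<longrightarrow> chart_inv c y \<notin> N"
  proof eventually_elim
    case (elim y)
    show ?case
    proof
      assume y: "y \<in> ?U"
      let ?q = "chart_inv c y"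
      have q: "?q \<in> fst c" by (rule chart_inv_in[OF c y])
      have bil: "bilinear (metric M c ?q)" by (rule metric_bilinear[OF c q])
      have "X c ?q - ?X0 c ?q = 0"
        by (rule metric_eq_0_imp_eq_0[OF c q]) (use elim y in \<open>simp add: bilinear_lsub[OF bil]\<close>)
      then show "?q \<notin> N" by (simp add: N_def)
    qed
  qed
  then have "emeasure m (N \<inter> fst c) = 0" using null_set_chart_iff[OF c N] by blast
  then have "emeasure m N = 0" by (simp add: N_def Int_def conj_commute)
  then have "AE q in m. q \<notin> N" by (intro AE_not_in) (simp add: null_sets_def sets_m N)
  then show "AE q in m. q \<in> fst c \<longrightarrow> vf_norm M X q = vf_norm M ?X0 q"
  proof eventually_elim
    case (elim q)
    have "vector_field M X" "vector_field M ?X0" using mX mX0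
        by (auto simp: measurable_vector_field_def)
    then show ?case using elim vf_norm_eq[OF _ c] by (auto simp: N_def)
  qed
qed

section \<open>Poincare constants and disjointly supported functions\<close>

lemma measure_m_UNIV: "measure m UNIV = 1"
  using emeasure_m unfolding space_m by (simp add: measure_def)

lemma integrable_bounded:
  fixes h :: "'a \<Rightarrow> real"
  assumes "h \<in> borel_measurable borel" "\<And>q. \<bar>h q\<bar> \<le> B"
  shows "integrable m h"
  by (rule m.integrable_const_bound[of _ B]) (use assms in \<open>simp_all add: measurable_cong_sets[OF
      sets_m refl]\<close>)

lemma continuous_bounded:
  fixes h :: "'a \<Rightarrow> real"
  assumes "continuous_on UNIV h"
  obtains B where "\<And>q. \<bar>h q\<bar> \<le> B"
  using compact_imp_bounded[OF compact_continuous_image[OF assms compact_space]]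
  unfolding bounded_iff by force

lemma integrable_powr_continuous:
  fixes h :: "'a \<Rightarrow> real"
  assumes h: "continuous_on UNIV h" and "0 \<le> p"
  shows "integrable m (\<lambda>q. \<bar>h q\<bar> powr p)"
proof -
  obtain B where B: "\<And>q. \<bar>h q\<bar> \<le> B" by (rule continuous_bounded[OF h]) blast
  have [measurable]: "h \<in> borel_measurable borel" by (rule borel_measurable_continuous_onI[OF h])
  show ?thesis
    by (rule integrable_bounded[of _ "B powr p"]) (use B assms(2) in \<open>auto intro!: powr_mono2\<close>)
qed

lemma C1_slope_measurable: "C1_slope \<phi> G \<Longrightarrow> \<phi> \<in> borel_measurable borel"
  by (rule borel_measurable_continuous_onI[OF C1_slope_continuous])

lemma integrable_C1_slope:
  assumes "C1_slope \<phi> G"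
  shows "integrable m \<phi>"
proof -
  obtain B where B: "\<And>q. \<bar>\<phi> q\<bar> \<le> B" by (rule continuous_bounded[OF C1_slope_continuous[OF assms]]) blast
  show ?thesis by (rule integrable_bounded[OF C1_slope_measurable[OF assms] B])
qed

lemma sobolev_if_AE_C1_slope:
  assumes \<Psi>: "C1_slope \<Psi> G" and \<psi>: "\<psi> \<in> borel_measurable borel" and ae: "AE q in m. \<psi> q = \<Psi> q"
    and p: "1 \<le> p"
  shows "\<psi> \<in> sobolev M m p"
  unfolding sobolev_def
proof (intro CollectI conjI \<psi>)
  obtain d where d: "has_differential \<Psi> d G" using \<Psi> unfolding C1_slope_def by blast
  have [measurable]: "\<psi> \<in> borel_measurable m" "\<Psi> \<in> borel_measurable m"
    using \<psi> C1_slope_measurable[OF \<Psi>] by (simp_all add: measurable_cong_sets[OF sets_m refl])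
  have i: "integrable m (\<lambda>x. \<bar>\<Psi> x\<bar> powr p)"
    using integrable_powr_continuous[OF C1_slope_continuous[OF \<Psi>]] p by simp
  show "integrable m (\<lambda>x. \<bar>\<psi> x\<bar> powr p)"
    by (rule integrable_cong_AE_imp[OF i]) (use ae in \<open>auto elim: eventually_mono\<close>)
  show "\<exists>X. weak_gradient M \<psi> X \<and> integrable m (\<lambda>x. vf_norm M X x powr p)"
  proof (intro exI conjI)
    show "weak_gradient M \<psi> (gradient_field d)"
      by (rule weak_gradient_cong_AE[OF \<psi> C1_slope_measurable[OF \<Psi>] ae
          weak_gradient_gradient_field[OF d]])
    show "integrable m (\<lambda>x. vf_norm M (gradient_field d) x powr p)"
      using integrable_powr_continuous[OF vf_norm_gradient_field_continuous[OF d], of p] p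
          by (simp add: vf_norm_nonneg)
  qed
qed

text \<open>The chosen gradient either agrees almost everywhere with the classical one, or its norm has a
  non-integrable power and the integral on the left is \<open>0\<close>.\<close>

lemma gradient_integral_le:
  assumes \<Psi>: "C1_slope \<Psi> G" and \<psi>: "\<psi> \<in> borel_measurable borel" and ae: "AE q in m. \<psi> q = \<Psi> q"
    and p: "1 \<le> p" and G: "\<And>q. 0 \<le> G q" "integrable m (\<lambda>q. G q powr p)"
  shows "(\<integral>x. vf_norm M (gradient M \<psi>) x powr p \<partial>m) \<le> (\<integral>x. G x powr p \<partial>m)"
proof (cases "integrable m (\<lambda>x. vf_norm M (gradient M \<psi>) x powr p)")
  case True
  obtain d where d: "has_differential \<Psi> d G" using \<Psi> unfolding C1_slope_def by blast
  have "weak_gradient M \<psi> (gradient_field d)"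
    by (rule weak_gradient_cong_AE[OF \<psi> C1_slope_measurable[OF \<Psi>] ae weak_gradient_gradient_field[OF
        d]])
  then have "weak_gradient M \<psi> (gradient M \<psi>)" unfolding gradient_def
      by (rule someI[of "weak_gradient M \<psi>"])
  from weak_gradient_unique[OF d \<psi> ae this p True]
  have "AE x in m. vf_norm M (gradient M \<psi>) x powr p \<le> G x powr p"
  proof eventually_elim
    case (elim x)
    then show ?case
      using vf_norm_gradient_field_le[OF d G(1)] p by (intro powr_mono2) (auto simp: vf_norm_nonneg)
  qed
  then show ?thesis by (rule integral_mono_AE[OF True G(2)])
next
  case False
  then show ?thesis by (simp add: not_integrable_integral_eq)
qed

lemma poincare_const_nonneg:
  assumes "1 \<le> k"
  shows "0 \<le> poincare_const M m k p"
  unfolding poincare_const_def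
proof (rule INF_greatest)
  fix L assume "L \<in> {L. sobolev_subspace M m p L \<and> has_ae_dim m L k \<and> (\<forall>\<phi>\<in>L. ae_constant m \<phi> \<longrightarrow>
      ae_zero m \<phi>)}"
  then obtain b where b: "\<And>i. i < k \<Longrightarrow> b i \<in> L"
    "\<And>a :: nat \<Rightarrow> real. (AE x in m. (\<Sum>i<k. a i * b i x) = 0) \<Longrightarrow> (\<forall>i<k. a i = 0)"
    unfolding has_ae_dim_def by blast
  have k: "0 < k" using assms by simp
  have "\<not> ae_zero m (b 0)"
  proof
    assume "ae_zero m (b 0)"
    moreover have "(\<Sum>i<k. (if i = 0 then 1 else 0) * b i x) = b 0 x" for x
    proof -
      have "(\<Sum>i<k. (if i = 0 then 1 else 0) * b i x) = (\<Sum>i<k. if i = 0 then b i x else 0)"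
        by (intro sum.cong) auto
      then show ?thesis using k by simp
    qed
    ultimately have "AE x in m. (\<Sum>i<k. (if i = 0 then 1 else 0) * b i x) = 0" by (simp add: ae_zero_def)
    from b(2)[OF this] k show False by auto
  qed
  then have "b 0 \<in> {\<phi>\<in>L. \<not> ae_zero m \<phi>}" using b(1) k by blast
  then have "ereal (rayleigh M m p (b 0)) \<le> (SUP \<phi>\<in>{\<phi>\<in>L. \<not> ae_zero m \<phi>}. ereal (rayleigh M m p \<phi>))"
    by (rule SUP_upper)
  moreover have "0 \<le> rayleigh M m p (b 0)"
    unfolding rayleigh_def by (intro divide_nonneg_nonneg Bochner_Integration.integral_nonneg) auto
  ultimately show "0 \<le> (SUP \<phi>\<in>{\<phi>\<in>L. \<not> ae_zero m \<phi>}. ereal (rayleigh M m p \<phi>))"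
    by (meson ereal_less_eq(5) order_trans)
qed

text \<open>The subspace consists of the combinations of mean zero. It contains no nonzero constants,
    and on it
  the numerator and the denominator of the Rayleigh quotient are both diagonal.\<close>

lemma poincare_const_le_disjoint_functions:
  fixes \<phi> g :: "nat \<Rightarrow> 'a \<Rightarrow> real"
  assumes p: "1 \<le> p" and R: "0 \<le> R"
    and \<phi>: "\<And>i. i \<le> k \<Longrightarrow> C1_slope (\<phi> i) (g i)" "\<And>i q. i \<le> k \<Longrightarrow> 0 \<le> \<phi> i q"
    and nz: "\<And>i. i \<le> k \<Longrightarrow> \<not> ae_zero m (\<phi> i)"
    and disjoint: "\<And>i j q. i \<le> k \<Longrightarrow> j \<le> k \<Longrightarrow> \<phi> i q \<noteq> 0 \<Longrightarrow> \<phi> j q \<noteq> 0 \<Longrightarrow> i = j"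
    and g: "\<And>i q. i \<le> k \<Longrightarrow> 0 \<le> g i q" "\<And>i q. i \<le> k \<Longrightarrow> \<phi> i q = 0 \<Longrightarrow> g i q = 0"
      "\<And>i. i \<le> k \<Longrightarrow> integrable m (\<lambda>q. g i q powr p)"
    and le: "\<And>i. i \<le> k \<Longrightarrow> (\<integral>q. g i q powr p \<partial>m) \<le> R * (\<integral>q. \<phi> i q powr p \<partial>m)"
  shows "poincare_const M m k p \<le> ereal R"
proof -
  define I where "I i = (\<integral>q. \<phi> i q \<partial>m)" for i
  have int: "integrable m (\<phi> i)" if "i \<le> k" for i by (rule integrable_C1_slope[OF \<phi>(1)[OF that]])
  have I: "0 < I i" if i: "i \<le> k" for i
  proof -
    have "0 \<le> I i" unfolding I_def by (rule Bochner_Integration.integral_nonneg) (rule \<phi>(2)[OF i])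
    moreover have "I i \<noteq> 0"
      unfolding I_def using integral_nonneg_eq_0_iff_AE[OF int[OF i]] \<phi>(2)[OF i] nz[OF i] by (simp
          add: ae_zero_def)
    ultimately show ?thesis by simp
  qed
  define \<Psi> where "\<Psi> a q = (\<Sum>i\<le>k. a i * \<phi> i q)" for a :: "nat \<Rightarrow> real" and q
  have \<Psi>_slope: "C1_slope (\<Psi> a) (\<lambda>q. \<Sum>i\<le>k. \<bar>a i\<bar> * g i q)" for a
    unfolding \<Psi>_def by (intro C1_slope_sum C1_slope_cmult \<phi>(1)) simp
  have \<Psi>_meas: "\<Psi> a \<in> borel_measurable borel" for a by (rule C1_slope_measurable[OF \<Psi>_slope])
  have \<Psi>_int: "(\<integral>q. \<Psi> a q \<partial>m) = (\<Sum>i\<le>k. a i * I i)" for a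
    unfolding \<Psi>_def I_def by (subst Bochner_Integration.integral_sum) (use int in auto)
  define L where "L = {\<psi> \<in> borel_measurable borel. \<exists>a. (\<Sum>i\<le>k. a i * I i) = 0 \<and> (AE q in m. \<psi> q =
      \<Psi> a q)}"
  have LI: "\<psi> \<in> L" if "\<psi> \<in> borel_measurable borel" "(\<Sum>i\<le>k. a i * I i) = 0" "AE q in m. \<psi> q = \<Psi> a q"
      for \<psi> a
    using that unfolding L_def by blast
  have LE: "\<exists>a. \<psi> \<in> borel_measurable borel \<and> (\<Sum>i\<le>k. a i * I i) = 0 \<and> (AE q in m. \<psi> q = \<Psi> a q)"
      if "\<psi> \<in> L" for \<psi>
    using that unfolding L_def by blast
  have sub: "sobolev_subspace M m p L"
    unfolding sobolev_subspace_def
  proof (intro conjI ballI allI impI subsetI)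
    fix \<psi> assume "\<psi> \<in> L"
    then obtain a where a: "\<psi> \<in> borel_measurable borel" "(\<Sum>i\<le>k. a i * I i) = 0" "AE q in m. \<psi> q = \<Psi> a q"
      using LE by blast
    show "\<psi> \<in> sobolev M m p" by (rule sobolev_if_AE_C1_slope[OF \<Psi>_slope a(1,3) p])
    show "(\<lambda>x. r * \<psi> x) \<in> L" for r
    proof (rule LI[of _ "\<lambda>i. r * a i"])
      show "(\<lambda>x. r * \<psi> x) \<in> borel_measurable borel" using a(1) by measurable
      show "(\<Sum>i\<le>k. r * a i * I i) = 0" using a(2) by (simp add: mult.assoc sum_distrib_left[symmetric])
      show "AE q in m. r * \<psi> q = \<Psi> (\<lambda>i. r * a i) q"
        using a(3) by eventually_elim (simp add: \<Psi>_def sum_distrib_left mult.assoc)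
    qed
    show "\<psi>' \<in> L" if "\<psi>' \<in> borel_measurable borel" "AE x in m. \<psi>' x = \<psi> x" for \<psi>'
    proof (rule LI[OF that(1) a(2)])
      show "AE q in m. \<psi>' q = \<Psi> a q" using that(2) a(3) by eventually_elim simp
    qed
    fix \<psi>' assume "\<psi>' \<in> L"
    then obtain a' where a': "\<psi>' \<in> borel_measurable borel" "(\<Sum>i\<le>k. a' i * I i) = 0"
        "AE q in m. \<psi>' q = \<Psi> a' q"
      using LE by blast
    show "(\<lambda>x. \<psi> x + \<psi>' x) \<in> L"
    proof (rule LI[of _ "\<lambda>i. a i + a' i"])
      show "(\<lambda>x. \<psi> x + \<psi>' x) \<in> borel_measurable borel" using a(1) a'(1) by measurable
      show "(\<Sum>i\<le>k. (a i + a' i) * I i) = 0" using a(2) a'(2) by (simp add: distrib_right sum.distrib)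
      show "AE q in m. \<psi> q + \<psi>' q = \<Psi> (\<lambda>i. a i + a' i) q"
        using a(3) a'(3) by eventually_elim (simp add: \<Psi>_def sum.distrib distrib_right)
    qed
  next
    show "(\<lambda>x. 0) \<in> L" by (rule LI[of _ "\<lambda>_. 0"]) (simp_all add: \<Psi>_def)
  qed
  have split: "(\<Sum>i\<le>k. h i) = (\<Sum>i<k. h i) + h k" for h :: "nat \<Rightarrow> real"
    by (simp add: lessThan_Suc_atMost[symmetric])
  define b where "b i q = \<phi> i q / I i - \<phi> k q / I k" for i q
  have dim: "has_ae_dim m L k"
    unfolding has_ae_dim_def
  proof (rule exI[of _ b], intro conjI allI impI ballI)
    have comb: "(\<Sum>i<k. a i * b i q) = \<Psi> (\<lambda>i. if i = k then - (\<Sum>i<k. a i) / I k else a i / I i) q"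
        for a q
      unfolding \<Psi>_def split b_def
      by (simp add: right_diff_distrib sum_subtractf sum_distrib_right sum_divide_distrib sum_negf)
    show "b j \<in> L" if "j < k" for j
    proof (rule LI[of _ "\<lambda>i. if i = k then - 1 / I k else if i = j then 1 / I j else 0"])
      show "b j \<in> borel_measurable borel"
      proof -
        have [measurable]: "\<phi> j \<in> borel_measurable borel" "\<phi> k \<in> borel_measurable borel"
          using that by (auto intro!: C1_slope_measurable[OF \<phi>(1)])
        show ?thesis unfolding b_def by measurable
      qed
      have e: "(\<Sum>i<k. (if i = k then x else if i = j then y else 0) * h i) = y * h j" for x y
          and h :: "nat \<Rightarrow> real"
      proof -
        have "(\<Sum>i<k. (if i = k then x else if i = j then y else 0) * h i) = (\<Sum>i<k. if i = j then y *
            h i else 0)"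
          by (intro sum.cong) auto
        then show ?thesis using that by simp
      qed
      show "(\<Sum>i\<le>k. (if i = k then - 1 / I k else if i = j then 1 / I j else 0) * I i) = 0"
        unfolding split e using I[of j] I[of k] that by simp
      show "AE q in m. b j q = \<Psi> (\<lambda>i. if i = k then - 1 / I k else if i = j then 1 / I j else 0) q"
        unfolding \<Psi>_def split e b_def by simp
    qed
    show "a j = 0" if ae: "AE x in m. (\<Sum>i<k. a i * b i x) = 0" and j: "j < k" for a j
    proof (rule ccontr)
      assume aj: "a j \<noteq> 0"
      have "AE x in m. \<phi> j x = 0"
        using ae
      proof eventually_elim
        case (elim x)
        show ?case
        proof (rule ccontr)
          assume nzx: "\<phi> j x \<noteq> 0"
          have 0: "\<phi> i x = 0" if "i \<le> k" "i \<noteq> j" for i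
            using disjoint[of i j x] nzx that j by auto
          have "(\<Sum>i<k. a i * b i x) = (\<Sum>i<k. if i = j then a i * (\<phi> i x / I i) else 0)"
            by (rule sum.cong) (use 0 j in \<open>auto simp: b_def\<close>)
          also have "\<dots> = a j * (\<phi> j x / I j)" using j by simp
          finally show False using elim aj nzx I[of j] j by simp
        qed
      qed
      then show False using nz[of j] j by (simp add: ae_zero_def)
    qed
    fix \<psi> assume "\<psi> \<in> L"
    then obtain a where a: "(\<Sum>i\<le>k. a i * I i) = 0" "AE q in m. \<psi> q = \<Psi> a q" using LE by blast
    have "- (\<Sum>i<k. a i * I i) = a k * I k" using a(1) unfolding split by simp
    then have "\<Psi> (\<lambda>i. if i = k then - (\<Sum>i<k. a i * I i) / I k else a i * I i / I i) = \<Psi> a"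
      unfolding \<Psi>_def using I by (intro ext sum.cong) (auto simp: less_imp_neq[OF I, symmetric])
    with a(2) have "AE x in m. \<psi> x = (\<Sum>i<k. (a i * I i) * b i x)"
      unfolding comb by simp
    then show "\<exists>a. AE x in m. \<psi> x = (\<Sum>i<k. a i * b i x)" by (rule exI[of _ "\<lambda>i. a i * I i"])
  qed
  have mean0: "(\<integral>q. \<psi> q \<partial>m) = 0"
    if "\<psi> \<in> borel_measurable borel" "(\<Sum>i\<le>k. a i * I i) = 0" "AE q in m. \<psi> q = \<Psi> a q" for \<psi> a
  proof -
    have "(\<integral>q. \<psi> q \<partial>m) = (\<integral>q. \<Psi> a q \<partial>m)"
      by (rule integral_cong_AE) (use that \<Psi>_meas in \<open>simp_all add: measurable_cong_sets[OF sets_m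
          refl]\<close>)
    then show ?thesis using \<Psi>_int that(2) by simp
  qed
  have const: "ae_zero m \<psi>" if \<psi>: "\<psi> \<in> L" "ae_constant m \<psi>" for \<psi>
  proof -
    obtain a where a: "\<psi> \<in> borel_measurable borel" "(\<Sum>i\<le>k. a i * I i) = 0" "AE q in m. \<psi> q = \<Psi> a q"
      using LE[OF \<psi>(1)] by blast
    obtain r where r: "AE q in m. \<psi> q = r" using \<psi>(2) by (auto simp: ae_constant_def)
    have "(\<integral>q. \<psi> q \<partial>m) = (\<integral>q. r \<partial>m)"
      by (rule integral_cong_AE) (use a(1) r in \<open>simp_all add: measurable_cong_sets[OF sets_m refl]\<close>)
    then have "r = 0" using mean0[OF a] measure_m_UNIV by (simp add: space_m)
    then show ?thesis using r by (simp add: ae_zero_def)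
  qed
  have ray: "rayleigh M m p \<psi> \<le> R" if \<psi>: "\<psi> \<in> L" for \<psi>
  proof -
    obtain a where a: "\<psi> \<in> borel_measurable borel" "(\<Sum>i\<le>k. a i * I i) = 0" "AE q in m. \<psi> q = \<Psi> a q"
      using LE[OF \<psi>] by blast
    have \<phi>p: "integrable m (\<lambda>q. \<phi> i q powr p)" if i: "i \<le> k" for i
      using integrable_powr_continuous[OF C1_slope_continuous[OF \<phi>(1)[OF i]], of p] p \<phi>(2)[OF i] by simp
    let ?G = "\<lambda>q. \<Sum>i\<le>k. \<bar>a i\<bar> * g i q"
    have Gp: "?G q powr p = (\<Sum>i\<le>k. \<bar>a i\<bar> powr p * g i q powr p)" for q
    proof -
      have "\<bar>\<Sum>i\<le>k. \<bar>a i\<bar> * g i q\<bar> powr p = (\<Sum>i\<le>k. \<bar>\<bar>a i\<bar>\<bar> powr p * \<bar>g i q\<bar> powr p)"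
        by (rule sum_powr_of_disjoint) (use disjoint[of _ _ q] g(2)[of _ q] in auto)
      moreover have "0 \<le> ?G q" using g(1) by (intro sum_nonneg) auto
      moreover have "(\<Sum>i\<le>k. \<bar>\<bar>a i\<bar>\<bar> powr p * \<bar>g i q\<bar> powr p) = (\<Sum>i\<le>k. \<bar>a i\<bar> powr p * g i q powr p)"
        using g(1) by (intro sum.cong) auto
      ultimately show ?thesis by simp
    qed
    have \<Psi>p: "\<bar>\<Psi> a q\<bar> powr p = (\<Sum>i\<le>k. \<bar>a i\<bar> powr p * \<phi> i q powr p)" for q
    proof -
      have "\<bar>\<Sum>i\<le>k. a i * \<phi> i q\<bar> powr p = (\<Sum>i\<le>k. \<bar>a i\<bar> powr p * \<bar>\<phi> i q\<bar> powr p)"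
        by (rule sum_powr_of_disjoint) (use disjoint[of _ _ q] in auto)
      moreover have "(\<Sum>i\<le>k. \<bar>a i\<bar> powr p * \<bar>\<phi> i q\<bar> powr p) = (\<Sum>i\<le>k. \<bar>a i\<bar> powr p * \<phi> i q powr p)"
        using \<phi>(2) by (intro sum.cong) auto
      ultimately show ?thesis by (simp add: \<Psi>_def)
    qed
    have "(\<integral>x. vf_norm M (gradient M \<psi>) x powr p \<partial>m) \<le> (\<integral>x. ?G x powr p \<partial>m)"
    proof (rule gradient_integral_le[OF \<Psi>_slope a(1,3) p])
      show "0 \<le> ?G q" for q using g(1) by (intro sum_nonneg) auto
      show "integrable m (\<lambda>q. ?G q powr p)" unfolding Gp
        by (intro Bochner_Integration.integrable_sum integrable_mult_right g(3)) simp
    qed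
    also have "\<dots> = (\<Sum>i\<le>k. \<bar>a i\<bar> powr p * (\<integral>x. g i x powr p \<partial>m))"
      unfolding Gp by (subst Bochner_Integration.integral_sum) (use g(3) in auto)
    also have "\<dots> \<le> (\<Sum>i\<le>k. \<bar>a i\<bar> powr p * (R * (\<integral>x. \<phi> i x powr p \<partial>m)))"
      by (intro sum_mono mult_left_mono le) auto
    also have "\<dots> = R * (\<Sum>i\<le>k. \<bar>a i\<bar> powr p * (\<integral>x. \<phi> i x powr p \<partial>m))"
      by (simp add: sum_distrib_left algebra_simps)
    also have "(\<Sum>i\<le>k. \<bar>a i\<bar> powr p * (\<integral>x. \<phi> i x powr p \<partial>m)) = (\<integral>x. \<bar>\<Psi> a x\<bar> powr p \<partial>m)"
      unfolding \<Psi>p by (subst Bochner_Integration.integral_sum) (use \<phi>p in auto)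
    also have "(\<integral>x. \<bar>\<Psi> a x\<bar> powr p \<partial>m) = (\<integral>x. \<bar>\<psi> x - (\<integral>y. \<psi> y \<partial>m)\<bar> powr p \<partial>m)"
      unfolding mean0[OF a]
    proof (rule integral_cong_AE)
      have [measurable]: "\<psi> \<in> borel_measurable m" "\<Psi> a \<in> borel_measurable m"
        using a(1) \<Psi>_meas by (simp_all add: measurable_cong_sets[OF sets_m refl])
      show "(\<lambda>x. \<bar>\<Psi> a x\<bar> powr p) \<in> borel_measurable m" "(\<lambda>x. \<bar>\<psi> x - 0\<bar> powr p) \<in> borel_measurable m"
        by measurable
      show "AE x in m. \<bar>\<Psi> a x\<bar> powr p = \<bar>\<psi> x - 0\<bar> powr p" using a(3) by eventually_elim simp
    qed
    finally have main: "(\<integral>x. vf_norm M (gradient M \<psi>) x powr p \<partial>m) \<le> R * (\<integral>x. \<bar>\<psi> x - (\<integral>y. \<psi> y \<partial>m)\<bar>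
        powr p \<partial>m)" .
    have "0 \<le> (\<integral>x. \<bar>\<psi> x - (\<integral>y. \<psi> y \<partial>m)\<bar> powr p \<partial>m)" by (rule Bochner_Integration.integral_nonneg) simp
    \<comment> \<open>This includes a vanishing denominator, where the quotient is \<open>0\<close>.\<close>
    moreover have "x / y \<le> R" if "x \<le> R * y" "0 \<le> y" for x y :: real
      using that R by (cases "y = 0") (simp_all add: divide_le_eq)
    ultimately show ?thesis unfolding rayleigh_def using main by blast
  qed
  have "poincare_const M m k p \<le> (SUP \<phi>\<in>{\<phi>\<in>L. \<not> ae_zero m \<phi>}. ereal (rayleigh M m p \<phi>))"
    unfolding poincare_const_def by (rule INF_lower) (use sub dim const in blast)
  also have "\<dots> \<le> ereal R" by (rule SUP_least) (use ray in simp)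
  finally show ?thesis .
qed

text \<open>Pointwise, \<open>g\<^sup>p \<le> \<kappa>\<^sup>p (1 + \<phi>\<^sup>p - P\<^sup>p)\<close> on \<open>A\<close> and \<open>g\<^sup>p \<le> \<kappa>\<^sup>p (1 + \<phi>\<^sup>p)\<close> on the rest of the
    support of
  \<open>\<phi>\<close>. The mass of the support, at most \<open>P m(A)\<close>, is compensated by \<open>P\<^sup>p m(A)\<close>.\<close>

lemma slope_integral_le:
  fixes \<phi> :: "'a \<Rightarrow> real"
  assumes A: "A \<in> sets borel" and \<phi>: "continuous_on UNIV \<phi>" "\<And>q. 0 \<le> \<phi> q"
    and P: "\<And>q. q \<in> A \<Longrightarrow> \<phi> q = P" "1 \<le> P"
    and mass: "measure m {q. \<phi> q \<noteq> 0} \<le> P * measure m A" and p: "1 \<le> p" and \<kappa>: "0 \<le> \<kappa>"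
  defines "g \<equiv> (\<lambda>q. if q \<in> A \<or> \<phi> q = 0 then 0 else \<kappa> * max 1 (\<phi> q))"
  shows "integrable m (\<lambda>q. g q powr p)"
    and "(\<integral>q. g q powr p \<partial>m) \<le> \<kappa> powr p * (\<integral>q. \<phi> q powr p \<partial>m)"
proof -
  let ?S = "{q. \<phi> q \<noteq> 0}"
  have \<phi>m[measurable]: "\<phi> \<in> borel_measurable borel" by (rule borel_measurable_continuous_onI[OF \<phi>(1)])
  note A[measurable]
  have S[measurable]: "?S \<in> sets borel" by measurable
  have gm[measurable]: "g \<in> borel_measurable borel" unfolding g_def by measurable
  have g0: "0 \<le> g q" for q using \<kappa> by (simp add: g_def)
  have \<phi>p: "integrable m (\<lambda>q. \<phi> q powr p)"
    using integrable_powr_continuous[OF \<phi>(1), of p] p \<phi>(2) by simp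
  have ind: "integrable m (\<lambda>q. indicator B q :: real)" if "B \<in> sets borel" for B :: "'a set"
    using that by (intro integrable_real_indicator) (simp_all add: sets_m m.emeasure_finite
        less_top[symmetric])
  have pointwise: "g q powr p \<le> \<kappa> powr p * (indicator ?S q + \<phi> q powr p - P powr p * indicator A q)"
      for q
  proof -
    consider "q \<in> A" | "q \<notin> A" "\<phi> q = 0" | "q \<notin> A" "\<phi> q \<noteq> 0" by blast
    then show ?thesis
    proof cases
      case 1
      then show ?thesis using P(1)[of q] P(2) by (simp add: g_def)
    next
      case 2
      then show ?thesis by (simp add: g_def)
    next
      case 3
      have "(max 1 (\<phi> q)) powr p \<le> 1 + \<phi> q powr p" by (cases "\<phi> q \<le> 1") (auto simp: max_def)
      then have "\<kappa> powr p * (max 1 (\<phi> q)) powr p \<le> \<kappa> powr p * (1 + \<phi> q powr p)"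
        by (rule mult_left_mono) simp
      moreover have "g q powr p = \<kappa> powr p * (max 1 (\<phi> q)) powr p"
        using 3 \<kappa> by (simp add: g_def powr_mult)
      ultimately show ?thesis using 3 by simp
    qed
  qed
  have bi: "integrable m (\<lambda>q. \<kappa> powr p * (indicator ?S q + \<phi> q powr p - P powr p * indicator A q))"
    using \<phi>p ind[OF S] ind[OF A] by simp
  show gi: "integrable m (\<lambda>q. g q powr p)"
  proof (rule Bochner_Integration.integrable_bound[OF bi])
    show "(\<lambda>q. g q powr p) \<in> borel_measurable m"
      using gm by (simp add: measurable_cong_sets[OF sets_m refl])
    show "AE q in m. norm (g q powr p) \<le> norm (\<kappa> powr p * (indicator ?S q + \<phi> q powr p - P powr p *
        indicator A q))"
      using pointwise by (intro AE_I2) (metis abs_ge_self norm_of_real order_trans powr_ge_zero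
          real_norm_def abs_of_nonneg)
  qed
  have "(\<integral>q. g q powr p \<partial>m) \<le> (\<integral>q. \<kappa> powr p * (indicator ?S q + \<phi> q powr p - P powr p * indicator A
      q) \<partial>m)"
    by (rule integral_mono[OF gi bi]) (rule pointwise)
  also have "\<dots> = \<kappa> powr p * (measure m ?S + (\<integral>q. \<phi> q powr p \<partial>m) - P powr p * measure m A)"
    using \<phi>p ind[OF S] ind[OF A] by (simp add: space_m)
  also have "\<dots> \<le> \<kappa> powr p * (\<integral>q. \<phi> q powr p \<partial>m)"
  proof (rule mult_left_mono)
    have "P powr 1 \<le> P powr p" using P(2) p by (intro powr_mono) auto
    then have "P * measure m A \<le> P powr p * measure m A" using P(2) by (intro mult_right_mono) auto
    then show "measure m ?S + (\<integral>q. \<phi> q powr p \<partial>m) - P powr p * measure m A \<le> (\<integral>q. \<phi> q powr p \<partial>m)"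
      using mass by linarith
  qed simp
  finally show "(\<integral>q. g q powr p \<partial>m) \<le> \<kappa> powr p * (\<integral>q. \<phi> q powr p \<partial>m)" .
qed

definition log_mass_ratio :: "nat \<Rightarrow> (nat \<Rightarrow> 'a set) \<Rightarrow> real" where
  "log_mass_ratio k A =
     (MAX \<alpha>\<in>{..k}. ln (exp 1 * (1 - (\<Sum>\<beta>\<in>{..k} - {\<alpha>}. measure m (A \<beta>))) / measure m (A \<alpha>)))"

lemma separation_le_riem_dist:
  assumes "\<alpha> \<le> k" "\<beta> \<le> k" "\<alpha> \<noteq> \<beta>" "x \<in> A \<alpha>" "y \<in> A \<beta>"
  shows "separation M k A \<le> riem_dist M x y"
proof -
  have "{riem_setdist M (A \<alpha>) (A \<beta>) |\<alpha> \<beta>. \<alpha> \<le> k \<and> \<beta> \<le> k \<and> \<alpha> \<noteq> \<beta>}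
      \<subseteq> (\<lambda>(\<alpha>, \<beta>). riem_setdist M (A \<alpha>) (A \<beta>)) ` ({..k} \<times> {..k})" by auto
  then have "finite {riem_setdist M (A \<alpha>) (A \<beta>) |\<alpha> \<beta>. \<alpha> \<le> k \<and> \<beta> \<le> k \<and> \<alpha> \<noteq> \<beta>}"
    by (rule finite_subset) simp
  then have "separation M k A \<le> riem_setdist M (A \<alpha>) (A \<beta>)"
    unfolding separation_def by (rule Min_le) (use assms in blast)
  also have "\<dots> \<le> riem_dist M x y"
    unfolding riem_setdist_def using assms(4,5) by (meson INF_lower INF_lower2)
  finally show ?thesis .
qed

text \<open>Since \<open>2T\<close> is less than the separation, chains of length at most \<open>T\<close> from different sets never
    meet.
  The common rate \<open>\<kappa>\<close> is determined by the set with the largest logarithm and is more than sufficient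
  for the other sets.\<close>

lemma poincare_const_le_separation:
  assumes k: "1 \<le> k" and p: "1 \<le> p" and A: "\<And>\<alpha>. \<alpha> \<le> k \<Longrightarrow> A \<alpha> \<in> sets borel"
    and pos: "\<And>\<alpha>. \<alpha> \<le> k \<Longrightarrow> measure m (A \<alpha>) \<noteq> 0"
    and T: "0 < T" "ennreal (2 * T) < separation M k A" and \<epsilon>: "0 < \<epsilon>"
  shows "1 \<le> log_mass_ratio k A"
    and "poincare_const M m k p \<le> ereal ((log_mass_ratio k A / T * (1 + \<epsilon>)) powr p)"
proof -
  define X where "X = log_mass_ratio k A"
  define N where "N \<alpha> = chain_nbhd (A \<alpha>) T" for \<alpha>
  have N_disj: "\<alpha> = \<beta>" if le: "\<alpha> \<le> k" "\<beta> \<le> k" and x: "x \<in> N \<alpha>" "x \<in> N \<beta>" for \<alpha> \<beta> x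
  proof (rule ccontr)
    assume ne: "\<alpha> \<noteq> \<beta>"
    obtain a L b L' where c: "a \<in> A \<alpha>" "L \<le> T" "chain a L x" "b \<in> A \<beta>" "L' \<le> T" "chain b L' x"
      using x unfolding N_def chain_nbhd_def by blast
    have "chain a (L + L') b" by (rule chain_trans[OF chain_sym[OF c(6)] c(3)])
    then have "riem_dist M a b \<le> ennreal (L + L')" by (rule riem_dist_le_chain)
    also have "\<dots> \<le> ennreal (2 * T)" using c(2,5) by (intro ennreal_leI) simp
    also have "\<dots> < separation M k A" by (rule T(2))
    also have "\<dots> \<le> riem_dist M a b" by (rule separation_le_riem_dist[OF le ne c(1,4)])
    finally show False by simp
  qed
  have A_N: "A \<alpha> \<subseteq> N \<alpha>" for \<alpha> unfolding N_def by (rule chain_nbhd_superset) (use T in simp)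
  have mass: "measure m S \<le> 1 - (\<Sum>\<beta>\<in>{..k} - {\<alpha>}. measure m (A \<beta>))"
    if \<alpha>: "\<alpha> \<le> k" and S: "S \<in> sets borel" "S \<subseteq> N \<alpha>" for \<alpha> S
  proof -
    define B where "B = A(\<alpha> := S)"
    have B_N: "B \<beta> \<subseteq> N \<beta>" for \<beta> using A_N S(2) by (simp add: B_def)
    have "measure m (\<Union>\<beta>\<in>{..k}. B \<beta>) = (\<Sum>\<beta>\<in>{..k}. measure m (B \<beta>))"
    proof (rule m.finite_measure_finite_Union)
      show "B ` {..k} \<subseteq> sets m" using A S(1) by (auto simp: B_def sets_m)
      show "disjoint_family_on B {..k}"
        unfolding disjoint_family_on_def using N_disj B_N by blast
    qed simp
    moreover have "measure m (\<Union>\<beta>\<in>{..k}. B \<beta>) \<le> 1"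
      using m.bounded_measure measure_m_UNIV by (metis space_m)
    moreover have "(\<Sum>\<beta>\<in>{..k}. measure m (B \<beta>)) = measure m S + (\<Sum>\<beta>\<in>{..k} - {\<alpha>}. measure m (A \<beta>))"
      using \<alpha> by (subst sum.remove[of _ \<alpha>]) (auto simp: B_def intro!: sum.cong)
    ultimately show ?thesis by simp
  qed
  define \<mu> where "\<mu> \<alpha> = measure m (A \<alpha>)" for \<alpha>
  define Q where "Q \<alpha> = 1 - (\<Sum>\<beta>\<in>{..k} - {\<alpha>}. measure m (A \<beta>))" for \<alpha>
  have \<mu>: "0 < \<mu> \<alpha>" if "\<alpha> \<le> k" for \<alpha> using pos[OF that] by (simp add: \<mu>_def less_le measure_nonneg)
  have Q: "\<mu> \<alpha> \<le> Q \<alpha>" if "\<alpha> \<le> k" for \<alpha> unfolding \<mu>_def Q_def by (rule mass[OF that A[OF that] A_N])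
  have X: "1 + ln (Q \<alpha> / \<mu> \<alpha>) \<le> X" if \<alpha>: "\<alpha> \<le> k" for \<alpha>
  proof -
    have "0 < Q \<alpha> / \<mu> \<alpha>" using \<mu>[OF \<alpha>] Q[OF \<alpha>] by (intro divide_pos_pos) linarith+
    then have "ln (exp 1 * (Q \<alpha> / \<mu> \<alpha>)) = ln (exp 1) + ln (Q \<alpha> / \<mu> \<alpha>)"
      by (intro ln_mult_pos) simp_all
    then have "1 + ln (Q \<alpha> / \<mu> \<alpha>) = ln (exp 1 * (Q \<alpha> / \<mu> \<alpha>))" by (simp only: ln_exp)
    also have "\<dots> = ln (exp 1 * Q \<alpha> / \<mu> \<alpha>)" by simp
    also have "\<dots> \<le> X"
      unfolding X_def log_mass_ratio_def Q_def \<mu>_def by (rule Max_ge) (use \<alpha> in auto)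
    finally show ?thesis .
  qed
  show X1: "1 \<le> log_mass_ratio k A"
  proof -
    have "0 \<le> ln (Q 0 / \<mu> 0)" using \<mu>[of 0] Q[of 0] by (intro ln_ge_zero) simp
    then show ?thesis using X[of 0] by (simp add: X_def)
  qed
  define \<kappa> where "\<kappa> = X / T"
  have \<kappa>: "0 < \<kappa>" "\<kappa> * T = X" using X1 T(1) by (simp_all add: \<kappa>_def X_def)
  define P where "P = linear_then_exp X"
  have P: "P = exp (X - 1)" unfolding P_def by (rule linear_then_exp_values(2)) (use X1 in \<open>simp
      add: X_def\<close>)
  have P1: "1 \<le> P" using X1 unfolding P by (simp add: X_def)
  have PQ: "Q \<alpha> \<le> P * \<mu> \<alpha>" if \<alpha>: "\<alpha> \<le> k" for \<alpha>
  proof -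
    have r: "0 < Q \<alpha> / \<mu> \<alpha>" using \<mu>[OF \<alpha>] Q[OF \<alpha>] by (intro divide_pos_pos) linarith+
    have "exp (ln (Q \<alpha> / \<mu> \<alpha>)) \<le> P" unfolding P using X[OF \<alpha>] by simp
    then have "Q \<alpha> / \<mu> \<alpha> \<le> P" using r by simp
    then show ?thesis using \<mu>[OF \<alpha>] by (simp add: field_simps)
  qed
  define g where "g \<alpha> \<phi> q = (if q \<in> A \<alpha> \<or> \<phi> q = 0 then 0 else \<kappa> * (1 + \<epsilon>) * max 1 (\<phi> q))"
    for \<alpha> and \<phi> :: "'a \<Rightarrow> real" and q
  have "\<exists>\<phi>. C1_slope \<phi> (g \<alpha> \<phi>) \<and> (\<forall>x. x \<in> A \<alpha> \<longrightarrow> \<phi> x = P) \<and> (\<forall>x. \<phi> x \<noteq> 0 \<longrightarrow> x \<in> N \<alpha>) \<and> (\<forall>x. 0 \<le> \<phi> x)"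
      for \<alpha>
    unfolding g_def N_def P_def \<kappa>(2)[symmetric]
    by (rule exists_test_function[OF compact_space T(1) \<epsilon> \<kappa>(1), of "A \<alpha>"]) blast
  then have "\<forall>\<alpha>. \<exists>\<phi>. C1_slope \<phi> (g \<alpha> \<phi>) \<and> (\<forall>x. x \<in> A \<alpha> \<longrightarrow> \<phi> x = P) \<and> (\<forall>x. \<phi> x \<noteq> 0 \<longrightarrow> x \<in> N \<alpha>) \<and>
      (\<forall>x. 0 \<le> \<phi> x)" ..
  from choice[OF this] obtain \<phi> where \<phi>: "\<And>\<alpha>. C1_slope (\<phi> \<alpha>) (g \<alpha> (\<phi> \<alpha>))" "\<And>\<alpha> x. x \<in> A \<alpha> \<Longrightarrow> \<phi> \<alpha> x = P"
    "\<And>\<alpha> x. \<phi> \<alpha> x \<noteq> 0 \<Longrightarrow> x \<in> N \<alpha>" "\<And>\<alpha> x. 0 \<le> \<phi> \<alpha> x" by blast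
  have supp: "measure m {q. \<phi> \<alpha> q \<noteq> 0} \<le> P * measure m (A \<alpha>)" if \<alpha>: "\<alpha> \<le> k" for \<alpha>
  proof -
    have [measurable]: "\<phi> \<alpha> \<in> borel_measurable borel" by (rule C1_slope_measurable[OF \<phi>(1)])
    have "{q. \<phi> \<alpha> q \<noteq> 0} \<in> sets borel" by measurable
    then have "measure m {q. \<phi> \<alpha> q \<noteq> 0} \<le> Q \<alpha>" unfolding Q_def by (rule mass[OF \<alpha>]) (use \<phi>(3) in blast)
    then show ?thesis using PQ[OF \<alpha>] by (simp add: \<mu>_def)
  qed
  have \<kappa>\<epsilon>: "0 \<le> \<kappa> * (1 + \<epsilon>)" using \<kappa>(1) \<epsilon> by simp
  note slope = slope_integral_le[OF A C1_slope_continuous[OF \<phi>(1)] \<phi>(4) \<phi>(2) P1 supp p \<kappa>\<epsilon>, folded g_def]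
  have "poincare_const M m k p \<le> ereal ((\<kappa> * (1 + \<epsilon>)) powr p)"
  proof (rule poincare_const_le_disjoint_functions[OF p, of _ _ \<phi> "\<lambda>\<alpha>. g \<alpha> (\<phi> \<alpha>)"])
    show "\<not> ae_zero m (\<phi> \<alpha>)" if \<alpha>: "\<alpha> \<le> k" for \<alpha>
    proof
      assume "ae_zero m (\<phi> \<alpha>)"
      then have "AE q in m. q \<notin> A \<alpha>"
        unfolding ae_zero_def by eventually_elim (use \<phi>(2)[of _ \<alpha>] P1 in force)
      moreover have "A \<alpha> \<in> sets m" using A[OF \<alpha>] by (simp add: sets_m)
      ultimately have "emeasure m (A \<alpha>) = 0" by (simp add: AE_iff_measurable[OF \<open>A \<alpha> \<in> sets m\<close>] space_m)
      then show False using pos[OF \<alpha>] by (simp add: measure_def)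
    qed
    show "\<alpha> = \<beta>" if "\<alpha> \<le> k" "\<beta> \<le> k" "\<phi> \<alpha> q \<noteq> 0" "\<phi> \<beta> q \<noteq> 0" for \<alpha> \<beta> q
      using N_disj[OF that(1,2)] \<phi>(3) that(3,4) by blast
    show "0 \<le> g \<alpha> (\<phi> \<alpha>) q" for \<alpha> q using \<kappa>\<epsilon> by (simp add: g_def)
    show "g \<alpha> (\<phi> \<alpha>) q = 0" if "\<phi> \<alpha> q = 0" for \<alpha> q using that by (simp add: g_def)
  qed (use \<phi>(1,4) slope in simp_all)
  then show "poincare_const M m k p \<le> ereal ((log_mass_ratio k A / T * (1 + \<epsilon>)) powr p)"
    by (simp add: \<kappa>_def X_def)
qed

end

theorem theorem1p1:
  fixes M :: "('a::{t2_space, second_countable_topology}, 'n::finite) riem"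
    and v :: "'a measure" and f :: "'a \<Rightarrow> real"
    and k :: nat and p :: real and A :: "nat \<Rightarrow> 'a set"
  assumes "closed_weighted_riemannian_manifold M v f"
    and "1 \<le> k" and "1 \<le> p"
    and "\<And>\<alpha>. \<alpha> \<le> k \<Longrightarrow> A \<alpha> \<in> sets borel"
  shows "ereal_powr (poincare_const M (weighted_measure v f) k p) (1 / p)
           \<le> separation_bound M (weighted_measure v f) k A"
proof -
  interpret weighted_manifold M v f
    using assms(1) by unfold_locales (simp_all add: closed_weighted_riemannian_manifold_def)
  show ?thesis
  proof (cases "separation M k A = 0 \<or> (\<exists>\<alpha>\<le>k. measure m (A \<alpha>) = 0)")
    case True
    then show ?thesis by (simp add: separation_bound_def)
  next
    case False
    then have sep: "0 < separation M k A" and pos: "\<And>\<alpha>. \<alpha> \<le> k \<Longrightarrow> measure m (A \<alpha>) \<noteq> 0"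
      by (auto simp: less_le)
    define X where "X = log_mass_ratio k A"
    define D where "D = enn2real (separation M k A)"
    have bound: "separation_bound M m k A = ereal (2 / D * X)"
      using False by (simp add: separation_bound_def D_def X_def log_mass_ratio_def)
    note main = poincare_const_le_separation[OF assms(2,3) assms(4) pos]
    \<comment> \<open>Some admissible \<open>T\<close> is needed to know that the Poincare constant is finite.\<close>
    obtain T0 where T0: "0 < T0" "ennreal (2 * T0) < separation M k A"
    proof (cases "separation M k A")
      case (real d)
      then show thesis using that[of "d / 4"] sep by (simp add: ennreal_less_iff)
    next
      case top
      then show thesis using that[of 1] by simp
    qed
    have X: "1 \<le> X" unfolding X_def by (rule main(1)[OF _ _ T0]) (simp_all, rule zero_less_one)
    obtain r where r: "poincare_const M m k p = ereal r" "0 \<le> r"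
      using poincare_const_nonneg[OF assms(2), of p] main(2)[OF _ _ T0 zero_less_one]
      by (cases "poincare_const M m k p") auto
    define t where "t = r powr (1 / p)"
    have t: "ereal_powr (poincare_const M m k p) (1 / p) = ereal t"
      by (simp add: ereal_powr_def r(1) t_def)
    have t_le: "t \<le> X / T * (1 + \<epsilon>)" if "0 < T" "ennreal (2 * T) < separation M k A" "0 < \<epsilon>" for T \<epsilon>
    proof -
      have "r \<le> (X / T * (1 + \<epsilon>)) powr p" using main(2)[OF _ _ that] by (simp add: r(1) X_def)
      then have "t \<le> ((X / T * (1 + \<epsilon>)) powr p) powr (1 / p)"
        unfolding t_def using r(2) assms(3) by (intro powr_mono2) auto
      also have "\<dots> = X / T * (1 + \<epsilon>)"
        using assms(3) X that by (simp add: powr_powr)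
      finally show ?thesis .
    qed
    have "t \<le> 2 / D * X"
    proof (cases "separation M k A")
      case (real d)
      then have d: "0 < d" "D = d" using sep by (auto simp: D_def)
      have "t \<le> 2 / d * X * ((1 + inverse (real (Suc n))) * (1 + inverse (real (Suc n))))" for n
      proof -
        define \<epsilon> where "\<epsilon> = inverse (real (Suc n))"
        have \<epsilon>: "0 < \<epsilon>" by (simp add: \<epsilon>_def)
        have "2 * (d / (2 * (1 + \<epsilon>))) < d" using d(1) \<epsilon> by (simp add: field_simps)
        then have "t \<le> X / (d / (2 * (1 + \<epsilon>))) * (1 + \<epsilon>)"
          using d(1) \<epsilon> real by (intro t_le) (auto simp: ennreal_less_iff)
        also have "\<dots> = 2 / d * X * ((1 + \<epsilon>) * (1 + \<epsilon>))" using d(1) \<epsilon> by (simp add: field_simps)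
        finally show ?thesis unfolding \<epsilon>_def .
      qed
      moreover have "(\<lambda>n. 2 / d * X * ((1 + inverse (real (Suc n))) * (1 + inverse (real (Suc n))))) \<longlonglongrightarrow>
          2 / d * X * ((1 + 0) * (1 + 0))"
        by (intro tendsto_intros LIMSEQ_inverse_real_of_nat)
      ultimately have "t \<le> 2 / d * X * ((1 + 0) * (1 + 0))" by (intro LIMSEQ_le_const) auto
      then show ?thesis by (simp add: d)
    next
      case top
      \<comment> \<open>Here \<open>D = 0\<close> and the right-hand side is \<open>2 / 0 * X = 0\<close>; so \<open>T\<close> must tend to infinity.\<close>
      have "t \<le> 2 * X * inverse (real (Suc n))" for n
        using t_le[of "real (Suc n)" 1] top by (simp add: field_simps)
      moreover have "(\<lambda>n. 2 * X * inverse (real (Suc n))) \<longlonglongrightarrow> 2 * X * 0"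
        by (intro tendsto_intros LIMSEQ_inverse_real_of_nat)
      ultimately have "t \<le> 2 * X * 0" by (intro LIMSEQ_le_const) auto
      then show ?thesis by (simp add: D_def top)
    qed
    then show ?thesis unfolding bound t by simp
  qed
qed

end
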